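(* In dimension $3$, the relative frequencies of Klein sail faces satisfy $$\sum_{[f]}\operatorname{rel}([f])<\infty,$$ where the sum is over all integer equivalence classes of faces. As a result, for every $C>0$ there exist only finitely many pairwise integer non-equivalent faces $f$ with $\operatorname{rel}([f])>C$.
   Context: For linearly independent rays $L_1,L_2,L_3\subset\mathbb R^3$ from the origin, let $C_{L_1,L_2,L_3}$ be the closed simplicial cone they generate. The Klein sail associated with it is the boundary of $\operatorname{conv}((C_{L_1,L_2,L_3}\cap\mathbb Z^3)\setminus\{0\})$; its two-dimensional facets are its faces. Only cones whose boundary planes contain no non-zero lattice point are considered (this excludes a null set of cones); then all faces are bounded integral polygons. A face is identified with the set of lattice points it contains, which is a convex subset of $\mathbb Z^3$ contained in an affine rational plane. The space $\mathcal S_3$ of Klein sails in $\mathbb R^3$ is identified with the space of simplicial cones $\{g\mathbb R^3_{\ge0}:g\in\mathrm{SL}_3(\mathbb R)\}$ (unordered triples of linearly independent rays), a homogeneous space of $\mathrm{SL}_3(\mathbb R)$: it is the quotient of $\mathrm{SL}_3(\mathbb R)$ by the stabilizer of $\mathbb R^3_{\ge 0}$, which is generated by the diagonal matrices with positive entries and determinant one together with permutations of the rays. It carries an $\mathrm{SL}_3(\mathbb R)$-invariant measure, unique up to scaling; fix one, $\mu$. Two convex subsets $f_1,f_2\subset\mathbb Z^3$ contained in affine rational planes are integer equivalent if $f_2=\gamma f_1$ for some $\gamma\in\mathrm{SL}_3(\mathbb Z)$; $[f]$ denotes the class. The relative frequency is $\operatorname{rel}(f)=\mu(\{\mathcal K\in\mathcal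 S_3: f\text{ appears as a face of }\mathcal K\})$; it depends only on $[f]$ and is denoted $\operatorname{rel}([f])$. *)

theory Defs
  imports "HOL-Analysis.Analysis"
begin

section \<open>The special linear groups and the integer lattice\<close>

definition SL3R :: "(real^3^3) set" where
  "SL3R = {g. det g = 1}"

definition SL3Z :: "(real^3^3) set" where
  "SL3Z = {g \<in> SL3R. \<forall>i j. g $ i $ j \<in> \<int>}"

definition lattice :: "(real^3) set" where
  "lattice = {x. \<forall>i. x $ i \<in> \<int>}"

definition act :: "real^3^3 \<Rightarrow> (real^3) set \<Rightarrow> (real^3) set" where
  "act g S = ((*v) g) ` S"

section \<open>Simplicial cones and Klein sails\<close>

definition orthant :: "(real^3) set" where
  "orthant = {x. \<forall>i. 0 \<le> x $ i}"

text \<open>A Klein sail is represented by its simplicial cone. Cones are point sets, so the order of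
  the three generating rays (the columns of \<open>g\<close>, up to positive scaling) is forgotten.\<close>

definition cones :: "(real^3) set set" where
  "cones = {act g orthant | g. g \<in> SL3R}"

text \<open>The boundary planes of the cone are the linear spans of its two-dimensional faces.\<close>

definition generic_cone :: "(real^3) set \<Rightarrow> bool" where
  "generic_cone C \<longleftrightarrow> C \<in> cones \<and> (\<forall>F. F facet_of C \<longrightarrow> span F \<inter> lattice = {0})"

definition klein_polyhedron :: "(real^3) set \<Rightarrow> (real^3) set" where
  "klein_polyhedron C = convex hull (C \<inter> lattice - {0})"

definition klein_sail :: "(real^3) set \<Rightarrow> (real^3) set" where
  "klein_sail C = frontier (klein_polyhedron C)"

text \<open>The faces of the sail are the two-dimensional faces of the polyhedron it bounds; a face is
  identified with its set of lattice points.\<close>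

definition face_of_sail :: "(real^3) set \<Rightarrow> (real^3) set \<Rightarrow> bool" where
  "face_of_sail f C \<longleftrightarrow>
     (\<exists>F. F face_of klein_polyhedron C \<and> aff_dim F = 2 \<and> F \<subseteq> klein_sail C \<and> f = F \<inter> lattice)"

definition sail_faces :: "(real^3) set set" where
  "sail_faces = {f. \<exists>C. generic_cone C \<and> face_of_sail f C}"

text \<open>\<open>SL3Z\<close> permutes the convex subsets of the lattice contained in rational planes, so the
  class of such a set is the same whether or not the relation is restricted to them.\<close>

definition integer_equiv :: "((real^3) set \<times> (real^3) set) set" where
  "integer_equiv = {(f1, f2). \<exists>\<gamma>\<in>SL3Z. f2 = act \<gamma> f1}"

definition face_classes :: "(real^3) set set set" where
  "face_classes = sail_faces // integer_equiv"

section \<open>The space of sails and its invariant measure\<close>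

text \<open>The topology of the homogeneous space: the quotient topology of the orbit map.\<close>

definition cone_topology :: "(real^3) set topology" where
  "cone_topology = topology (\<lambda>U. U \<subseteq> cones \<and>
     openin (top_of_set SL3R) {g \<in> SL3R. act g orthant \<in> U})"

text \<open>A non-zero Borel measure, finite on compact sets, invariant under \<open>SL3R\<close>. Local finiteness
  is part of what makes the invariant measure unique up to scaling.\<close>

definition invariant_measure :: "(real^3) set measure \<Rightarrow> bool" where
  "invariant_measure \<mu> \<longleftrightarrow>
     space \<mu> = cones \<and>
     sets \<mu> = sigma_sets cones {U. openin cone_topology U} \<and>
     emeasure \<mu> cones \<noteq> 0 \<and>
     (\<forall>K. compactin cone_topology K \<longrightarrow> emeasure \<mu> K < \<infinity>) \<and>
     (\<forall>g\<in>SL3R. \<forall>A\<in>sets \<mu>. emeasure \<mu> (act g ` A) = emeasure \<mu> A)"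

text \<open>The set measured here is Borel, so \<open>emeasure\<close> does not fall back to 0: for a planar \<open>f\<close> whose
  convex hull is two-dimensional, having \<open>f\<close> as a face means \<open>f \<subseteq> C\<close> and \<open>x \<notin> C\<close> for every non-zero
  lattice point \<open>x\<close> beyond the plane of \<open>f\<close>, or on that plane but not in \<open>f\<close>.\<close>

definition rel :: "(real^3) set measure \<Rightarrow> (real^3) set \<Rightarrow> ennreal" where
  "rel \<mu> f = emeasure \<mu> {C. generic_cone C \<and> face_of_sail f C}"

definition rel_class :: "(real^3) set measure \<Rightarrow> (real^3) set set \<Rightarrow> ennreal" where
  "rel_class \<mu> c = the_elem (rel \<mu> ` c)"

section \<open>Well-definedness\<close>

lemma SL3R_mult: "g \<in> SL3R \<Longrightarrow> h \<in> SL3R \<Longrightarrow> g ** h \<in> SL3R"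
  by (simp add: SL3R_def det_mul)

lemma SL3R_inverse:
  assumes "g \<in> SL3R"
  obtains h where "h \<in> SL3R" "g ** h = mat 1" "h ** g = mat 1"
proof -
  from assms have "invertible g"
    by (simp add: SL3R_def invertible_det_nz)
  then obtain h where h: "g ** h = mat 1" "h ** g = mat 1"
    unfolding invertible_def by blast
  moreover have "h \<in> SL3R"
    using assms arg_cong[OF h(1), of det] by (simp add: SL3R_def det_mul)
  ultimately show ?thesis using that by blast
qed

lemma act_mult: "act (g ** h) S = act g (act h S)"
  by (simp add: act_def image_image matrix_vector_mul_assoc)

lemma act_id [simp]: "act (mat 1) S = S"
  by (simp add: act_def)

lemma SL3R_linear_inj:
  assumes "g \<in> SL3R" shows "linear ((*v) g)" "inj ((*v) g)"
  using assms by (auto simp: SL3R_def invertible_det_nz intro: inj_matrix_vector_mult)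

lemma quotient_map_cone_topology:
  "quotient_map (top_of_set SL3R) cone_topology (\<lambda>g. act g orthant)"
proof -
  let ?P = "\<lambda>U. U \<subseteq> cones \<and> openin (top_of_set SL3R) {g \<in> SL3R. act g orthant \<in> U}"
  have 1: "{g \<in> SL3R. act g orthant \<in> S \<inter> T}
      = {g \<in> SL3R. act g orthant \<in> S} \<inter> {g \<in> SL3R. act g orthant \<in> T}" for S T by auto
  have 2: "{g \<in> SL3R. act g orthant \<in> \<Union>\<K>}
      = (\<Union>K\<in>\<K>. {g \<in> SL3R. act g orthant \<in> K})" for \<K> by auto
  have "istopology ?P"
    unfolding istopology_def 1 2 by (auto intro!: openin_Int openin_Union)
  then have op: "openin cone_topology U \<longleftrightarrow> ?P U" for U
    by (simp add: cone_topology_def topology_inverse')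
  have "{g \<in> SL3R. act g orthant \<in> cones} = SL3R"
    by (auto simp: cones_def)
  then have "openin cone_topology cones"
    by (simp add: op)
  then have top: "topspace cone_topology = cones"
    using op by (meson openin_subset openin_topspace subset_antisym)
  show ?thesis
    unfolding quotient_map_def top op by (auto simp: cones_def)
qed

lemma topspace_cone_topology [simp]: "topspace cone_topology = cones"
proof -
  have "(\<lambda>g. act g orthant) ` SL3R = topspace cone_topology"
    using quotient_map_cone_topology unfolding quotient_map_def by simp
  then show ?thesis by (auto simp: cones_def)
qed

lemma openin_cone_topology:
  "openin cone_topology U \<longleftrightarrow>
     U \<subseteq> cones \<and> openin (top_of_set SL3R) {g \<in> SL3R. act g orthant \<in> U}"
proof -
  have "openin (top_of_set SL3R) {g \<in> SL3R. act g orthant \<in> U} \<longleftrightarrow> openin cone_topology U"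
    if "U \<subseteq> cones"
    using quotient_map_cone_topology that unfolding quotient_map_def by simp
  then show ?thesis using openin_subset[of cone_topology U] by auto
qed

lemma act_cones:
  assumes "g \<in> SL3R" "C \<in> cones" shows "act g C \<in> cones"
proof -
  obtain k where k: "k \<in> SL3R" "C = act k orthant"
    using assms(2) by (auto simp: cones_def)
  then have "act g C = act (g ** k) orthant" by (simp add: act_mult)
  then show ?thesis using SL3R_mult[OF assms(1) k(1)] unfolding cones_def by blast
qed

lemma act_inverse:
  assumes "g ** h = mat 1" shows "act g (act h S) = S"
  using act_mult[of g h S] assms by simp

lemma image_act_eq:
  assumes "g ** h = mat 1" "h ** g = mat 1"
  shows "act g ` A = {C. act h C \<in> A}"
proof (intro set_eqI iffI)
  fix C assume "C \<in> act g ` A"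
  then obtain D where "D \<in> A" "C = act g D" by blast
  then show "C \<in> {C. act h C \<in> A}" by (simp add: act_inverse[OF assms(2)])
next
  fix C assume "C \<in> {C. act h C \<in> A}"
  then have "act h C \<in> A" "C = act g (act h C)" by (simp_all add: act_inverse[OF assms(1)])
  then show "C \<in> act g ` A" by (rule rev_image_eqI)
qed

lemma openin_act:
  assumes g: "g \<in> SL3R" and U: "openin cone_topology U"
  shows "openin cone_topology (act g ` U)"
proof -
  obtain h where h: "h \<in> SL3R" "g ** h = mat 1" "h ** g = mat 1"
    using SL3R_inverse[OF g] .
  have *: "{x \<in> SL3R. act x orthant \<in> act g ` U}
      = {x \<in> SL3R. h ** x \<in> {x \<in> SL3R. act x orthant \<in> U}}"
    using h SL3R_mult by (auto simp: image_act_eq[OF h(2,3)] act_mult)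
  have "continuous_on SL3R (\<lambda>x. h ** x)"
    unfolding matrix_matrix_mult_def by (intro continuous_intros)
  then have "continuous_map (top_of_set SL3R) (top_of_set SL3R) (\<lambda>x. h ** x)"
    using h(1) SL3R_mult by auto
  then have "openin (top_of_set SL3R) {x \<in> SL3R. h ** x \<in> {x \<in> SL3R. act x orthant \<in> U}}"
    using U unfolding openin_cone_topology continuous_map by auto
  then show ?thesis
    using U act_cones[OF g] unfolding openin_cone_topology * by auto
qed

lemma sets_act:
  assumes g: "g \<in> SL3R" and \<mu>: "invariant_measure \<mu>" and A: "A \<in> sets \<mu>"
  shows "act g ` A \<in> sets \<mu>"
proof -
  obtain h where h: "h \<in> SL3R" "g ** h = mat 1" "h ** g = mat 1"
    using SL3R_inverse[OF g] .
  have "act g ` A \<in> sigma_sets cones {U. openin cone_topology U}"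
    if "A \<in> sigma_sets cones {U. openin cone_topology U}"
    using that
  proof induction
    case (Basic a)
    then show ?case using openin_act[OF g] by (auto intro: sigma_sets.Basic)
  next
    case Empty
    then show ?case by (simp add: sigma_sets.Empty)
  next
    case (Compl a)
    have "act g ` (cones - a) = cones - act g ` a"
      unfolding image_act_eq[OF h(2,3)]
      using act_cones[OF h(1)] act_cones[OF g] act_inverse[OF h(2)] by (auto, metis)
    then show ?case using Compl by (simp add: sigma_sets.Compl)
  next
    case (Union a)
    then show ?case by (simp add: image_UN sigma_sets.Union)
  qed
  then show ?thesis using \<mu> A by (simp add: invariant_measure_def)
qed

lemma emeasure_act:
  assumes g: "g \<in> SL3R" and \<mu>: "invariant_measure \<mu>"
  shows "emeasure \<mu> (act g ` A) = emeasure \<mu> A"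
proof (cases "A \<in> sets \<mu>")
  case True
  then show ?thesis using g \<mu> by (simp add: invariant_measure_def)
next
  case False
  obtain h where h: "h \<in> SL3R" "g ** h = mat 1" "h ** g = mat 1"
    using SL3R_inverse[OF g] .
  have "act h ` act g ` A = A"
    by (simp add: image_image act_inverse[OF h(3)])
  then have "act g ` A \<notin> sets \<mu>"
    using False sets_act[OF h(1) \<mu>] by metis
  then show ?thesis using False by (simp add: emeasure_notin_sets)
qed

lemma SL3Z_mult:
  assumes "g \<in> SL3Z" "h \<in> SL3Z" shows "g ** h \<in> SL3Z"
proof -
  have "(g ** h) $ i $ j \<in> \<int>" for i j
  proof -
    have "(\<Sum>k\<in>UNIV. g $ i $ k * h $ k $ j) \<in> \<int>"
      using assms by (intro Ints_sum Ints_mult) (simp_all add: SL3Z_def)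
    then show ?thesis by (simp add: matrix_matrix_mult_def)
  qed
  moreover have "g ** h \<in> SL3R"
    using assms by (intro SL3R_mult) (simp_all add: SL3Z_def)
  ultimately show ?thesis by (simp add: SL3Z_def)
qed

lemma Ints_det:
  fixes M :: "real^3^3"
  assumes "\<And>i j. M $ i $ j \<in> \<int>" shows "det M \<in> \<int>"
  unfolding det_def by (intro Ints_sum Ints_mult Ints_prod assms Ints_of_int)

lemma SL3Z_inverse:
  assumes "g \<in> SL3Z"
  obtains h where "h \<in> SL3Z" "g ** h = mat 1" "h ** g = mat 1"
proof -
  from assms have g: "g \<in> SL3R" by (simp add: SL3Z_def)
  then obtain h where h: "h \<in> SL3R" "g ** h = mat 1" "h ** g = mat 1"
    using SL3R_inverse by blast
  have "h $ i $ j \<in> \<int>" for i j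
  proof -
    let ?M = "\<chi> k l. if l = i then (axis j 1 :: real^3) $ k else g $ k $ l"
    have det: "det g = 1" using g by (simp add: SL3R_def)
    have "g *v (h *v axis j 1) = axis j 1"
      by (simp add: matrix_vector_mul_assoc h(2))
    then have "h *v axis j 1 = (\<chi> i. det (\<chi> k l. if l = i then axis j 1 $ k else g $ k $ l) / det g)"
      using cramer[of g "h *v axis j 1" "axis j 1"] det by simp
    then have "(h *v axis j 1) $ i = det ?M"
      using det by simp
    moreover have "(h *v axis j 1) $ i = h $ i $ j"
      by (simp add: matrix_vector_mul_component inner_axis)
    moreover have "det ?M \<in> \<int>"
      using assms by (intro Ints_det) (simp add: SL3Z_def axis_def)
    ultimately show ?thesis by simp
  qed
  then have "h \<in> SL3Z" using h(1) by (simp add: SL3Z_def)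
  then show ?thesis using h by (intro that)
qed

lemma equiv_integer_equiv: "equiv UNIV integer_equiv"
proof (rule equivI)
  show "integer_equiv \<subseteq> UNIV \<times> UNIV" by simp
  have "(mat 1 :: real^3^3) $ i $ j \<in> \<int>" for i j
    by (simp add: mat_def)
  then have "mat 1 \<in> SL3Z"
    unfolding SL3Z_def SL3R_def by simp
  then show "refl integer_equiv"
    unfolding refl_on_def integer_equiv_def by (force intro: bexI[of _ "mat 1"])
  show "sym integer_equiv"
    unfolding sym_def integer_equiv_def using SL3Z_inverse act_inverse by (clarsimp, metis)
  show "trans integer_equiv"
    unfolding trans_def integer_equiv_def using SL3Z_mult act_mult by (clarsimp, metis)
qed

lemma SL3Z_lattice:
  assumes "\<gamma> \<in> SL3Z" shows "act \<gamma> lattice = lattice"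
proof -
  have sub: "act g lattice \<subseteq> lattice" if "g \<in> SL3Z" for g
  proof
    fix y assume "y \<in> act g lattice"
    then obtain x where x: "x \<in> lattice" "y = g *v x" by (auto simp: act_def)
    have "(\<Sum>j\<in>UNIV. g $ i $ j * x $ j) \<in> \<int>" for i
      using that x(1) by (intro Ints_sum Ints_mult) (simp_all add: SL3Z_def lattice_def)
    then show "y \<in> lattice" by (simp add: x(2) lattice_def matrix_vector_mult_def)
  qed
  obtain h where h: "h \<in> SL3Z" "\<gamma> ** h = mat 1" "h ** \<gamma> = mat 1"
    using SL3Z_inverse[OF assms] .
  have "act \<gamma> (act h lattice) \<subseteq> act \<gamma> lattice"
    using sub[OF h(1)] unfolding act_def[of \<gamma>] by (rule image_mono)
  then have "lattice \<subseteq> act \<gamma> lattice"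
    by (simp only: act_inverse[OF h(2)])
  then show ?thesis using sub[OF assms] by (intro equalityI)
qed

lemma generic_cone_act:
  assumes "\<gamma> \<in> SL3Z" "generic_cone C" shows "generic_cone (act \<gamma> C)"
proof -
  have \<gamma>: "\<gamma> \<in> SL3R" using assms by (simp add: SL3Z_def)
  note li = SL3R_linear_inj[OF \<gamma>]
  obtain h where h: "h \<in> SL3R" "\<gamma> ** h = mat 1" "h ** \<gamma> = mat 1"
    using SL3R_inverse[OF \<gamma>] .
  have "span F \<inter> lattice = {0}" if F: "F facet_of act \<gamma> C" for F
  proof -
    define G where "G = act h F"
    have FG: "F = act \<gamma> G" by (simp add: G_def act_inverse[OF h(2)])
    have "G facet_of C"
      using F li unfolding FG facet_of_def by (simp add: act_def face_of_linear_image)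
    then have "span G \<inter> lattice = {0}"
      using assms by (simp add: generic_cone_def)
    moreover have "span F \<inter> lattice = act \<gamma> (span G \<inter> lattice)"
      using li SL3Z_lattice[OF assms(1)] unfolding FG
      by (simp add: act_def linear_span_image image_Int)
    ultimately show ?thesis by (simp add: act_def)
  qed
  then show ?thesis using assms act_cones[OF \<gamma>] by (simp add: generic_cone_def)
qed

lemma klein_polyhedron_act:
  assumes "\<gamma> \<in> SL3Z" shows "klein_polyhedron (act \<gamma> C) = act \<gamma> (klein_polyhedron C)"
proof -
  have \<gamma>: "\<gamma> \<in> SL3R" using assms by (simp add: SL3Z_def)
  note li = SL3R_linear_inj[OF \<gamma>]
  have "act \<gamma> (C \<inter> lattice - {0}) = act \<gamma> C \<inter> lattice - {0}"
    using li SL3Z_lattice[OF assms] by (simp add: act_def image_Int image_set_diff)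
  then show ?thesis
    using convex_hull_linear_image[OF li(1)] by (simp add: klein_polyhedron_def act_def)
qed

lemma face_of_sail_act:
  assumes "\<gamma> \<in> SL3Z" "face_of_sail f C" shows "face_of_sail (act \<gamma> f) (act \<gamma> C)"
proof -
  have \<gamma>: "\<gamma> \<in> SL3R" using assms by (simp add: SL3Z_def)
  note li = SL3R_linear_inj[OF \<gamma>]
  obtain F where F: "F face_of klein_polyhedron C" "aff_dim F = 2" "F \<subseteq> klein_sail C"
      "f = F \<inter> lattice"
    using assms by (auto simp: face_of_sail_def)
  have "surj ((*v) \<gamma>)"
    using li linear_injective_imp_surjective by blast
  then have "klein_sail (act \<gamma> C) = act \<gamma> (klein_sail C)"
    using li unfolding klein_sail_def klein_polyhedron_act[OF assms(1)] frontier_def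
    by (simp add: act_def image_set_diff closure_injective_linear_image interior_injective_linear_image)
  then have "act \<gamma> F face_of klein_polyhedron (act \<gamma> C)" "aff_dim (act \<gamma> F) = 2"
      "act \<gamma> F \<subseteq> klein_sail (act \<gamma> C)"
    using F li unfolding klein_polyhedron_act[OF assms(1)]
    by (auto simp: act_def face_of_linear_image)
  moreover have "act \<gamma> f = act \<gamma> F \<inter> lattice"
    using li SL3Z_lattice[OF assms(1)] F(4) by (simp add: act_def image_Int)
  ultimately show ?thesis unfolding face_of_sail_def by blast
qed

lemma rel_act:
  assumes \<mu>: "invariant_measure \<mu>" and "\<gamma> \<in> SL3Z"
  shows "rel \<mu> (act \<gamma> f) = rel \<mu> f"
proof -
  obtain h where h: "h \<in> SL3Z" "\<gamma> ** h = mat 1" "h ** \<gamma> = mat 1"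
    using SL3Z_inverse[OF assms(2)] .
  have "{C. generic_cone C \<and> face_of_sail (act \<gamma> f) C}
      = act \<gamma> ` {C. generic_cone C \<and> face_of_sail f C}"
    unfolding image_act_eq[OF h(2,3)]
    using generic_cone_act face_of_sail_act assms(2) h(1) act_inverse[OF h(2)] act_inverse[OF h(3)]
    by (auto; metis)
  then show ?thesis
    using emeasure_act[OF _ \<mu>] assms(2) by (simp add: rel_def SL3Z_def)
qed

lemma rel_class_eq:
  assumes "invariant_measure \<mu>"
  shows "rel_class \<mu> (integer_equiv `` {f}) = rel \<mu> f"
proof -
  have "f \<in> integer_equiv `` {f}"
    using equiv_integer_equiv by (simp add: equiv_def refl_on_def)
  then have "rel \<mu> ` (integer_equiv `` {f}) = {rel \<mu> f}"
    using rel_act[OF assms] by (fastforce simp: integer_equiv_def)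
  then show ?thesis by (simp add: rel_class_def)
qed

end

theory Submission
  imports Defs "HOL-Library.Multiset"
begin

text \<open>Put a face into the plane \<open>x\<^sub>3 = d\<close> by a unimodular map, where \<open>d\<close> is its integer distance to the
  origin. The relative frequencies then add up to the measure of the pairs of a cone and a face in this
  normal form, up to the stabilizer of the face, whose order is bounded because a unimodular matrix that
  is congruent to \<open>1\<close> modulo \<open>3\<close> and permutes the finite face fixes it. It remains to cover the normalized
  cones by cells whose weighted measures have a finite sum.

  For \<open>d \<le> 3\<close> the cells are Siegel sets: diagonal translates of one compact set, hence of one and the same
  measure. A cone far out in the cusp lies in such a cell for many integral unipotent changes of the
  basis, and the reciprocal of their number is the weight, which decays geometrically.
  For \<open>d \<ge> 4\<close> White's theorem on empty lattice simplices provides three lattice points of the face in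
  a configuration determined by a pair \<open>(k, l)\<close> with \<open>k + l = d\<close>. About \<open>k l (k + l)\<close> images of the cell of
  this pair under unimodular real matrices fit into a fixed compact set with bounded overlap, so that
  its measure is \<open>O(1 / (k l (k + l)))\<close>, and the sum over \<open>(k, l)\<close> converges.\<close>

section \<open>Simplicial cones and the invariant measure\<close>

text \<open>\<open>invariant_measure\<close> gives no density, only invariance and finiteness on
  compact sets. Volume estimates therefore become packing arguments: many translates of a cell are
  put into one compact family, and a bound on how many of them share a cone bounds the measure of
  the cell (\<open>multiplicity_bound\<close>). Compactness has a price at large distance: after
  scaling the rows, the matrices of a cell must have determinant bounded away from 0. White's normal
  form alone does not ensure this. So its points are moved along a lattice line in the face until a
  coordinate drops by more than a factor 2 (\<open>slide\<close>, \<open>good\<close>). The cases k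
  = 1 and l = 1 need one more lattice point (\<open>extra_row\<close>), and
  \<open>hold_bound\<close> is where 4 \<le> d supplies the required factors. The treatment of small
  distances tolerates any bound on d at the cost of larger constants, so the two regimes can meet
  between 3 and 4. Exceptional cones may carry infinite faces; these form a null family and are
  split off before the counting.\<close>

definition cone_of :: "real^3^3 \<Rightarrow> (real^3) set" where
  "cone_of N = {x. \<forall>i. 0 \<le> (N *v x) $ i}"

text \<open>The adjugate, written with Cramer's determinants. Being polynomial in the entries, it is
  continuous everywhere.\<close>

definition adj3 :: "real^3^3 \<Rightarrow> real^3^3" where
  "adj3 N = (\<chi> i j. det (\<chi> k l. if l = i then axis j 1 $ k else N $ k $ l))"

text \<open>For positive determinant this is the inverse scaled to determinant 1. The scaling does
  not change the image of the orthant, so the orbit map sends it to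
  \<open>cone_of N\<close>.\<close>

definition sl_inv :: "real^3^3 \<Rightarrow> real^3^3" where
  "sl_inv N = (root 3 (det N) / det N) *\<^sub>R adj3 N"

lemma adj3_mult: "N ** adj3 N = det N *\<^sub>R mat 1" "adj3 N ** N = det N *\<^sub>R mat 1"
  by (simp_all add: vec_eq_iff forall_3 matrix_matrix_mult_def sum_3 adj3_def det_3 mat_def axis_def)
     (simp_all add: algebra_simps)

lemma scaleR_matrix_mult:
  fixes M N :: "real^3^3"
  shows "(c *\<^sub>R M) ** N = c *\<^sub>R (M ** N)" "M ** (c *\<^sub>R N) = c *\<^sub>R (M ** N)"
  by (simp_all add: vec_eq_iff matrix_matrix_mult_def sum_distrib_left mult_ac)

lemma det_scaleR: "det (c *\<^sub>R (M :: real^3^3)) = c ^ 3 * det M"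
  by (simp add: det_3 power3_eq_cube algebra_simps)

lemma sl_inv_mult:
  assumes "det N \<noteq> 0"
  shows "N ** sl_inv N = root 3 (det N) *\<^sub>R mat 1" "sl_inv N ** N = root 3 (det N) *\<^sub>R mat 1"
  using assms by (simp_all add: sl_inv_def scaleR_matrix_mult adj3_mult)

lemma det_sl_inv:
  assumes "det N \<noteq> 0" shows "det (sl_inv N) = 1"
proof -
  have "det N * det (sl_inv N) = det N"
    using arg_cong[OF sl_inv_mult(1)[OF assms], of det] by (simp add: det_mul det_scaleR odd_real_root_pow)
  then show ?thesis using assms by simp
qed

lemma continuous_det3: "continuous_on S (\<lambda>x. det (f x :: real^3^3))" if "continuous_on S f"
  unfolding det_3 by (intro continuous_intros that)

lemma continuous_on_const_if:
  "continuous_on S f \<Longrightarrow> continuous_on S g \<Longrightarrow> continuous_on S (\<lambda>x. if c then f x else g x)"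
  by (cases c) auto

lemma continuous_adj3: "continuous_on S (\<lambda>x. adj3 (f x))" if "continuous_on S f"
  unfolding adj3_def by (intro continuous_on_vec_lambda continuous_det3 continuous_on_const_if continuous_intros that)

lemma continuous_matrix_mult:
  fixes f g :: "'a::topological_space \<Rightarrow> real^3^3"
  assumes "continuous_on S f" "continuous_on S g"
  shows "continuous_on S (\<lambda>x. f x ** g x)"
  unfolding matrix_matrix_mult_def by (intro continuous_intros assms)

lemma continuous_sl_inv:
  assumes "\<And>N. N \<in> S \<Longrightarrow> det N \<noteq> 0" shows "continuous_on S sl_inv"
proof -
  have "continuous_on S (\<lambda>N. adj3 N)"
    by (rule continuous_adj3) simp
  moreover have "continuous_on S det" using continuous_det3[of S "\<lambda>x. x"] by simp
  ultimately show ?thesis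
    unfolding sl_inv_def using assms by (intro continuous_intros) auto
qed

lemma cone_of_mat_1: "cone_of (mat 1) = orthant"
  by (simp add: cone_of_def orthant_def)

text \<open>The rows of \<open>N\<close> are inward normals of the facets, so \<open>N\<close>
  transforms by the inverse on the right. Columns record the choice of a lattice basis, rows the
  coordinates along the rays.\<close>

lemma act_cone_of:
  assumes "g ** h = mat 1" "h ** g = mat 1"
  shows "act g (cone_of N) = cone_of (N ** h)"
proof (intro set_eqI iffI)
  fix x assume "x \<in> act g (cone_of N)"
  then obtain y where y: "y \<in> cone_of N" "x = g *v y" by (auto simp: act_def)
  have "N ** h *v x = N *v y"
    by (simp add: y(2) matrix_vector_mul_assoc[symmetric])
       (simp add: matrix_vector_mul_assoc assms)
  then show "x \<in> cone_of (N ** h)" using y(1) by (simp add: cone_of_def)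
next
  fix x assume x: "x \<in> cone_of (N ** h)"
  have "x = g *v (h *v x)" by (simp add: matrix_vector_mul_assoc assms)
  moreover have "h *v x \<in> cone_of N"
    using x by (simp add: cone_of_def matrix_vector_mul_assoc)
  ultimately show "x \<in> act g (cone_of N)" unfolding act_def by blast
qed

lemma cone_of_scale:
  assumes "c > 0" shows "cone_of (c *\<^sub>R N) = cone_of N"
  using assms by (simp add: cone_of_def scaleR_matrix_vector_assoc[symmetric] zero_le_mult_iff)

lemma act_scale_cone_of:
  assumes "c > 0" shows "act (c *\<^sub>R g) (cone_of N) = act g (cone_of N)"
proof -
  have *: "act (c *\<^sub>R g) (cone_of N) \<subseteq> act g (cone_of N)" if "c > 0" for c g
  proof
    fix x assume "x \<in> act (c *\<^sub>R g) (cone_of N)"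
    then obtain y where y: "y \<in> cone_of N" "x = (c *\<^sub>R g) *v y" by (auto simp: act_def)
    then have "x = g *v (c *\<^sub>R y)"
      by (simp add: scaleR_matrix_vector_assoc[symmetric] matrix_vector_mult_scaleR)
    moreover have "c *\<^sub>R y \<in> cone_of N"
      using y(1) \<open>c > 0\<close> by (simp add: cone_of_def matrix_vector_mult_scaleR)
    ultimately show "x \<in> act g (cone_of N)" unfolding act_def by blast
  qed
  show ?thesis
    using *[of c g] *[of "1/c" "c *\<^sub>R g"] assms by auto
qed

lemma act_sl_inv_orthant:
  assumes "det N > 0" shows "act (sl_inv N) orthant = cone_of N"
proof -
  let ?r = "root 3 (det N)"
  have r: "?r > 0" using assms by simp
  have "det N \<noteq> 0" using assms by simp
  note m = sl_inv_mult[OF this]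
  have "act (sl_inv N) (cone_of (mat 1)) = cone_of (mat 1 ** ((1/?r) *\<^sub>R N))"
    using r m by (intro act_cone_of) (simp_all add: scaleR_matrix_mult)
  then show ?thesis
    using r by (simp add: cone_of_mat_1 cone_of_scale)
qed

lemma sl_inv_SL3R: "det N > 0 \<Longrightarrow> sl_inv N \<in> SL3R"
  by (simp add: SL3R_def det_sl_inv)

lemma cone_of_in_cones: "det N > 0 \<Longrightarrow> cone_of N \<in> cones"
  using act_sl_inv_orthant sl_inv_SL3R unfolding cones_def by blast

lemma cones_cone_of:
  assumes "C \<in> cones" obtains N where "det N = 1" "C = cone_of N"
proof -
  obtain g where g: "g \<in> SL3R" "C = act g orthant" using assms by (auto simp: cones_def)
  obtain h where h: "h \<in> SL3R" "g ** h = mat 1" "h ** g = mat 1" using SL3R_inverse[OF g(1)] .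
  have "C = cone_of (mat 1 ** h)" using act_cone_of[OF h(2,3)] g(2) by (simp flip: cone_of_mat_1)
  then show ?thesis using that h(1) by (simp add: SL3R_def)
qed

lemma det_pos_inverse:
  assumes "det (g::real^3^3) > 0"
  obtains h where "det h > 0" "g ** h = mat 1" "h ** g = mat 1"
proof
  show "g ** ((1 / det g) *\<^sub>R adj3 g) = mat 1" "((1 / det g) *\<^sub>R adj3 g) ** g = mat 1"
    using assms by (simp_all add: scaleR_matrix_mult adj3_mult)
  then have "det g * det ((1 / det g) *\<^sub>R adj3 g) = 1"
    by (metis det_mul det_I)
  then show "det ((1 / det g) *\<^sub>R adj3 g) > 0"
    using assms by (metis zero_less_mult_pos zero_less_one)
qed

text \<open>An off-diagonal entry of the product is a vanishing sum of nonnegative terms, so every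
  term vanishes. Hence the column that pairs nontrivially with one row of \<open>M\<close> is 0 in
  all other rows.\<close>

lemma nonneg_monomial:
  fixes M :: "real^3^3"
  assumes M: "M ** M' = mat 1" "M' ** M = mat 1"
    and "\<And>i j. 0 \<le> M $ i $ j" "\<And>i j. 0 \<le> M' $ i $ j"
  obtains \<pi> c where "inj \<pi>" "\<And>i. c i > (0::real)"
    "\<And>i j. M $ i $ j = (if j = \<pi> i then c i else 0)"
proof -
  have z: "M $ i $ k * M' $ k $ j = 0" if "i \<noteq> j" for i j k
  proof -
    have "(\<Sum>k\<in>UNIV. M $ i $ k * M' $ k $ j) = (M ** M') $ i $ j"
      by (simp add: matrix_matrix_mult_def)
    also have "\<dots> = 0" using that by (simp add: M mat_def)
    finally show ?thesis using assms(3,4) by (subst (asm) sum_nonneg_eq_0_iff) auto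
  qed
  have "\<exists>k. M $ i $ k * M' $ k $ i \<noteq> 0" for i
  proof (rule ccontr)
    assume "\<not> ?thesis"
    then have "(M ** M') $ i $ i = 0" by (auto simp: matrix_matrix_mult_def intro!: sum.neutral)
    then show False by (simp add: M mat_def)
  qed
  then obtain \<pi> where \<pi>: "\<And>i. M $ i $ \<pi> i * M' $ \<pi> i $ i \<noteq> 0" by metis
  have "inj \<pi>"
  proof (rule injI, rule ccontr)
    fix i i' assume "\<pi> i = \<pi> i'" "i \<noteq> i'"
    then show False using z[of i i' "\<pi> i"] \<pi>[of i] \<pi>[of i'] by simp
  qed
  then have "surj \<pi>" by (simp add: finite_UNIV_inj_surj)
  have M0: "M $ i $ j = 0" if "j \<noteq> \<pi> i" for i j
  proof -
    obtain i' where "j = \<pi> i'" using \<open>surj \<pi>\<close> by (metis surjD)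
    then have "i \<noteq> i'" using that by auto
    then show ?thesis using z[of i i' j] \<pi>[of i'] \<open>j = \<pi> i'\<close> by auto
  qed
  have "M $ i $ \<pi> i > 0" for i
    using \<pi>[of i] assms(3)[of i "\<pi> i"] by (simp add: less_le)
  then show ?thesis
    using M0 by (intro that[OF \<open>inj \<pi>\<close>, of "\<lambda>i. M $ i $ \<pi> i"]) simp_all
qed

text \<open>The transition matrices \<open>N' ** H\<close> and \<open>N ** H'\<close> are inverse to
  each other and nonnegative, because each ray of one description lies in the cone of the other.
  Hence they are monomial.\<close>

lemma cone_of_eq:
  assumes "cone_of N = cone_of N'" "det N > 0" "det N' > 0"
  obtains \<pi> c where "inj \<pi>" "\<And>i. c i > (0::real)"
    "\<And>i j. N' $ i $ j = c i * N $ \<pi> i $ j"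
proof -
  obtain H where H: "N ** H = mat 1" "H ** N = mat 1" using det_pos_inverse[OF assms(2)] .
  obtain H' where H': "N' ** H' = mat 1" "H' ** N' = mat 1" using det_pos_inverse[OF assms(3)] .
  have nn: "0 \<le> (N2 ** H1) $ i $ j" if "N1 ** H1 = mat 1" "cone_of N1 = cone_of N2"
    for N1 N2 H1 :: "real^3^3" and i j
  proof -
    have "H1 *v axis j 1 \<in> cone_of N1"
      by (simp add: cone_of_def matrix_vector_mul_assoc that) (simp add: axis_def)
    then have "0 \<le> (N2 *v (H1 *v axis j 1)) $ i" unfolding that(2) by (simp add: cone_of_def)
    then show ?thesis
      by (simp add: matrix_vector_mul_assoc matrix_vector_mul_component inner_axis)
  qed
  have "N' ** H ** (N ** H') = N' ** (H ** N) ** H'" "N ** H' ** (N' ** H) = N ** (H' ** N') ** H"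
    by (simp_all only: matrix_mul_assoc)
  then have m: "N' ** H ** (N ** H') = mat 1" "N ** H' ** (N' ** H) = mat 1"
    by (simp_all add: H H')
  obtain \<pi> c where \<pi>: "inj \<pi>" "\<And>i. c i > 0"
    "\<And>i j. (N' ** H) $ i $ j = (if j = \<pi> i then c i else 0)"
    using nonneg_monomial[OF m nn[OF H(1) assms(1)] nn[OF H'(1) assms(1)[symmetric]]] by blast
  have "N' $ i $ j = c i * N $ \<pi> i $ j" for i j
  proof -
    have "N' = (N' ** H) ** N" by (simp add: matrix_mul_assoc[symmetric] H)
    then have "N' $ i $ j = ((N' ** H) ** N) $ i $ j" by metis
    also have "\<dots> = (\<Sum>k\<in>UNIV. (N' ** H) $ i $ k * N $ k $ j)"
      by (simp add: matrix_matrix_mult_def[of "N' ** H"])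
    also have "\<dots> = (\<Sum>k\<in>UNIV. if k = \<pi> i then c i * N $ k $ j else 0)"
      by (intro sum.cong) (auto simp: \<pi>(3))
    finally show ?thesis by simp
  qed
  then show ?thesis using that \<pi> by blast
qed

text \<open>If \<open>g\<close> has the cone of \<open>N\<close>, then the orthant is
  \<open>cone_of (N ** g)\<close>. A nearby \<open>x\<close> of determinant 1 has the cone of
  \<open>N ** g ** adj3 x\<close>, which is still in \<open>U\<close> by continuity.\<close>

lemma openin_cone_of_image:
  assumes "open U" "\<And>N. N \<in> U \<Longrightarrow> det N > 0"
  shows "openin cone_topology (cone_of ` U)"
proof -
  have "\<exists>T. open T \<and> g \<in> T \<and> T \<inter> SL3R \<subseteq> {g \<in> SL3R. act g orthant \<in> cone_of ` U}"
    if g: "g \<in> SL3R" "act g orthant \<in> cone_of ` U" for g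
  proof -
    obtain N where N: "N \<in> U" "act g orthant = cone_of N" using g by blast
    obtain h where h: "h \<in> SL3R" "g ** h = mat 1" "h ** g = mat 1" using SL3R_inverse[OF g(1)] .
    define F where "F = (\<lambda>x :: real^3^3. N ** g ** adj3 x)"
    have "continuous_on UNIV F"
      unfolding F_def by (intro continuous_matrix_mult continuous_adj3 continuous_intros)
    then have "open (F -` U)" using assms(1) by (simp add: open_vimage)
    moreover have "F g = N"
    proof -
      have "g ** adj3 g = mat 1" using adj3_mult(1)[of g] g(1) by (simp add: SL3R_def)
      then show ?thesis by (simp add: F_def matrix_mul_assoc[symmetric])
    qed
    moreover have "act x orthant = cone_of (F x)" if "x \<in> SL3R" for x
    proof -
      have x: "x ** adj3 x = mat 1" "adj3 x ** x = mat 1"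
        using adj3_mult[of x] that by (simp_all add: SL3R_def)
      have "orthant = act h (cone_of N)" using N(2) act_inverse[OF h(3)] by metis
      also have "\<dots> = cone_of (N ** g)" by (rule act_cone_of[OF h(3,2)])
      finally have o: "orthant = cone_of (N ** g)" .
      show ?thesis unfolding F_def o by (rule act_cone_of[OF x])
    qed
    ultimately show ?thesis using N(1) by (intro exI[of _ "F -` U"]) auto
  qed
  note * = this
  have "openin (top_of_set SL3R) {g \<in> SL3R. act g orthant \<in> cone_of ` U}"
  proof (subst openin_subopen, intro ballI)
    fix g assume g: "g \<in> {g \<in> SL3R. act g orthant \<in> cone_of ` U}"
    then obtain T where "open T" "g \<in> T" "T \<inter> SL3R \<subseteq> {g \<in> SL3R. act g orthant \<in> cone_of ` U}"
      using * by blast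
    then show "\<exists>T. openin (top_of_set SL3R) T \<and> g \<in> T \<and> T \<subseteq> {g \<in> SL3R. act g orthant \<in> cone_of ` U}"
      using g by (intro exI[of _ "SL3R \<inter> T"]) (auto simp: openin_open_Int)
  qed
  then show ?thesis
    unfolding openin_cone_topology using assms(2) cone_of_in_cones by auto
qed

text \<open>Closedness rests on \<open>P\<close>: two cones agree iff both transition matrices are
  nonnegative, a closed condition that a convergent subsequence in \<open>K\<close> carries to the
  limit.\<close>

lemma compact_cone_of_image:
  assumes "compact K" "\<And>N. N \<in> K \<Longrightarrow> det N > 0"
  shows "compactin cone_topology (cone_of ` K)" "closedin cone_topology (cone_of ` K)"
proof -
  have cont: "continuous_map (top_of_set SL3R) cone_topology (\<lambda>g. act g orthant)"
    using quotient_map_cone_topology by (rule quotient_imp_continuous_map)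
  have "compact (sl_inv ` K)"
    using assms by (intro compact_continuous_image continuous_sl_inv) force+
  then have "compactin (top_of_set SL3R) (sl_inv ` K)"
    using assms(2) sl_inv_SL3R by (auto simp: compactin_subtopology)
  then have "compactin cone_topology ((\<lambda>g. act g orthant) ` sl_inv ` K)"
    using cont by (rule image_compactin)
  also have "(\<lambda>g. act g orthant) ` sl_inv ` K = cone_of ` K"
    unfolding image_image using assms(2) act_sl_inv_orthant by auto
  finally show "compactin cone_topology (cone_of ` K)" .
  define P where "P = (\<lambda>N g :: real^3^3. (\<forall>i j. 0 \<le> (N ** g) $ i $ j) \<and> (\<forall>i j. 0 \<le> (adj3 g ** sl_inv N) $ i $ j))"
  have P: "act g orthant = cone_of N \<longleftrightarrow> P N g" if g: "g \<in> SL3R" and N: "det N > 0" for g N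
  proof -
    let ?r = "root 3 (det N)"
    have r: "?r > 0" using N by simp
    have gi: "g ** adj3 g = mat 1" "adj3 g ** g = mat 1"
      using adj3_mult[of g] g by (simp_all add: SL3R_def)
    have co: "act g orthant = cone_of (adj3 g)"
      using act_cone_of[OF gi, of "mat 1"] by (simp add: cone_of_mat_1)
    have ni: "N ** sl_inv N = ?r *\<^sub>R mat 1" "sl_inv N ** N = ?r *\<^sub>R mat 1"
      using sl_inv_mult N by auto
    \<comment> \<open>A cone is generated by the columns of an inverse of its matrix, so inclusion
      means that the other rows are nonnegative on these columns.\<close>
    have pos: "cone_of N1 \<subseteq> cone_of N2 \<longleftrightarrow> (\<forall>i j. 0 \<le> (N2 ** H1) $ i $ j)"
      if H: "N1 ** H1 = c *\<^sub>R mat 1" "H1 ** N1 = c *\<^sub>R mat 1" "c > 0" for N1 N2 H1 :: "real^3^3" and c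
    proof
      assume s: "cone_of N1 \<subseteq> cone_of N2"
      show "\<forall>i j. 0 \<le> (N2 ** H1) $ i $ j"
      proof (intro allI)
        fix i j
        have "H1 *v axis j 1 \<in> cone_of N1"
          using H(3) by (simp add: cone_of_def matrix_vector_mul_assoc H(1) scaleR_matrix_vector_assoc[symmetric])
             (simp add: axis_def)
        then have "0 \<le> (N2 *v (H1 *v axis j 1)) $ i" using s by (auto simp: cone_of_def)
        then show "0 \<le> (N2 ** H1) $ i $ j"
          by (simp add: matrix_vector_mul_assoc matrix_vector_mul_component inner_axis)
      qed
    next
      assume nn: "\<forall>i j. 0 \<le> (N2 ** H1) $ i $ j"
      show "cone_of N1 \<subseteq> cone_of N2"
      proof
        fix x assume x: "x \<in> cone_of N1"
        have "(N2 ** H1) *v (N1 *v x) = c *\<^sub>R (N2 *v x)"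
          by (simp add: matrix_vector_mul_assoc matrix_mul_assoc[symmetric] H(2) scaleR_matrix_mult
              scaleR_matrix_vector_assoc[symmetric])
        moreover have "0 \<le> ((N2 ** H1) *v (N1 *v x)) $ i" for i
          using nn x by (simp add: matrix_vector_mult_def[of "N2 ** H1"] sum_nonneg cone_of_def)
        ultimately show "x \<in> cone_of N2" using H(3)
          by (simp add: cone_of_def zero_le_mult_iff)
      qed
    qed
    show ?thesis
      unfolding co P_def using pos[of "adj3 g" g 1 N] gi pos[OF ni r, of "adj3 g"] by auto
  qed
  let ?S = "{g \<in> SL3R. act g orthant \<in> cone_of ` K}"
  have "closedin (top_of_set SL3R) ?S"
  proof -
    have SL: "closed SL3R"
      unfolding SL3R_def by (intro closed_Collect_eq continuous_det3) auto
    have "l \<in> ?S" if g: "\<And>n. g n \<in> ?S" and lim: "g \<longlonglongrightarrow> l" for g l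
    proof -
      have l: "l \<in> SL3R" using closed_sequentially[OF SL _ lim] g by blast
      have "\<forall>n. \<exists>N\<in>K. P N (g n)" using g P assms(2) by blast
      then obtain N where N: "\<And>n. N n \<in> K" "\<And>n. P (N n) (g n)" by metis
      obtain N' s where N': "N' \<in> K" "strict_mono s" "(N \<circ> s) \<longlonglongrightarrow> N'"
        using assms(1) N(1) unfolding compact_def by meson
      have gs: "(\<lambda>n. g (s n)) \<longlonglongrightarrow> l"
        using LIMSEQ_subseq_LIMSEQ[OF lim N'(2)] by (simp add: o_def)
      have Ns: "(\<lambda>n. N (s n)) \<longlonglongrightarrow> N'" using N'(3) by (simp add: o_def)
      have "isCont sl_inv N'"
      proof -
        have "open {N::real^3^3. det N > 0}"
          by (intro open_Collect_less continuous_det3) auto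
        then show ?thesis
          using continuous_sl_inv[of "{N. det N > 0}"] assms(2)[OF N'(1)]
          by (simp add: continuous_on_eq_continuous_at)
      qed
      then have sN: "(\<lambda>n. sl_inv (N (s n))) \<longlonglongrightarrow> sl_inv N'"
        using Ns by (rule isCont_tendsto_compose)
      have "isCont adj3 l"
      proof -
        have "continuous_on UNIV adj3"
          by (rule continuous_adj3) simp
        then show ?thesis by (simp add: continuous_on_eq_continuous_at)
      qed
      then have ag: "(\<lambda>n. adj3 (g (s n))) \<longlonglongrightarrow> adj3 l"
        using gs by (rule isCont_tendsto_compose)
      have "(\<lambda>n. (N (s n) ** g (s n)) $ i $ j) \<longlonglongrightarrow> (N' ** l) $ i $ j" for i j
        unfolding matrix_matrix_mult_def using Ns gs by (auto intro!: tendsto_intros)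
      moreover have "(\<lambda>n. (adj3 (g (s n)) ** sl_inv (N (s n))) $ i $ j) \<longlonglongrightarrow> (adj3 l ** sl_inv N') $ i $ j" for i j
        unfolding matrix_matrix_mult_def using sN ag by (auto intro!: tendsto_intros)
      ultimately have "P N' l"
        using N(2) unfolding P_def by (meson LIMSEQ_le_const)
      then show ?thesis using l P[OF l] N'(1) assms(2) by blast
    qed
    then have "closed ?S" unfolding closed_sequential_limits by blast
    then show ?thesis by (simp add: closed_subset)
  qed
  moreover have "SL3R - {g \<in> SL3R. act g orthant \<in> cones - cone_of ` K} = ?S"
    by (auto simp: cones_def)
  ultimately have "openin (top_of_set SL3R) {g \<in> SL3R. act g orthant \<in> cones - cone_of ` K}"
    by (smt (verit) openin_closedin_eq topspace_euclidean_subtopology mem_Collect_eq subsetI)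
  then show "closedin cone_topology (cone_of ` K)"
    unfolding closedin_def openin_cone_topology
    using assms(2) cone_of_in_cones by auto
qed

section \<open>Transport of the measure by matrices of positive determinant\<close>

context
  fixes \<mu> :: "(real^3) set measure"
  assumes \<mu>: "invariant_measure \<mu>"
begin

lemma space_invariant: "space \<mu> = cones"
  using \<mu> by (simp add: invariant_measure_def)

lemma openin_sets: "openin cone_topology U \<Longrightarrow> U \<in> sets \<mu>"
  using \<mu> by (simp add: invariant_measure_def sigma_sets.Basic)

lemma closedin_sets:
  assumes "closedin cone_topology U" shows "U \<in> sets \<mu>"
proof -
  have "cones - U \<in> sets \<mu>" using assms by (intro openin_sets) (simp add: closedin_def)
  then have "space \<mu> - (cones - U) \<in> sets \<mu>" by blast
  moreover have "space \<mu> - (cones - U) = U"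
    using closedin_subset[OF assms] by (auto simp: space_invariant)
  ultimately show ?thesis by simp
qed

lemma compact_cone_of_image_measure:
  assumes "compact K" "\<And>N. N \<in> K \<Longrightarrow> det N > 0"
  shows "cone_of ` K \<in> sets \<mu>" "emeasure \<mu> (cone_of ` K) < \<infinity>"
  using compact_cone_of_image[OF assms] closedin_sets \<mu> by (simp_all add: invariant_measure_def)

text \<open>Cones do not see positive scaling. This lets \<open>white_mat k l\<close>, of
  determinant k + l, preserve the measure.\<close>

lemma act_eq_SL3R:
  assumes "det g > 0" obtains g' where "g' \<in> SL3R" "\<And>C. C \<in> cones \<Longrightarrow> act g C = act g' C"
proof
  let ?r = "root 3 (det g)"
  have r: "?r > 0" using assms by simp
  have r3: "?r ^ 3 = det g" by (simp add: odd_real_root_pow)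
  show "(1 / ?r) *\<^sub>R g \<in> SL3R"
    using assms by (simp add: SL3R_def det_scaleR power_divide r3 del: real_root_gt_zero)
  show "act g C = act ((1 / ?r) *\<^sub>R g) C" if C: "C \<in> cones" for C
    using cones_cone_of[OF C] act_scale_cone_of[of "1 / ?r" g] r by (metis zero_less_divide_1_iff)
qed

lemma emeasure_act_pos:
  assumes "det g > 0" "A \<subseteq> cones"
  shows "emeasure \<mu> (act g ` A) = emeasure \<mu> A"
proof -
  obtain g' where g': "g' \<in> SL3R" "\<And>C. C \<in> cones \<Longrightarrow> act g C = act g' C"
    using act_eq_SL3R[OF assms(1)] by metis
  then have "act g ` A = act g' ` A" using assms(2) by (intro image_cong) auto
  then show ?thesis using emeasure_act[OF g'(1) \<mu>] by simp
qed

lemma sets_act_pos: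
  assumes "det g > 0" "A \<in> sets \<mu>"
  shows "act g ` A \<in> sets \<mu>"
proof -
  obtain g' where g': "g' \<in> SL3R" "\<And>C. C \<in> cones \<Longrightarrow> act g C = act g' C"
    using act_eq_SL3R[OF assms(1)] by metis
  then have "act g ` A = act g' ` A"
    using sets.sets_into_space[OF assms(2)] by (intro image_cong) (auto simp: space_invariant)
  then show ?thesis using sets_act[OF g'(1) \<mu> assms(2)] by simp
qed

text \<open>Integrate the number of sets containing a given cone: it is at most \<open>b\<close> on
  \<open>K\<close> and 0 elsewhere.\<close>

lemma multiplicity_bound:
  assumes T: "finite T" and G: "\<And>t. t \<in> T \<Longrightarrow> G t \<in> sets \<mu>" "\<And>t. t \<in> T \<Longrightarrow> G t \<subseteq> K"
    and K: "K \<in> sets \<mu>" and m: "\<And>t. t \<in> T \<Longrightarrow> emeasure \<mu> (G t) = m"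
    and mult: "\<And>C. card {t \<in> T. C \<in> G t} \<le> b"
  shows "of_nat (card T) * m \<le> of_nat b * emeasure \<mu> K"
proof -
  have "of_nat (card T) * m = (\<Sum>t\<in>T. \<integral>\<^sup>+C. indicator (G t) C \<partial>\<mu>)"
    using G m by simp
  also have "\<dots> = (\<integral>\<^sup>+C. (\<Sum>t\<in>T. indicator (G t) C) \<partial>\<mu>)"
    using G by (intro nn_integral_sum[symmetric]) auto
  also have "\<dots> \<le> (\<integral>\<^sup>+C. of_nat b * indicator K C \<partial>\<mu>)"
  proof (intro nn_integral_mono)
    fix C
    have "(\<Sum>t\<in>T. indicator (G t) C) = (of_nat (card {t \<in> T. C \<in> G t}) :: ennreal)"
      using T by (simp add: indicator_def of_bool_def[symmetric] sum.If_cases Int_def)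
    moreover have "{t \<in> T. C \<in> G t} = {}" if "C \<notin> K" using G(2) that by auto
    moreover have "of_nat (card {t \<in> T. C \<in> G t}) \<le> (of_nat b :: ennreal)"
      using mult by simp
    ultimately show "(\<Sum>t\<in>T. indicator (G t) C) \<le> of_nat b * (indicator K C :: ennreal)"
      by (cases "C \<in> K") auto
  qed
  also have "\<dots> = of_nat b * emeasure \<mu> K" using K by (simp add: nn_integral_cmult_indicator)
  finally show ?thesis .
qed

end

section \<open>Lattice stabilizers and measures of covers\<close>

lemma lattice_add: "x \<in> lattice \<Longrightarrow> y \<in> lattice \<Longrightarrow> x + y \<in> lattice"
  and lattice_diff: "x \<in> lattice \<Longrightarrow> y \<in> lattice \<Longrightarrow> x - y \<in> lattice"
  and lattice_scale: "x \<in> lattice \<Longrightarrow> k \<in> \<int> \<Longrightarrow> k *\<^sub>R x \<in> lattice"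
  by (auto simp: lattice_def)

lemma lattice_norm_ge_1:
  assumes "x \<in> lattice" "x \<noteq> 0" shows "norm x \<ge> 1"
proof -
  obtain i where "x $ i \<noteq> 0" using assms(2) by (auto simp: vec_eq_iff)
  then have "\<bar>x $ i\<bar> \<ge> 1" using assms(1) by (auto simp: lattice_def intro: Ints_nonzero_abs_ge1)
  then show ?thesis using component_le_norm_cart[of x i] by linarith
qed

text \<open>Minkowski: writing \<open>\<sigma> = 1 + 3N\<close>, boundedness of the powers of \<open>\<sigma>\<close> on an orbit gives
  \<open>3\<^sup>k N\<^sup>k = O(2\<^sup>k)\<close>, so \<open>N\<close> is nilpotent there, and an unbounded unipotent is excluded.\<close>

lemma finite_orbit_congruent_1:
  assumes \<sigma>: "\<sigma> \<in> SL3Z" and cong: "\<And>i j. \<exists>z\<in>\<int>. (\<sigma> - mat 1) $ i $ j = 3 * z"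
    and f: "act \<sigma> f = f" "finite f" and x: "x \<in> f" "x \<in> lattice"
  shows "\<sigma> *v x = x"
proof -
  define T where "T = (\<lambda>x. \<sigma> *v x)"
  define D where "D = (\<lambda>x. T x - x)"
  have linT: "linear T" by (simp add: T_def)
  have linTm: "linear (T ^^ m)" for m
  proof (induction m)
    case (Suc m)
    then show ?case using linear_compose[OF _ linT] by (simp add: o_def)
  qed (simp add: linear_id[unfolded id_def] id_def)
  have Tf: "(T ^^ m) x \<in> f" for m
  proof (induction m)
    case (Suc m)
    then show ?case using f(1) by (auto simp: T_def act_def)
  qed (simp add: x)
  obtain M where M: "\<And>y. y \<in> f \<Longrightarrow> norm y \<le> M"
    using finite_imp_bounded[OF f(2)] by (auto simp: bounded_iff)
  have bnd: "norm ((T ^^ m) ((D ^^ k) x)) \<le> 2 ^ k * M" for m k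
  proof (induction k arbitrary: m)
    case 0
    then show ?case using M Tf by simp
  next
    case (Suc k)
    have "(T ^^ m) ((D ^^ Suc k) x) = (T ^^ Suc m) ((D ^^ k) x) - (T ^^ m) ((D ^^ k) x)"
      using linear_diff[OF linTm] by (simp add: D_def funpow_swap1)
    then show ?case
      using norm_triangle_ineq4[of "(T ^^ Suc m) ((D ^^ k) x)" "(T ^^ m) ((D ^^ k) x)"]
        Suc[of "Suc m"] Suc[of m] by simp
  qed
  have Dl: "\<exists>z\<in>lattice. D y = 3 *\<^sub>R z" if "y \<in> lattice" for y
  proof -
    obtain z where z: "\<And>i j. z i j \<in> \<int>" "\<And>i j. (\<sigma> - mat 1) $ i $ j = 3 * z i j"
      using cong by metis
    have "D y = (\<sigma> - mat 1) *v y"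
      by (simp add: D_def T_def matrix_vector_mult_diff_rdistrib)
    also have "\<dots> = 3 *\<^sub>R (\<chi> i. \<Sum>j\<in>UNIV. z i j * y $ j)"
      by (simp add: vec_eq_iff matrix_vector_mult_def z(2)[simplified] sum_distrib_left mult_ac)
    finally have "D y = 3 *\<^sub>R (\<chi> i. \<Sum>j\<in>UNIV. z i j * y $ j)" .
    moreover have "(\<chi> i. \<Sum>j\<in>UNIV. z i j * y $ j) \<in> lattice"
      using that z(1) by (auto simp: lattice_def)
    ultimately show ?thesis by blast
  qed
  have Dsc: "D (c *\<^sub>R y) = c *\<^sub>R D y" for c y
    by (simp add: D_def T_def matrix_vector_mult_scaleR scaleR_right_diff_distrib)
  have Dk: "\<exists>z\<in>lattice. (D ^^ k) x = 3 ^ k *\<^sub>R z" for k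
  proof (induction k)
    case (Suc k)
    then obtain z where "z \<in> lattice" "(D ^^ k) x = 3 ^ k *\<^sub>R z" by blast
    moreover then obtain z' where "z' \<in> lattice" "D z = 3 *\<^sub>R z'" using Dl by blast
    ultimately show ?case by (intro bexI[of _ z']) (simp_all add: Dsc)
  qed (use x in auto)
  have "\<exists>k. (D ^^ k) x = 0"
  proof -
    obtain k where k: "(2/3::real) ^ k * M < 1"
    proof (cases "M > 0")
      case True
      obtain k where "(2/3::real) ^ k < 1 / M"
        using real_arch_pow_inv[of "1/M" "2/3"] True by auto
      then show ?thesis using that True by (auto simp: field_simps)
    next
      case False
      then show ?thesis using that[of 0] by simp
    qed
    obtain z where z: "z \<in> lattice" "(D ^^ k) x = 3 ^ k *\<^sub>R z" using Dk by blast
    have "3 ^ k * norm z \<le> 2 ^ k * M" using bnd[of 0 k] z by simp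
    then have "norm z \<le> (2/3) ^ k * M" by (simp add: field_simps)
    then have "z = 0" using lattice_norm_ge_1[OF z(1)] k by force
    then show ?thesis using z by (intro exI[of _ k]) simp
  qed
  then obtain k where k: "(D ^^ k) x = 0" "\<And>j. j < k \<Longrightarrow> (D ^^ j) x \<noteq> 0"
    using exists_least_iff[of "\<lambda>k. (D ^^ k) x = 0"] by blast
  have "D x = 0"
  proof (cases k)
    case 0
    then show ?thesis using k by (simp add: D_def T_def)
  next
    case (Suc j)
    show ?thesis
    proof (cases j)
      case 0
      then show ?thesis using Suc k by simp
    next
      case (Suc l)
      \<comment> \<open>On the vector before the last nonzero one, \<open>T\<close> acts by adding
        the fixed vector \<open>D y\<close>, so its orbit is an arithmetic progression and cannot be
        bounded.\<close>
      define y where "y = (D ^^ l) x"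
      have Dy: "D y \<noteq> 0" "D (D y) = 0"
        using k(2)[of "Suc l"] k(1) \<open>k = Suc j\<close> Suc by (simp_all add: y_def)
      have TD: "T (D y) = D y" using Dy(2) by (simp add: D_def)
      have Tm: "(T ^^ m) y = y + real m *\<^sub>R D y" for m
      proof (induction m)
        case (Suc m)
        then have "(T ^^ Suc m) y = T y + real m *\<^sub>R T (D y)"
          using linT by (simp add: linear_add linear_scale)
        also have "T y = y + D y" by (simp add: D_def)
        finally show ?case by (simp add: TD algebra_simps)
      qed simp
      obtain m :: nat where m: "real m * norm (D y) > 2 ^ l * M + norm y"
        using ex_less_of_nat_mult[of "norm (D y)"] Dy(1) by auto
      have "real m * norm (D y) = norm ((T ^^ m) y - y)" by (simp add: Tm)
      also have "\<dots> \<le> norm ((T ^^ m) y) + norm y" by (rule norm_triangle_ineq4)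
      also have "\<dots> \<le> 2 ^ l * M + norm y" using bnd[of m l] by (simp add: y_def)
      finally show ?thesis using m by simp
    qed
  qed
  then show ?thesis by (simp add: D_def T_def)
qed

lemma matrix_eq_on_span:
  fixes A B :: "real^3^3"
  assumes "span f = UNIV" "\<And>x. x \<in> f \<Longrightarrow> A *v x = B *v x" shows "A = B"
proof -
  have "A *v x = B *v x" for x
    using linear_eq_on_span[of "(*v) A" "(*v) B" f] assms by auto
  then show ?thesis by (simp add: matrix_eq)
qed

text \<open>Reduction modulo 3 is injective on these matrices: two with the same reduction differ by
  an element congruent to 1 that stabilizes \<open>f\<close>. By
  \<open>finite_orbit_congruent_1\<close> it fixes the spanning set \<open>f\<close> pointwise. So
  3^9 is a bound independent of the face.\<close>

lemma stabilizer_bound: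
  obtains b :: nat where "\<And>f f'. finite f \<Longrightarrow> f \<subseteq> lattice \<Longrightarrow> span f = UNIV \<Longrightarrow>
    finite {\<gamma> \<in> SL3Z. act \<gamma> f = f'} \<and> card {\<gamma> \<in> SL3Z. act \<gamma> f = f'} \<le> b"
proof
  define R where "R = (\<lambda>\<gamma>::real^3^3. \<lambda>(i,j). \<lfloor>\<gamma> $ i $ j\<rfloor> mod 3)"
  let ?X = "PiE (UNIV :: (3 \<times> 3) set) (\<lambda>_. {0..<3::int})"
  fix f f' :: "(real^3) set"
  assume f: "finite f" "f \<subseteq> lattice" "span f = UNIV"
  let ?G = "{\<gamma> \<in> SL3Z. act \<gamma> f = f'}"
  have "inj_on R ?G"
  proof
    fix \<gamma> \<delta> assume g: "\<gamma> \<in> ?G" "\<delta> \<in> ?G" and eq: "R \<gamma> = R \<delta>"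
    obtain h where h: "h \<in> SL3Z" "\<gamma> ** h = mat 1" "h ** \<gamma> = mat 1"
      using SL3Z_inverse g by blast
    let ?s = "h ** \<delta>"
    have s: "?s \<in> SL3Z" using h g SL3Z_mult by blast
    have sf: "act ?s f = f" using g act_inverse[OF h(3), of f] by (simp add: act_mult)
    have "\<exists>z\<in>\<int>. (?s - mat 1) $ i $ j = 3 * z" for i j
    proof -
      have dz: "\<exists>z\<in>\<int>. (\<delta> - \<gamma>) $ k $ j = 3 * z" for k j
      proof -
        have "\<lfloor>\<gamma> $ k $ j\<rfloor> mod 3 = \<lfloor>\<delta> $ k $ j\<rfloor> mod 3" using fun_cong[OF eq, of "(k,j)"] by (simp add: R_def)
        then obtain z where z: "\<lfloor>\<delta> $ k $ j\<rfloor> - \<lfloor>\<gamma> $ k $ j\<rfloor> = 3 * z"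
          by (metis mod_eq_dvd_iff dvdE)
        have "\<gamma> $ k $ j \<in> \<int>" "\<delta> $ k $ j \<in> \<int>" using g by (auto simp: SL3Z_def)
        then have "\<delta> $ k $ j - \<gamma> $ k $ j = of_int (\<lfloor>\<delta> $ k $ j\<rfloor> - \<lfloor>\<gamma> $ k $ j\<rfloor>)"
          by (auto elim!: Ints_cases)
        then show ?thesis unfolding z by (intro bexI[of _ "of_int z"]) auto
      qed
      then obtain z where z: "\<And>k j. z k j \<in> \<int>" "\<And>k j. (\<delta> - \<gamma>) $ k $ j = 3 * z k j" by metis
      have "h ** (\<delta> - \<gamma>) = h ** \<delta> - h ** \<gamma>"
        by (simp add: matrix_matrix_mult_def vec_eq_iff right_diff_distrib sum_subtractf)
      then have "?s - mat 1 = h ** (\<delta> - \<gamma>)" by (simp add: h)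
      then have "(?s - mat 1) $ i $ j = 3 * (\<Sum>k\<in>UNIV. h $ i $ k * z k j)"
        by (simp add: matrix_matrix_mult_def z(2)[simplified] sum_distrib_left mult_ac)
      moreover have "(\<Sum>k\<in>UNIV. h $ i $ k * z k j) \<in> \<int>"
        using h(1) z(1) by (auto simp: SL3Z_def)
      ultimately show ?thesis by blast
    qed
    then have "?s *v x = x" if "x \<in> f" for x
      using finite_orbit_congruent_1[OF s _ sf f(1) that] f(2) that by blast
    then have "?s = mat 1" by (intro matrix_eq_on_span[OF f(3)]) auto
    then have "\<gamma> ** ?s = \<gamma>" by simp
    then show "\<gamma> = \<delta>" by (simp add: matrix_mul_assoc h)
  qed
  moreover have "R ` ?G \<subseteq> ?X" by (auto simp: R_def)
  moreover have "finite ?X" by (intro finite_PiE) auto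
  ultimately show "finite ?G \<and> card ?G \<le> card ?X"
    by (auto intro: inj_on_finite card_inj_on_le)
qed

lemma countable_SL3Z: "countable SL3Z"
proof -
  let ?R = "\<lambda>g :: real^3^3. \<lambda>(i, j). \<lfloor>g $ i $ j\<rfloor>"
  have "countable (PiE (UNIV :: (3\<times>3) set) (\<lambda>_. UNIV :: int set))"
    by (intro countable_PiE) auto
  then have "countable (?R ` SL3Z)"
    by (rule countable_subset[rotated]) auto
  moreover have "inj_on ?R SL3Z"
  proof (rule inj_onI)
    fix g h assume g: "g \<in> SL3Z" "h \<in> SL3Z" and eq: "?R g = ?R h"
    have "g $ i $ j = h $ i $ j" for i j
    proof -
      have "g $ i $ j \<in> \<int>" "h $ i $ j \<in> \<int>" using g by (auto simp: SL3Z_def)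
      then show ?thesis using fun_cong[OF eq, of "(i,j)"] by (auto elim!: Ints_cases)
    qed
    then show "g = h" by (simp add: vec_eq_iff)
  qed
  ultimately show ?thesis by (rule countable_image_inj_on)
qed

section \<open>Weighted covers and multiplicities\<close>

lemma borel_measurable_nn_integral_count_space:
  fixes f :: "'i \<Rightarrow> 'a \<Rightarrow> ennreal"
  assumes "countable I" and [measurable]: "\<And>i. i \<in> I \<Longrightarrow> f i \<in> borel_measurable M"
  shows "(\<lambda>x. \<integral>\<^sup>+i. f i x \<partial>count_space I) \<in> borel_measurable M"
proof (cases "finite I")
  case True
  then show ?thesis by (simp add: nn_integral_count_space_finite)
next
  case False
  then have [simp]: "I \<noteq> {}" by auto
  note * = bij_betw_from_nat_into[OF \<open>countable I\<close> False]
  have **: "(\<integral>\<^sup>+i. f i x \<partial>count_space I) = (\<Sum>n. f (from_nat_into I n) x)" for x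
    by (simp add: nn_integral_bij_count_space[symmetric, OF *] nn_integral_count_space_nat)
  show ?thesis unfolding ** by (intro borel_measurable_suminf_order assms(2)) (simp add: from_nat_into)
qed

lemma nn_integral_count_space_indicator_card:
  "(\<integral>\<^sup>+\<gamma>. indicator (A \<gamma>) C \<partial>count_space \<Gamma>) = of_nat (card {\<gamma> \<in> \<Gamma>. C \<in> A \<gamma>})"
  if "finite {\<gamma> \<in> \<Gamma>. C \<in> A \<gamma>}"
  using that by (subst nn_integral_count_space'[of "{\<gamma> \<in> \<Gamma>. C \<in> A \<gamma>}"]) auto

text \<open>A union bound with weights: \<open>g\<close>, the weighted number of sets containing a
  point, is at least 1 on \<open>S\<close> outside \<open>Z\<close>. A cell that is hit for many
  \<gamma> may have a small weight.\<close>

lemma emeasure_weighted_cover: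
  fixes A :: "'i \<Rightarrow> 'g \<Rightarrow> 'a set" and w :: "'i \<Rightarrow> ennreal"
  assumes S: "S \<in> sets M" and cnt: "countable I" "countable \<Gamma>"
    and A: "\<And>i \<gamma>. i \<in> I \<Longrightarrow> \<gamma> \<in> \<Gamma> \<Longrightarrow> A i \<gamma> \<in> sets M"
    and cover: "\<And>C. C \<in> S \<Longrightarrow> C \<notin> Z \<Longrightarrow>
      \<exists>i\<in>I. \<exists>G. finite G \<and> G \<subseteq> \<Gamma> \<and> 1 \<le> w i * of_nat (card G) \<and> (\<forall>\<gamma>\<in>G. C \<in> A i \<gamma>)"
    and null: "\<And>B. B \<in> sets M \<Longrightarrow> B \<subseteq> S \<inter> Z \<Longrightarrow> emeasure M B = 0"
  shows "emeasure M S \<le> (\<integral>\<^sup>+i. w i * (\<integral>\<^sup>+\<gamma>. emeasure M (A i \<gamma>) \<partial>count_space \<Gamma>) \<partial>count_space I)"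
proof -
  define g where "g = (\<lambda>C. \<integral>\<^sup>+i. w i * (\<integral>\<^sup>+\<gamma>. indicator (A i \<gamma>) C \<partial>count_space \<Gamma>) \<partial>count_space I)"
  have m1: "(\<lambda>C. \<integral>\<^sup>+\<gamma>. indicator (A i \<gamma>) C \<partial>count_space \<Gamma>) \<in> borel_measurable M" if "i \<in> I" for i
    using that A cnt by (intro borel_measurable_nn_integral_count_space) auto
  have [measurable]: "g \<in> borel_measurable M"
    unfolding g_def using m1 cnt by (intro borel_measurable_nn_integral_count_space) auto
  have g1: "g C \<ge> 1" if C: "C \<in> S" "C \<notin> Z" for C
  proof -
    obtain i G where iG: "i \<in> I" "finite G" "G \<subseteq> \<Gamma>" "1 \<le> w i * of_nat (card G)" "\<forall>\<gamma>\<in>G. C \<in> A i \<gamma>"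
      using cover[OF C] by blast
    have "of_nat (card G) = (\<integral>\<^sup>+\<gamma>. indicator G \<gamma> \<partial>count_space \<Gamma>)"
      using iG by (simp add: emeasure_count_space_finite)
    also have "\<dots> \<le> (\<integral>\<^sup>+\<gamma>. indicator (A i \<gamma>) C \<partial>count_space \<Gamma>)"
      using iG by (intro nn_integral_mono) (auto split: split_indicator)
    finally have "1 \<le> w i * (\<integral>\<^sup>+\<gamma>. indicator (A i \<gamma>) C \<partial>count_space \<Gamma>)"
      using iG(4) mult_left_mono order_trans by (metis zero_le)
    also have "\<dots> = (\<integral>\<^sup>+j. w j * (\<integral>\<^sup>+\<gamma>. indicator (A j \<gamma>) C \<partial>count_space \<Gamma>) * indicator {i} j \<partial>count_space I)"
      using iG(1) by (subst nn_integral_indicator_finite) (auto simp: emeasure_count_space_finite)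
    also have "\<dots> \<le> g C"
      unfolding g_def by (intro nn_integral_mono) (auto split: split_indicator)
    finally show ?thesis .
  qed
  \<comment> \<open>\<open>Z\<close> itself may fail to be measurable, so the exceptional set is cut
    out by the measurable function \<open>g\<close>.\<close>
  let ?B = "S \<inter> {C \<in> space M. g C < 1}"
  have B: "?B \<in> sets M" using S by auto
  have "?B \<subseteq> S \<inter> Z" using g1 by (auto simp: not_le[symmetric])
  then have "emeasure M ?B = 0" by (rule null[OF B])
  then have "emeasure M S = emeasure M (S - ?B)"
    using S B by (simp add: emeasure_Diff_null_set null_sets_def)
  also have "\<dots> = (\<integral>\<^sup>+C. indicator (S - ?B) C \<partial>M)" using S B by simp
  also have "\<dots> \<le> (\<integral>\<^sup>+C. g C \<partial>M)"
    by (intro nn_integral_mono) (auto split: split_indicator simp: not_less)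
  also have "\<dots> = (\<integral>\<^sup>+i. \<integral>\<^sup>+C. w i * (\<integral>\<^sup>+\<gamma>. indicator (A i \<gamma>) C \<partial>count_space \<Gamma>) \<partial>M \<partial>count_space I)"
    unfolding g_def using m1 by (intro nn_integral_count_space_nn_integral cnt) auto
  also have "\<dots> = (\<integral>\<^sup>+i. w i * (\<integral>\<^sup>+\<gamma>. emeasure M (A i \<gamma>) \<partial>count_space \<Gamma>) \<partial>count_space I)"
  proof (intro nn_integral_cong)
    fix i assume "i \<in> space (count_space I)"
    then have i: "i \<in> I" by simp
    have "(\<integral>\<^sup>+C. w i * (\<integral>\<^sup>+\<gamma>. indicator (A i \<gamma>) C \<partial>count_space \<Gamma>) \<partial>M)
      = w i * (\<integral>\<^sup>+C. (\<integral>\<^sup>+\<gamma>. indicator (A i \<gamma>) C \<partial>count_space \<Gamma>) \<partial>M)"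
      using m1[OF i] by (rule nn_integral_cmult)
    also have "(\<integral>\<^sup>+C. (\<integral>\<^sup>+\<gamma>. indicator (A i \<gamma>) C \<partial>count_space \<Gamma>) \<partial>M)
      = (\<integral>\<^sup>+\<gamma>. (\<integral>\<^sup>+C. indicator (A i \<gamma>) C \<partial>M) \<partial>count_space \<Gamma>)"
      using A[OF i] by (intro nn_integral_count_space_nn_integral cnt) auto
    also have "\<dots> = (\<integral>\<^sup>+\<gamma>. emeasure M (A i \<gamma>) \<partial>count_space \<Gamma>)"
      using A[OF i] by (intro nn_integral_cong) simp
    finally show "(\<integral>\<^sup>+C. w i * (\<integral>\<^sup>+\<gamma>. indicator (A i \<gamma>) C \<partial>count_space \<Gamma>) \<partial>M)
      = w i * (\<integral>\<^sup>+\<gamma>. emeasure M (A i \<gamma>) \<partial>count_space \<Gamma>)" .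
  qed
  finally show ?thesis .
qed

text \<open>The converse count: all pairs of a face and a \<gamma> together cover each point at most
  \<open>b\<close> times, so their total measure is controlled by the common envelope
  \<open>E\<close>.\<close>

lemma sum_emeasure_multiplicity:
  fixes A :: "'f \<Rightarrow> 'g \<Rightarrow> 'a set"
  assumes F: "finite F" and cnt: "countable \<Gamma>"
    and A: "\<And>f \<gamma>. f \<in> F \<Longrightarrow> \<gamma> \<in> \<Gamma> \<Longrightarrow> A f \<gamma> \<in> sets M" "\<And>f \<gamma>. f \<in> F \<Longrightarrow> \<gamma> \<in> \<Gamma> \<Longrightarrow> A f \<gamma> \<subseteq> E"
    and E: "E \<in> sets M"
    and mult: "\<And>C. finite {(f, \<gamma>) \<in> F \<times> \<Gamma>. C \<in> A f \<gamma>} \<and> card {(f, \<gamma>) \<in> F \<times> \<Gamma>. C \<in> A f \<gamma>} \<le> b"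
  shows "(\<Sum>f\<in>F. \<integral>\<^sup>+\<gamma>. emeasure M (A f \<gamma>) \<partial>count_space \<Gamma>) \<le> of_nat b * emeasure M E"
proof -
  have "(\<Sum>f\<in>F. \<integral>\<^sup>+\<gamma>. emeasure M (A f \<gamma>) \<partial>count_space \<Gamma>)
    = (\<Sum>f\<in>F. \<integral>\<^sup>+\<gamma>. (\<integral>\<^sup>+C. indicator (A f \<gamma>) C \<partial>M) \<partial>count_space \<Gamma>)"
    using A by (intro sum.cong nn_integral_cong) auto
  also have "\<dots> = (\<Sum>f\<in>F. \<integral>\<^sup>+C. (\<integral>\<^sup>+\<gamma>. indicator (A f \<gamma>) C \<partial>count_space \<Gamma>) \<partial>M)"
    using A cnt by (intro sum.cong nn_integral_count_space_nn_integral[symmetric]) auto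
  also have "\<dots> = (\<integral>\<^sup>+C. (\<Sum>f\<in>F. \<integral>\<^sup>+\<gamma>. indicator (A f \<gamma>) C \<partial>count_space \<Gamma>) \<partial>M)"
    using A cnt by (intro nn_integral_sum[symmetric] borel_measurable_nn_integral_count_space) auto
  also have "\<dots> \<le> (\<integral>\<^sup>+C. of_nat b * indicator E C \<partial>M)"
  proof (intro nn_integral_mono)
    fix C
    let ?X = "{(f, \<gamma>) \<in> F \<times> \<Gamma>. C \<in> A f \<gamma>}"
    have fin: "finite {\<gamma> \<in> \<Gamma>. C \<in> A f \<gamma>}" if "f \<in> F" for f
    proof -
      have "{\<gamma> \<in> \<Gamma>. C \<in> A f \<gamma>} \<subseteq> snd ` ?X" using that by force
      then show ?thesis using mult finite_subset by blast
    qed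
    have "(\<Sum>f\<in>F. \<integral>\<^sup>+\<gamma>. indicator (A f \<gamma>) C \<partial>count_space \<Gamma>)
      = (\<Sum>f\<in>F. of_nat (card {\<gamma> \<in> \<Gamma>. C \<in> A f \<gamma>}))"
      using fin by (intro sum.cong nn_integral_count_space_indicator_card) auto
    also have "\<dots> = of_nat (card (SIGMA f:F. {\<gamma> \<in> \<Gamma>. C \<in> A f \<gamma>}))"
      using F fin by (simp add: card_SigmaI)
    also have "(SIGMA f:F. {\<gamma> \<in> \<Gamma>. C \<in> A f \<gamma>}) = ?X" by auto
    finally have *: "(\<Sum>f\<in>F. \<integral>\<^sup>+\<gamma>. indicator (A f \<gamma>) C \<partial>count_space \<Gamma>) = of_nat (card ?X)" .
    show "(\<Sum>f\<in>F. \<integral>\<^sup>+\<gamma>. indicator (A f \<gamma>) C \<partial>count_space \<Gamma>) \<le> of_nat b * (indicator E C :: ennreal)"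
    proof (cases "C \<in> E")
      case True
      then show ?thesis unfolding * using mult by simp
    next
      case False
      then have "?X = {}" using A(2) by auto
      then have "card ?X = 0" by (simp only: card.empty)
      then show ?thesis unfolding * by simp
    qed
  qed
  also have "\<dots> = of_nat b * emeasure M E" using E by (simp add: nn_integral_cmult_indicator)
  finally show ?thesis .
qed

section \<open>Null cones\<close>

text \<open>These maps turn the plane x_3 = 0 about the second axis into the plane x_3 = t
  x_1.\<close>

definition shear :: "real \<Rightarrow> real^3^3" where
  "shear t = (\<chi> i j. if i = j then 1 else if i = 3 \<and> j = 1 then t else 0)"

lemma shear_mult: "shear s ** shear t = shear (s + t)"
  by (simp add: vec_eq_iff forall_3 matrix_matrix_mult_def sum_3 shear_def)

lemma shear_0: "shear 0 = mat 1"
  by (simp add: vec_eq_iff forall_3 shear_def mat_def)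

lemma det_shear [simp]: "det (shear t) = 1"
  by (simp add: det_3 shear_def)

text \<open>The sail of such a cone may have an unbounded face in the direction of a generating ray.
  Rays along the second axis are missing here, since no generic cone has them.\<close>

definition ray_in_plane :: "(real^3) set \<Rightarrow> bool" where
  "ray_in_plane C \<longleftrightarrow> (\<exists>N x i. det N > 0 \<and> C = cone_of N \<and> N *v x = axis i 1 \<and> x $ 3 = 0 \<and> x $ 1 \<noteq> 0)"

definition bounded_mats :: "real \<Rightarrow> real \<Rightarrow> (real^3^3) set" where
  "bounded_mats m e = {N. (\<forall>i j. \<bar>N $ i $ j\<bar> \<le> m) \<and> e \<le> det N}"

lemma compact_bounded_mats: "compact (bounded_mats m e)"
proof -
  have "closed {N::real^3^3. \<bar>N $ i $ j\<bar> \<le> m}" for i j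
    by (intro closed_Collect_le continuous_intros)
  moreover have "closed {N::real^3^3. e \<le> det N}"
    by (intro closed_Collect_le continuous_det3 continuous_intros)
  moreover have "bounded_mats m e = (\<Inter>i. \<Inter>j. {N. \<bar>N $ i $ j\<bar> \<le> m}) \<inter> {N. e \<le> det N}"
    by (auto simp: bounded_mats_def)
  ultimately have "closed (bounded_mats m e)" by (simp only:) (intro closed_Int closed_INT ballI)
  moreover have "bounded (bounded_mats m e)"
  proof -
    have "norm N \<le> (\<Sum>i\<in>(UNIV::3 set). \<Sum>j\<in>(UNIV::3 set). m)" if "N \<in> bounded_mats m e" for N :: "real^3^3"
    proof -
      have "norm N \<le> (\<Sum>i\<in>UNIV. norm (N $ i))" unfolding norm_vec_def by (rule L2_set_le_sum) simp
      also have "\<dots> \<le> (\<Sum>i\<in>(UNIV::3 set). \<Sum>j\<in>(UNIV::3 set). m)"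
        using that by (intro sum_mono order_trans[OF norm_le_l1_cart]) (auto simp: bounded_mats_def)
      finally show ?thesis .
    qed
    then show ?thesis by (auto simp: bounded_iff)
  qed
  ultimately show ?thesis by (simp add: compact_eq_bounded_closed)
qed

context
  fixes \<mu> :: "(real^3) set measure"
  assumes \<mu>: "invariant_measure \<mu>"
begin

lemma bounded_mats_measure:
  assumes "e > 0"
  shows "cone_of ` bounded_mats m e \<in> sets \<mu>" "emeasure \<mu> (cone_of ` bounded_mats m e) < \<infinity>"
proof -
  have "det N > 0" if "N \<in> bounded_mats m e" for N using that assms by (simp add: bounded_mats_def)
  then show "cone_of ` bounded_mats m e \<in> sets \<mu>" "emeasure \<mu> (cone_of ` bounded_mats m e) < \<infinity>"
    using compact_cone_of_image_measure[OF \<mu> compact_bounded_mats] by blast+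
qed

text \<open>Apply the n shears of slope t/n to a part that comes from a compact family. The images
  have a ray with x_1 nonzero and slope x_3 / x_1 = t/n. A cone has three rays, so it lies in at
  most 3 images, while all images stay in one compact family. Letting n grow leaves only measure
  0.\<close>

lemma null_ray_in_plane:
  assumes A: "A \<in> sets \<mu>" "A \<subseteq> Collect ray_in_plane"
  shows "emeasure \<mu> A = 0"
proof -
  let ?K = "\<lambda>m. cone_of ` bounded_mats m 1"
  have K: "?K m \<in> sets \<mu>" "emeasure \<mu> (?K m) < \<infinity>" for m
    using bounded_mats_measure[of 1 m] by auto
  have z: "emeasure \<mu> (A \<inter> ?K (real m)) = 0" for m
  proof -
    let ?B = "A \<inter> ?K (real m)"
    have B: "?B \<in> sets \<mu>" using A K by auto
    have le: "of_nat n * emeasure \<mu> ?B \<le> 3 * emeasure \<mu> (?K (2 * real m))" for n :: nat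
    proof -
      define \<tau> where "\<tau> = (\<lambda>t::nat. real t / real n)"
      define G where "G = (\<lambda>t. act (shear (\<tau> t)) ` ?B)"
      have "of_nat (card {..<n}) * emeasure \<mu> ?B \<le> of_nat 3 * emeasure \<mu> (?K (2 * real m))"
      proof (rule multiplicity_bound[OF \<mu>, of _ G])
        fix t assume "t \<in> {..<n}"
        then have t: "0 \<le> \<tau> t" "\<tau> t \<le> 1" by (auto simp: \<tau>_def)
        show "G t \<in> sets \<mu>" unfolding G_def by (intro sets_act_pos[OF \<mu>] B) simp
        show "emeasure \<mu> (G t) = emeasure \<mu> ?B"
          using sets.sets_into_space[OF B]
          by (simp add: G_def emeasure_act_pos[OF \<mu>] space_invariant[OF \<mu>])
        show "G t \<subseteq> ?K (2 * real m)"
        proof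
          fix C assume "C \<in> G t"
          then obtain N where N: "N \<in> bounded_mats (real m) 1" "C = act (shear (\<tau> t)) (cone_of N)"
            by (auto simp: G_def)
          have C: "C = cone_of (N ** shear (- \<tau> t))"
            unfolding N(2) by (intro act_cone_of) (simp_all add: shear_mult shear_0)
          have "\<bar>(N ** shear (- \<tau> t)) $ i $ j\<bar> \<le> 2 * real m" for i j
          proof -
            have nb: "\<bar>N $ i $ j\<bar> \<le> real m" for i j using N(1) by (simp add: bounded_mats_def)
            have "(N ** shear (- \<tau> t)) $ i $ j = N $ i $ j - (if j = 1 then \<tau> t * N $ i $ 3 else 0)"
              using exhaust_3[of j] by (auto simp: matrix_matrix_mult_def sum_3 shear_def)
            moreover have "\<bar>if j = 1 then \<tau> t * N $ i $ 3 else 0\<bar> \<le> real m"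
              using t nb[of i 3] mult_mono[of "\<tau> t" 1 "\<bar>N $ i $ 3\<bar>" "real m"] by (auto simp: abs_mult)
            ultimately show ?thesis using nb[of i j] by linarith
          qed
          then show "C \<in> ?K (2 * real m)"
            unfolding C using N(1) by (intro imageI) (simp add: bounded_mats_def det_mul)
        qed
      next
        fix C
        let ?T = "{t \<in> {..<n}. C \<in> G t}"
        show "card ?T \<le> 3"
        proof (cases "?T = {}")
          case True
          then show ?thesis by (simp only: card.empty)
        next
          case False
          have sub: "G t \<subseteq> cones" for t
            using sets.sets_into_space[OF B] act_cones[of "shear (\<tau> t)"]
            by (auto simp: G_def space_invariant[OF \<mu>] SL3R_def)
          then have "C \<in> cones" using False by blast
          then obtain N0 where N0: "det N0 = 1" "C = cone_of N0" by (rule cones_cone_of)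
          obtain H where H: "N0 ** H = mat 1" "H ** N0 = mat 1" using det_pos_inverse[of N0] N0 by auto
          \<comment> \<open>Columns of the inverse matrix: generators of the three rays of
            \<open>C\<close>.\<close>
          define z where "z = (\<lambda>k. H *v axis k 1)"
          have ex: "\<exists>k. z k $ 1 \<noteq> 0 \<and> z k $ 3 = \<tau> t * z k $ 1" if t: "t \<in> ?T" for t
          proof -
            obtain D where D: "D \<in> A" "C = act (shear (\<tau> t)) D" using t by (auto simp: G_def)
            obtain N x i where N: "det N > 0" "D = cone_of N" "N *v x = axis i 1" "x $ 3 = 0" "x $ 1 \<noteq> 0"
              using set_mp[OF A(2) D(1)] unfolding mem_Collect_eq ray_in_plane_def by blast
            have C: "C = cone_of (N ** shear (- \<tau> t))"
              unfolding D(2) N(2) by (intro act_cone_of) (simp_all add: shear_mult shear_0)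
            obtain \<pi> c where \<pi>: "inj \<pi>" "\<And>i. c i > (0::real)"
              "\<And>i j. (N ** shear (- \<tau> t)) $ i $ j = c i * N0 $ \<pi> i $ j"
              using cone_of_eq[of N0 "N ** shear (- \<tau> t)"] C N0 N(1) by (auto simp: det_mul)
            define y where "y = shear (\<tau> t) *v x"
            have y: "y $ 1 = x $ 1" "y $ 3 = \<tau> t * x $ 1"
              using N(4) by (simp_all add: y_def matrix_vector_mult_def sum_3 shear_def)
            have "(N ** shear (- \<tau> t)) *v y = N *v ((shear (- \<tau> t) ** shear (\<tau> t)) *v x)"
              by (simp only: y_def matrix_vector_mul_assoc matrix_mul_assoc)
            then have Ny: "(N ** shear (- \<tau> t)) *v y = axis i 1" by (simp add: shear_mult shear_0 N)
            have comp: "c i' * (N0 *v y) $ \<pi> i' = axis i 1 $ i'" for i'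
            proof -
              have "((N ** shear (- \<tau> t)) *v y) $ i' = c i' * (N0 *v y) $ \<pi> i'"
                unfolding matrix_vector_mult_def[of "N ** shear (- \<tau> t)"] matrix_vector_mult_def[of N0]
                by (simp add: \<pi>(3) sum_distrib_left mult_ac)
              then show ?thesis by (simp add: Ny)
            qed
            have "surj \<pi>" using \<pi>(1) by (simp add: finite_UNIV_inj_surj)
            have "(N0 *v y) $ k = (1 / c i) * axis (\<pi> i) 1 $ k" for k
            proof -
              obtain i' where k: "k = \<pi> i'" using \<open>surj \<pi>\<close> by (metis surjD)
              show ?thesis
                using comp[of i'] \<pi>(2)[of i'] \<pi>(1) unfolding k by (auto simp: axis_def field_simps inj_eq)
            qed
            then have "N0 *v y = (1 / c i) *\<^sub>R axis (\<pi> i) 1" by (simp add: vec_eq_iff)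
            then have "H *v (N0 *v y) = (1 / c i) *\<^sub>R z (\<pi> i)"
              by (simp add: z_def matrix_vector_mult_scaleR)
            then have "y = (1 / c i) *\<^sub>R z (\<pi> i)" by (simp add: matrix_vector_mul_assoc H)
            then have "z (\<pi> i) = c i *\<^sub>R y" using \<pi>(2)[of i] by simp
            then show ?thesis using y N(5) \<pi>(2)[of i] by (intro exI[of _ "\<pi> i"]) simp
          qed
          then obtain k where k: "\<And>t. t \<in> ?T \<Longrightarrow> z (k t) $ 1 \<noteq> 0 \<and> z (k t) $ 3 = \<tau> t * z (k t) $ 1"
            by metis
          have "inj_on k ?T"
          proof (rule inj_onI)
            fix s t assume st: "s \<in> ?T" "t \<in> ?T" "k s = k t"
            then have "\<tau> s = \<tau> t" using k[of s] k[of t] by simp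
            then show "s = t" using st by (auto simp: \<tau>_def)
          qed
          then have "card ?T \<le> card (UNIV :: 3 set)" by (rule card_inj_on_le) auto
          then show ?thesis by simp
        qed
      qed (use K in auto)
      then show ?thesis by simp
    qed
    show ?thesis
    proof (rule ccontr)
      assume nz: "emeasure \<mu> ?B \<noteq> 0"
      have "(SUP n. of_nat n * emeasure \<mu> ?B) \<le> 3 * emeasure \<mu> (?K (2 * real m))"
        using le by (intro SUP_least)
      moreover have "(SUP n::nat. of_nat n * emeasure \<mu> ?B) = top"
        using nz by (simp add: SUP_mult_right_ennreal[symmetric] ennreal_SUP_of_nat_eq_top ennreal_top_mult)
      ultimately show False using K(2)[of "2 * real m"] by (simp add: top_unique ennreal_mult_eq_top_iff)
    qed
  qed
  have "A \<subseteq> (\<Union>m. A \<inter> ?K (real m))"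
  proof
    fix C assume C: "C \<in> A"
    then have "C \<in> cones" using sets.sets_into_space[OF A(1)] by (auto simp: space_invariant[OF \<mu>])
    then obtain N where N: "det N = 1" "C = cone_of N" by (rule cones_cone_of)
    obtain m :: nat where m: "norm N \<le> real m" using real_arch_simple by blast
    have "\<bar>N $ i $ j\<bar> \<le> real m" for i j
      using component_le_norm_cart[of "N $ i" j] Finite_Cartesian_Product.norm_nth_le[of N i] m by simp
    then have "N \<in> bounded_mats (real m) 1" using N by (simp add: bounded_mats_def)
    then show "C \<in> (\<Union>m. A \<inter> ?K (real m))" using N C by blast
  qed
  moreover have "emeasure \<mu> (\<Union>m. A \<inter> ?K (real m)) = 0"
    using A K z by (intro emeasure_UN_eq_0) auto
  moreover have "(\<Union>m. A \<inter> ?K (real m)) \<in> sets \<mu>" using A K by auto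
  ultimately show ?thesis by (metis emeasure_mono le_zero_eq)
qed

text \<open>For a fixed index the cone and the plane \<open>n i\<close> determine the moved face as
  the set of lattice points of the cone on that plane. So they determine its class, and \<gamma> up
  to the bounded stabilizer. Hence the sets \<open>B\<close>, over all classes and all \<gamma>,
  cover a cone of \<open>E i\<close> at most \<open>b\<close> times.\<close>

lemma frequency_sum_bound:
  fixes I :: "'i set" and E :: "'i \<Rightarrow> (real^3) set set" and w :: "'i \<Rightarrow> ennreal" and n :: "'i \<Rightarrow> real^3"
  assumes cnt: "countable I" and E: "\<And>i. i \<in> I \<Longrightarrow> E i \<in> sets \<mu>"
    and rep: "\<And>f. f \<in> sail_faces \<Longrightarrow> \<exists>\<gamma>\<in>SL3Z. \<exists>d::nat. act \<gamma> f \<subseteq> {x. x $ 3 = real d}"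
    and face: "\<And>C f. generic_cone C \<Longrightarrow> face_of_sail f C \<Longrightarrow>
      span f = UNIV \<and> (\<exists>m. f = {x \<in> C \<inter> lattice. m \<bullet> x = 1})"
    and cover: "\<And>C f d. generic_cone C \<Longrightarrow> face_of_sail f C \<Longrightarrow> f \<subseteq> {x. x $ 3 = real d} \<Longrightarrow>
      \<not> ray_in_plane C \<Longrightarrow> finite f \<and> (\<exists>i\<in>I. \<exists>G. finite G \<and> G \<subseteq> SL3Z \<and> 1 \<le> w i * of_nat (card G) \<and>
        (\<forall>\<gamma>\<in>G. act \<gamma> f \<subseteq> {x. n i \<bullet> x = 1} \<and> act \<gamma> C \<in> E i))"
  obtains b :: nat where "\<And>F. finite F \<Longrightarrow> F \<subseteq> face_classes \<Longrightarrow>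
    (\<Sum>c\<in>F. rel_class \<mu> c) \<le> of_nat b * (\<integral>\<^sup>+i. w i * emeasure \<mu> (E i) \<partial>count_space I)"
proof -
  obtain b :: nat where b: "\<And>f f'. finite f \<Longrightarrow> f \<subseteq> lattice \<Longrightarrow> span f = UNIV \<Longrightarrow>
    finite {\<gamma> \<in> SL3Z. act \<gamma> f = f'} \<and> card {\<gamma> \<in> SL3Z. act \<gamma> f = f'} \<le> b"
    by (rule stabilizer_bound) blast
  define S where "S = (\<lambda>f. {C. generic_cone C \<and> face_of_sail f C})"
  have relS: "rel \<mu> f = emeasure \<mu> (S f)" for f by (simp add: rel_def S_def)
  have SL: "\<gamma> \<in> SL3Z \<Longrightarrow> \<gamma> \<in> SL3R" for \<gamma> by (simp add: SL3Z_def)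
  have S_act: "S (act \<gamma> f) = act \<gamma> ` S f" if \<gamma>: "\<gamma> \<in> SL3Z" for \<gamma> f
  proof -
    obtain h where h: "h \<in> SL3Z" "\<gamma> ** h = mat 1" "h ** \<gamma> = mat 1"
      using SL3Z_inverse[OF \<gamma>] .
    show ?thesis
      unfolding image_act_eq[OF h(2,3)] S_def
      using generic_cone_act face_of_sail_act \<gamma> h(1) act_inverse[OF h(2)] act_inverse[OF h(3)]
      by (auto; metis)
  qed
  have "(\<Sum>c\<in>F. rel_class \<mu> c) \<le> of_nat b * (\<integral>\<^sup>+i. w i * emeasure \<mu> (E i) \<partial>count_space I)"
    if F: "finite F" "F \<subseteq> face_classes" for F
  proof -
    have "\<exists>f d. rel_class \<mu> c = rel \<mu> f \<and> c = integer_equiv `` {f} \<and> f \<subseteq> {x. x $ 3 = real d}"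
      if "c \<in> F" for c
    proof -
      obtain f where f: "f \<in> sail_faces" "c = integer_equiv `` {f}"
        using F(2) \<open>c \<in> F\<close> by (auto simp: face_classes_def quotient_def)
      obtain \<gamma> d where \<gamma>: "\<gamma> \<in> SL3Z" "act \<gamma> f \<subseteq> {x. x $ 3 = real d}" using rep[OF f(1)] by blast
      have "(f, act \<gamma> f) \<in> integer_equiv" using \<gamma>(1) by (auto simp: integer_equiv_def)
      then have "c = integer_equiv `` {act \<gamma> f}"
        unfolding f(2) by (rule equiv_class_eq[OF equiv_integer_equiv])
      then show ?thesis using \<gamma>(2) rel_class_eq[OF \<mu>] by metis
    qed
    then obtain r d where r: "\<And>c. c \<in> F \<Longrightarrow> rel_class \<mu> c = rel \<mu> (r c)"
      "\<And>c. c \<in> F \<Longrightarrow> c = integer_equiv `` {r c}"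
      "\<And>c. c \<in> F \<Longrightarrow> r c \<subseteq> {x. x $ 3 = real (d c)}" by metis
    \<comment> \<open>The other classes contribute 0: \<open>emeasure\<close> is 0 outside the
      sigma-algebra, and by \<open>cover\<close> an infinite face occurs only for cones in the null
      family \<open>ray_in_plane\<close>.\<close>
    define F' where "F' = {c \<in> F. S (r c) \<in> sets \<mu> \<and> finite (r c) \<and> S (r c) \<noteq> {}}"
    have F': "finite F'" using F(1) by (simp add: F'_def)
    have z: "rel_class \<mu> c = 0" if c: "c \<in> F" "c \<notin> F'" for c
    proof -
      consider "S (r c) \<notin> sets \<mu>" | "S (r c) = {}" | "S (r c) \<in> sets \<mu>" "infinite (r c)"
        using c by (auto simp: F'_def)
      then have "emeasure \<mu> (S (r c)) = 0"
      proof cases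
        case 3
        then have "S (r c) \<subseteq> Collect ray_in_plane"
          using cover r(3)[OF c(1)] by (auto simp: S_def)
        then show ?thesis using null_ray_in_plane 3 by blast
      qed (simp_all add: emeasure_notin_sets)
      then show ?thesis using r(1)[OF c(1)] relS by simp
    qed
    have props: "r c \<subseteq> lattice" "span (r c) = UNIV" if "c \<in> F'" for c
      using that face by (fastforce simp: F'_def S_def)+
    define B where "B = (\<lambda>f i \<gamma>. if act \<gamma> f \<subseteq> {x. n i \<bullet> x = 1} then S (act \<gamma> f) \<inter> E i else {})"
    have B: "B (r c) i \<gamma> \<in> sets \<mu>" if "c \<in> F'" "i \<in> I" "\<gamma> \<in> SL3Z" for c i \<gamma>
      using that E sets_act[OF SL \<mu>] by (auto simp: B_def S_act F'_def)
    have one: "emeasure \<mu> (S (r c)) \<le>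
      (\<integral>\<^sup>+i. w i * (\<integral>\<^sup>+\<gamma>. emeasure \<mu> (B (r c) i \<gamma>) \<partial>count_space SL3Z) \<partial>count_space I)"
      if c: "c \<in> F'" for c
    proof -
      \<comment> \<open>The part of \<open>S (r c)\<close> that \<gamma> moves into
        \<open>E i\<close>. Its image under \<gamma> is \<open>B (r c) i \<gamma>\<close>, which has
        the same measure.\<close>
      define A where "A = (\<lambda>i \<gamma>. if act \<gamma> (r c) \<subseteq> {x. n i \<bullet> x = 1} then {C \<in> S (r c). act \<gamma> C \<in> E i} else {})"
      have AB: "act \<gamma> ` A i \<gamma> = B (r c) i \<gamma>" "A i \<gamma> = act (SOME h. h \<in> SL3Z \<and> \<gamma> ** h = mat 1 \<and> h ** \<gamma> = mat 1) ` B (r c) i \<gamma>"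
        "(SOME h. h \<in> SL3Z \<and> \<gamma> ** h = mat 1 \<and> h ** \<gamma> = mat 1) \<in> SL3Z" if \<gamma>: "\<gamma> \<in> SL3Z" for i \<gamma>
      proof -
        let ?h = "SOME h. h \<in> SL3Z \<and> \<gamma> ** h = mat 1 \<and> h ** \<gamma> = mat 1"
        have h: "?h \<in> SL3Z" "\<gamma> ** ?h = mat 1" "?h ** \<gamma> = mat 1"
          using SL3Z_inverse[OF \<gamma>] someI_ex[of "\<lambda>h. h \<in> SL3Z \<and> \<gamma> ** h = mat 1 \<and> h ** \<gamma> = mat 1"] by metis+
        show "?h \<in> SL3Z" by (rule h)
        show 1: "act \<gamma> ` A i \<gamma> = B (r c) i \<gamma>"
          by (auto simp: A_def B_def S_act[OF \<gamma>])
        show "A i \<gamma> = act ?h ` B (r c) i \<gamma>"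
          by (simp add: 1[symmetric] image_image act_inverse[OF h(3)])
      qed
      have "emeasure \<mu> (S (r c)) \<le>
        (\<integral>\<^sup>+i. w i * (\<integral>\<^sup>+\<gamma>. emeasure \<mu> (A i \<gamma>) \<partial>count_space SL3Z) \<partial>count_space I)"
      proof (rule emeasure_weighted_cover[where Z = "Collect ray_in_plane"])
        show "A i \<gamma> \<in> sets \<mu>" if "i \<in> I" "\<gamma> \<in> SL3Z" for i \<gamma>
          unfolding AB(2)[OF that(2)] using B[OF c that] AB(3)[OF that(2)] by (intro sets_act[OF SL \<mu>])
      next
        fix C assume C: "C \<in> S (r c)" "C \<notin> Collect ray_in_plane"
        have "r c \<subseteq> {x. x $ 3 = real (d c)}" using c by (intro r) (simp add: F'_def)
        then have "\<exists>i\<in>I. \<exists>G. finite G \<and> G \<subseteq> SL3Z \<and> 1 \<le> w i * of_nat (card G) \<and>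
          (\<forall>\<gamma>\<in>G. act \<gamma> (r c) \<subseteq> {x. n i \<bullet> x = 1} \<and> act \<gamma> C \<in> E i)"
          using cover[of C "r c"] C by (simp add: S_def)
        then show "\<exists>i\<in>I. \<exists>G. finite G \<and> G \<subseteq> SL3Z \<and> 1 \<le> w i * of_nat (card G) \<and> (\<forall>\<gamma>\<in>G. C \<in> A i \<gamma>)"
        proof (elim bexE exE conjE)
          fix i G assume i: "i \<in> I" and G: "finite G" "G \<subseteq> SL3Z" "1 \<le> w i * of_nat (card G)"
            and GE: "\<forall>\<gamma>\<in>G. act \<gamma> (r c) \<subseteq> {x. n i \<bullet> x = 1} \<and> act \<gamma> C \<in> E i"
          have "\<forall>\<gamma>\<in>G. C \<in> A i \<gamma>" using GE C(1) by (simp add: A_def)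
          then show ?thesis using i G by blast
        qed
      next
        fix B assume "B \<in> sets \<mu>" "B \<subseteq> S (r c) \<inter> Collect ray_in_plane"
        then show "emeasure \<mu> B = 0" by (intro null_ray_in_plane) auto
      qed (use c cnt countable_SL3Z in \<open>auto simp: F'_def\<close>)
      also have "\<dots> = (\<integral>\<^sup>+i. w i * (\<integral>\<^sup>+\<gamma>. emeasure \<mu> (B (r c) i \<gamma>) \<partial>count_space SL3Z) \<partial>count_space I)"
        by (intro nn_integral_cong arg_cong2[where f = "(*)"] refl)
           (simp add: AB(1)[symmetric] emeasure_act[OF SL \<mu>])
      finally show ?thesis .
    qed
    have mult: "(\<Sum>c\<in>F'. \<integral>\<^sup>+\<gamma>. emeasure \<mu> (B (r c) i \<gamma>) \<partial>count_space SL3Z) \<le> of_nat b * emeasure \<mu> (E i)"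
      if i: "i \<in> I" for i
    proof (rule sum_emeasure_multiplicity[OF F' countable_SL3Z])
      fix C
      let ?X = "{(c, \<gamma>) \<in> F' \<times> SL3Z. C \<in> B (r c) i \<gamma>}"
      show "finite ?X \<and> card ?X \<le> b"
      proof (cases "?X = {}")
        case True
        then show ?thesis by (simp only: card.empty finite.emptyI) simp
      next
        case False
        let ?f = "{x \<in> C \<inter> lattice. n i \<bullet> x = 1}"
        have eq: "act \<gamma> (r c) = ?f" if X: "(c, \<gamma>) \<in> ?X" for c \<gamma>
        proof -
          have CS: "generic_cone C" "face_of_sail (act \<gamma> (r c)) C" and sub: "act \<gamma> (r c) \<subseteq> {x. n i \<bullet> x = 1}"
            using X by (auto simp: B_def S_def split: if_splits)
          obtain m where sp: "span (act \<gamma> (r c)) = UNIV" and m: "act \<gamma> (r c) = {x \<in> C \<inter> lattice. m \<bullet> x = 1}"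
            using face[OF CS] by blast
          \<comment> \<open>Two linear forms with value 1 on a spanning set are equal, so the form
            supporting the face is the prescribed \<open>n i\<close>.\<close>
          have "x \<bullet> m = x \<bullet> n i" if "x \<in> act \<gamma> (r c)" for x
            using that m sub by (auto simp: inner_commute)
          then have "x \<bullet> m = x \<bullet> n i" for x
            using linear_eq_on_span[of "\<lambda>x. x \<bullet> m" "\<lambda>x. x \<bullet> n i" "act \<gamma> (r c)"] sp
              bounded_linear.linear[OF bounded_linear_inner_left] by blast
          then have "m = n i" by (metis vector_eq_ldot)
          then show ?thesis using m by simp
        qed
        obtain c0 \<gamma>0 where X0: "(c0, \<gamma>0) \<in> ?X" using False by auto
        have c0: "c = c0" if X: "(c, \<gamma>) \<in> ?X" for c \<gamma>
        proof -
          have "(r c, ?f) \<in> integer_equiv" "(r c0, ?f) \<in> integer_equiv"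
            using eq[OF X] eq[OF X0] X X0 by (auto simp: integer_equiv_def)
          then have "integer_equiv `` {r c} = integer_equiv `` {r c0}"
            using equiv_class_eq[OF equiv_integer_equiv] by metis
          then show ?thesis using r(2)[of c] r(2)[of c0] X X0 by (auto simp: F'_def)
        qed
        let ?Y = "{\<gamma> \<in> SL3Z. act \<gamma> (r c0) = ?f}"
        have sub: "?X \<subseteq> {c0} \<times> ?Y"
        proof
          fix y assume y: "y \<in> ?X"
          obtain c \<gamma> where cg: "y = (c, \<gamma>)" by (cases y)
          have "c = c0" using c0 y unfolding cg by blast
          moreover have "act \<gamma> (r c) = ?f" using eq y unfolding cg by blast
          ultimately show "y \<in> {c0} \<times> ?Y" using y unfolding cg by auto
        qed
        have "c0 \<in> F'" using X0 by auto
        then have Y: "finite ?Y" "card ?Y \<le> b" using b[of "r c0" ?f] props by (auto simp: F'_def)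
        have "finite ?X" using sub by (rule finite_subset) (use Y in auto)
        moreover have "card ?X \<le> card ({c0} \<times> ?Y)" using sub by (rule card_mono[rotated]) (use Y in auto)
        ultimately show ?thesis using Y(2) by (simp add: card_cartesian_product)
      qed
    qed (use B i E in \<open>auto simp: B_def split: if_splits\<close>)
    have "(\<Sum>c\<in>F. rel_class \<mu> c) = (\<Sum>c\<in>F'. rel_class \<mu> c)"
      using z F by (intro sum.mono_neutral_right) (auto simp: F'_def)
    also have "\<dots> \<le> (\<Sum>c\<in>F'. \<integral>\<^sup>+i. w i * (\<integral>\<^sup>+\<gamma>. emeasure \<mu> (B (r c) i \<gamma>) \<partial>count_space SL3Z) \<partial>count_space I)"
      using one r(1) by (intro sum_mono) (auto simp: relS F'_def)
    also have "\<dots> = (\<integral>\<^sup>+i. w i * (\<Sum>c\<in>F'. \<integral>\<^sup>+\<gamma>. emeasure \<mu> (B (r c) i \<gamma>) \<partial>count_space SL3Z) \<partial>count_space I)"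
      by (subst nn_integral_sum[symmetric]) (auto simp: sum_distrib_left)
    also have "\<dots> \<le> (\<integral>\<^sup>+i. w i * (of_nat b * emeasure \<mu> (E i)) \<partial>count_space I)"
      using mult by (intro nn_integral_mono mult_left_mono) auto
    also have "\<dots> = of_nat b * (\<integral>\<^sup>+i. w i * emeasure \<mu> (E i) \<partial>count_space I)"
      by (subst nn_integral_cmult[symmetric]) (auto simp: mult_ac)
    finally show ?thesis .
  qed
  then show ?thesis by (rule that)
qed

end

section \<open>Faces of generic sails\<close>

lemma convex_cone_of: "convex (cone_of N)"
  unfolding cone_of_def convex_def
  by (auto simp: matrix_vector_right_distrib matrix_vector_mult_scaleR)

lemma cone_of_row: "cone_of N = {x. \<forall>i. 0 \<le> N $ i \<bullet> x}"
  by (simp add: cone_of_def matrix_vector_mul_component)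

lemma matrix_inverse_expansion:
  fixes N H :: "real^3^3"
  assumes "H ** N = mat 1"
  shows "x = (\<Sum>j\<in>UNIV. (N $ j \<bullet> x) *\<^sub>R (H *v axis j 1))"
proof -
  have "H *v (N *v x) = x" by (simp add: matrix_vector_mul_assoc assms)
  moreover have "N *v x = (\<Sum>j\<in>UNIV. (N $ j \<bullet> x) *\<^sub>R axis j 1)"
    by (simp add: vec_eq_iff matrix_vector_mul_component axis_def sum.If_cases if_distrib cong: if_cong)
  ultimately show ?thesis
    by (simp add: linear_sum[OF matrix_vector_mul_linear] matrix_vector_mult_scaleR)
qed

lemma row_inverse_axis:
  fixes N H :: "real^3^3"
  assumes "N ** H = mat 1"
  shows "N $ i \<bullet> (H *v axis j 1) = (if i = j then 1 else 0)"
proof -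
  have "N $ i \<bullet> (H *v axis j 1) = (N *v (H *v axis j 1)) $ i" by (simp add: matrix_vector_mul_component)
  also have "\<dots> = axis j 1 $ i" by (simp add: matrix_vector_mul_assoc assms)
  finally show ?thesis by (simp add: axis_def)
qed

text \<open>\<open>generic_cone\<close> speaks of spans of facets. The facet on which row
  \<open>i\<close> vanishes contains the other two generating rays, so it spans the whole plane
  orthogonal to that row.\<close>

lemma generic_row_nonzero:
  assumes gen: "generic_cone (cone_of N)" and N: "det N > 0"
    and x: "x \<in> lattice" "x \<noteq> 0"
  shows "N $ i \<bullet> x \<noteq> 0"
proof
  assume 0: "N $ i \<bullet> x = 0"
  obtain H where H: "N ** H = mat 1" "H ** N = mat 1" using det_pos_inverse[OF N] .
  let ?C = "cone_of N" and ?F = "cone_of N \<inter> {x. N $ i \<bullet> x = 0}"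
  have Ni: "N $ i \<noteq> 0" using row_inverse_axis[OF H(1), of i i] by force
  have face: "?F face_of ?C"
    by (rule face_of_Int_supporting_hyperplane_ge[OF convex_cone_of]) (simp add: cone_of_row)
  have HF: "H *v axis j 1 \<in> ?F" if "j \<noteq> i" for j
    using that by (simp add: cone_of_row row_inverse_axis[OF H(1)])
  have HC: "H *v axis j 1 \<in> ?C" for j
    by (simp add: cone_of_row row_inverse_axis[OF H(1)])
  have spF: "span ?F = {x. N $ i \<bullet> x = 0}"
  proof
    show "span ?F \<subseteq> {x. N $ i \<bullet> x = 0}" by (rule span_minimal) (auto simp: subspace_hyperplane)
    show "{x. N $ i \<bullet> x = 0} \<subseteq> span ?F"
    proof
      fix y assume y: "y \<in> {x. N $ i \<bullet> x = 0}"
      have "(N $ j \<bullet> y) *\<^sub>R (H *v axis j 1) \<in> span ?F" for j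
        using y HF[of j] by (cases "j = i") (auto intro: span_mul span_base span_zero)
      then have "(\<Sum>j\<in>UNIV. (N $ j \<bullet> y) *\<^sub>R (H *v axis j 1)) \<in> span ?F" by (intro span_sum)
      then show "y \<in> span ?F" using matrix_inverse_expansion[OF H(2), of y] by simp
    qed
  qed
  have spC: "span ?C = UNIV"
  proof -
    have "y \<in> span ?C" for y
      by (subst matrix_inverse_expansion[OF H(2), of y]) (intro span_sum span_mul span_base HC)
    then show ?thesis by blast
  qed
  have dF: "dim ?F = 2"
    using dim_span[of ?F] dim_hyperplane[OF Ni] by (simp add: spF)
  have dC: "dim ?C = 3"
    using dim_span[of ?C] by (simp add: spC)
  have z: "0 \<in> ?F" by (simp add: cone_of_def)
  then have "aff_dim ?F = 2" "aff_dim ?C = 3"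
    using dF dC by (auto simp: aff_dim_zero hull_inc)
  then have "?F facet_of ?C"
    using face z unfolding facet_of_def by auto
  then have "span ?F \<inter> lattice = {0}" using gen by (simp add: generic_cone_def)
  then show False using 0 x spF by blast
qed

text \<open>The form \<open>m\<close> is the supporting functional of the face, normalized to 1
  there; this requires its level \<open>b\<close> to be positive. The face then has an affine hull
  that misses 0, so being two-dimensional it spans the space.\<close>

lemma face_data:
  assumes gen: "generic_cone C" and face: "face_of_sail f C"
  obtains m where "f = {x \<in> C \<inter> lattice. m \<bullet> x = 1}"
    "\<And>x. x \<in> C \<inter> lattice \<Longrightarrow> x \<noteq> 0 \<Longrightarrow> 1 \<le> m \<bullet> x" "span f = UNIV"
proof -
  define A where "A = C \<inter> lattice - {0}"
  let ?K = "convex hull A"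
  have "C \<in> cones" using gen by (simp add: generic_cone_def)
  then obtain N where N: "det N = 1" "C = cone_of N" by (rule cones_cone_of)
  have pos: "N $ i \<bullet> x > 0" if "x \<in> A" for x i
    using that generic_row_nonzero[of N x i] gen N by (auto simp: A_def cone_of_row less_le)
  have Kpoly: "?K = klein_polyhedron C" by (simp add: klein_polyhedron_def A_def)
  obtain F where F: "F face_of ?K" "aff_dim F = 2" "f = F \<inter> lattice"
    using face unfolding face_of_sail_def Kpoly by blast
  obtain a b where ab: "a \<noteq> 0" "affine hull F = {x. a \<bullet> x = b}"
    using aff_dim_eq_hyperplane[of F] F(2) by auto
  have FK: "F = ?K \<inter> {x. a \<bullet> x = b}"
    using face_of_imp_eq_affine_Int[OF _ F(1)] ab(2) by auto
  have "(\<forall>x\<in>?K. a \<bullet> x \<ge> b) \<or> (\<forall>x\<in>?K. a \<bullet> x \<le> b)"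
  proof (rule ccontr)
    assume "\<not> ?thesis"
    then obtain x y where xy: "x \<in> ?K" "y \<in> ?K" "a \<bullet> x < b" "a \<bullet> y > b" by force
    define u where "u = (b - a \<bullet> x) / (a \<bullet> y - a \<bullet> x)"
    have u: "0 < u" "u < 1" using xy by (auto simp: u_def field_simps)
    define z where "z = (1 - u) *\<^sub>R x + u *\<^sub>R y"
    have "a \<bullet> z = a \<bullet> x + u * (a \<bullet> y - a \<bullet> x)" by (simp add: z_def inner_add_right algebra_simps)
    also have "\<dots> = b" using xy by (simp add: u_def)
    finally have az: "a \<bullet> z = b" .
    have zs: "z \<in> open_segment x y" using u xy by (auto simp: in_segment z_def)
    have "z \<in> ?K" using u xy convex_convex_hull[of A] unfolding z_def by (intro convexD) auto
    then have "z \<in> F" using FK az by blast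
    then have "x \<in> F" using face_ofD[OF F(1) zs] xy by blast
    then show False using FK xy by auto
  qed
  then obtain a b where ab: "a \<noteq> 0" "\<And>x. x \<in> ?K \<Longrightarrow> a \<bullet> x \<ge> b" "F = ?K \<inter> {x. a \<bullet> x = b}"
  proof
    assume "\<forall>x\<in>?K. a \<bullet> x \<ge> b"
    then show ?thesis using that[of a b] ab FK by blast
  next
    assume "\<forall>x\<in>?K. a \<bullet> x \<le> b"
    then show ?thesis using that[of "-a" "-b"] ab FK by auto
  qed
  define A0 where "A0 = A \<inter> {x. a \<bullet> x = b}"
  \<comment> \<open>The polyhedron is a hull of infinitely many points. To see that its face is the
    hull of the lattice points on the plane, enclose it in this convex set: an open half-space
    together with that hull.\<close>
  let ?Q = "{x. b < a \<bullet> x} \<union> convex hull A0"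
  have A0b: "a \<bullet> x = b" if "x \<in> convex hull A0" for x
    using hull_minimal[of A0 "{x. a \<bullet> x = b}" convex] that by (auto simp: A0_def convex_hyperplane)
  have "convex ?Q"
  proof (rule convex_alt[THEN iffD2], intro ballI allI impI)
    fix x y and u :: real assume x: "x \<in> ?Q" and y: "y \<in> ?Q" and u: "0 \<le> u \<and> u \<le> 1"
    have xb: "a \<bullet> x \<ge> b" and yb: "a \<bullet> y \<ge> b" using x y A0b by force+
    consider "u = 0" | "u = 1" | "x \<in> convex hull A0" "y \<in> convex hull A0"
      | "0 < u" "u < 1" "a \<bullet> x > b \<or> a \<bullet> y > b" using x y u by fastforce
    then show "(1 - u) *\<^sub>R x + u *\<^sub>R y \<in> ?Q"
    proof cases
      case 1
      then show ?thesis using x by simp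
    next
      case 2
      then show ?thesis using y by simp
    next
      case 3
      then have "(1 - u) *\<^sub>R x + u *\<^sub>R y \<in> convex hull A0" using u convex_convex_hull[of A0] unfolding convex_alt by blast
      then show ?thesis by simp
    next
      case 4
      have "(1 - u) * (a \<bullet> x - b) + u * (a \<bullet> y - b) > 0"
        using 4 xb yb by (smt (verit) mult_pos_pos mult_nonneg_nonneg)
      then have "b < a \<bullet> ((1 - u) *\<^sub>R x + u *\<^sub>R y)" by (simp add: inner_add_right algebra_simps)
      then show ?thesis by simp
    qed
  qed
  moreover have "A \<subseteq> ?Q"
  proof
    fix x assume "x \<in> A"
    moreover then have "b \<le> a \<bullet> x" using ab(2) hull_inc by fast
    ultimately show "x \<in> ?Q" by (cases "a \<bullet> x = b") (auto simp: A0_def hull_inc)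
  qed
  ultimately have "?K \<subseteq> ?Q" by (intro hull_minimal)
  then have "F \<subseteq> convex hull A0" using ab(3) by auto
  moreover have "A0 \<subseteq> F" using ab(3) by (auto simp: A0_def hull_inc)
  ultimately have d0: "aff_dim A0 = 2"
    using F(2) aff_dim_subset[of A0 F] aff_dim_subset[of F "convex hull A0"] by (simp add: aff_dim_convex_hull)
  then have "A0 \<noteq> {}" by auto
  then obtain p where p: "p \<in> A" "a \<bullet> p = b" by (auto simp: A0_def)
  have inA: "x \<in> A" if "x \<in> lattice" "x \<noteq> 0" "\<And>i. N $ i \<bullet> x \<ge> 0" for x
    using that by (simp add: A_def N(2) cone_of_row)
  have aA: "a \<bullet> x \<ge> b" if "x \<in> A" for x using ab(2) that hull_inc by fast
  \<comment> \<open>Doubling \<open>p\<close> would undercut a negative minimum. A minimum 0 is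
    undercut by a large multiple of \<open>p\<close>, which is interior by genericity, plus a
    lattice step \<open>v\<close> on which \<open>a\<close> is negative.\<close>
  have b: "b > 0"
  proof (rule ccontr)
    assume "\<not> b > 0"
    moreover have "\<not> b < 0"
    proof
      assume "b < 0"
      have "2 *\<^sub>R p \<in> A"
        using p pos[OF p(1)] by (intro inA) (auto simp: A_def less_imp_le intro: lattice_scale)
      then show False using aA[of "2 *\<^sub>R p"] p \<open>b < 0\<close> by simp
    qed
    ultimately have b0: "b = 0" by simp
    obtain i where i: "a $ i \<noteq> 0" using ab(1) by (auto simp: vec_eq_iff)
    define v :: "real^3" where "v = (- sgn (a $ i)) *\<^sub>R axis i 1"
    have vl: "v \<in> lattice" by (auto simp: v_def lattice_def axis_def sgn_if)
    have av: "a \<bullet> v < 0" using i by (simp add: v_def inner_axis sgn_if)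
    have "\<exists>k::nat. \<forall>j. real k * (N $ j \<bullet> p) \<ge> - (N $ j \<bullet> v)"
    proof -
      have "\<exists>k::nat. real k * (N $ j \<bullet> p) \<ge> - (N $ j \<bullet> v)" for j
        using ex_less_of_nat_mult[OF pos[OF p(1), of j], of "- (N $ j \<bullet> v)"] less_imp_le by blast
      then obtain k :: "3 \<Rightarrow> nat" where k: "\<And>j. real (k j) * (N $ j \<bullet> p) \<ge> - (N $ j \<bullet> v)" by metis
      have "real (Max (range k)) * (N $ j \<bullet> p) \<ge> real (k j) * (N $ j \<bullet> p)" for j
        using pos[OF p(1), of j] by (intro mult_right_mono) auto
      then show ?thesis using k order_trans by blast
    qed
    then obtain k :: nat where k: "\<And>j. real k * (N $ j \<bullet> p) \<ge> - (N $ j \<bullet> v)" by blast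
    let ?x = "real k *\<^sub>R p + v"
    have ax: "a \<bullet> ?x < 0" using p b0 av by (simp add: inner_add_right)
    have "0 \<le> N $ j \<bullet> ?x" for j using k[of j] by (simp add: inner_add_right)
    moreover have "?x \<in> lattice" using p vl by (intro lattice_add lattice_scale) (auto simp: A_def)
    moreover have "?x \<noteq> 0" using ax by force
    ultimately have "?x \<in> A" by (intro inA)
    then show False using aA[of ?x] ax b0 by simp
  qed
  have KC: "?K \<subseteq> C" unfolding N(2) by (rule hull_minimal) (auto simp: A_def N(2) convex_cone_of)
  have f: "f = {x \<in> C \<inter> lattice. ((1/b) *\<^sub>R a) \<bullet> x = 1}"
  proof
    show "f \<subseteq> {x \<in> C \<inter> lattice. ((1/b) *\<^sub>R a) \<bullet> x = 1}" using KC b by (auto simp: F(3) ab(3))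
    show "{x \<in> C \<inter> lattice. ((1/b) *\<^sub>R a) \<bullet> x = 1} \<subseteq> f"
    proof
      fix x assume x: "x \<in> {x \<in> C \<inter> lattice. ((1/b) *\<^sub>R a) \<bullet> x = 1}"
      then have "x \<in> A" by (auto simp: A_def)
      then show "x \<in> f" using x b hull_inc[of x A convex] by (auto simp: F(3) ab(3) divide_simps split: if_splits)
    qed
  qed
  have "A0 \<subseteq> f" using b by (auto simp: f A0_def A_def)
  have "affine hull f \<subseteq> {x. a \<bullet> x = b}"
    by (rule hull_minimal) (use b in \<open>auto simp: f affine_hyperplane\<close>)
  then have "0 \<notin> affine hull f" using b by auto
  moreover have "aff_dim f \<ge> 2" using aff_dim_subset[OF \<open>A0 \<subseteq> f\<close>] d0 by simp
  ultimately have "aff_dim (insert 0 f) \<ge> 3" by (simp add: aff_dim_insert)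
  moreover have "aff_dim (insert 0 f) = int (dim (insert 0 f))" by (intro aff_dim_zero hull_inc) simp
  ultimately have "dim f \<ge> 3" by (simp add: dim_insert span_zero)
  then have "span f = UNIV"
    using dim_eq_full[of f] dim_subset_UNIV[of f] by simp
  then show ?thesis
    using that[OF f] aA b by (auto simp: A_def divide_simps)
qed

text \<open>Lattice points \<open>\<lfloor>t x\<rfloor> + M p\<close> with \<open>p\<close> in the interior follow the direction \<open>x\<close> inside the cone.\<close>

lemma cone_nonneg_of_lattice:
  assumes p: "p \<in> lattice" "\<And>i. N $ i \<bullet> p > 0" and x: "x \<in> cone_of N"
    and m: "\<And>y. y \<in> cone_of N \<inter> lattice \<Longrightarrow> 0 \<le> m \<bullet> y"
  shows "0 \<le> m \<bullet> x"
proof (rule ccontr)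
  assume "\<not> 0 \<le> m \<bullet> x"
  then have neg: "- (m \<bullet> x) > 0" by simp
  \<comment> \<open>The rounding error: norm at most 3, one for each coordinate. The multiple
    \<open>M\<close> of \<open>p\<close> outweighs it in every row.\<close>
  define e where "e = (\<lambda>t::nat. \<chi> i. of_int \<lfloor>real t * x $ i\<rfloor> - real t * x $ i)"
  have ebound: "norm (e t) \<le> 3" for t
  proof -
    have "norm (e t) \<le> (\<Sum>i\<in>UNIV. \<bar>e t $ i\<bar>)" by (rule norm_le_l1_cart)
    also have "\<dots> \<le> (\<Sum>i\<in>(UNIV::3 set). 1)"
      by (intro sum_mono) (simp add: e_def abs_le_iff, linarith)
    finally show ?thesis by simp
  qed
  have "\<exists>M::nat. \<forall>j. real M * (N $ j \<bullet> p) \<ge> 3 * norm (N $ j)"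
  proof -
    have "\<exists>k::nat. real k * (N $ j \<bullet> p) \<ge> 3 * norm (N $ j)" for j
      using ex_less_of_nat_mult[OF p(2), of "3 * norm (N $ j)" j] less_imp_le by blast
    then obtain k :: "3 \<Rightarrow> nat" where k: "\<And>j. real (k j) * (N $ j \<bullet> p) \<ge> 3 * norm (N $ j)" by metis
    have "real (Max (range k)) * (N $ j \<bullet> p) \<ge> real (k j) * (N $ j \<bullet> p)" for j
      using p(2)[of j] by (intro mult_right_mono) auto
    then show ?thesis using k order_trans by blast
  qed
  then obtain M :: nat where M: "\<And>j. real M * (N $ j \<bullet> p) \<ge> 3 * norm (N $ j)" by blast
  obtain t :: nat where t: "real t * (- (m \<bullet> x)) > 3 * norm m + real M * (m \<bullet> p)"
    using ex_less_of_nat_mult[OF neg] by blast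
  define y where "y = real t *\<^sub>R x + e t + real M *\<^sub>R p"
  have ie: "\<bar>a \<bullet> e t\<bar> \<le> 3 * norm a" for a
    using Cauchy_Schwarz_ineq2[of a "e t"] mult_left_mono[OF ebound[of t], of "norm a"] by simp
  have "0 \<le> N $ j \<bullet> y" for j
  proof -
    have "0 \<le> real t * (N $ j \<bullet> x)" using x by (simp add: cone_of_row)
    then show ?thesis using ie[of "N $ j"] M[of j] by (simp add: y_def inner_add_right)
  qed
  moreover have "y \<in> lattice"
  proof -
    have "real t *\<^sub>R x + e t = (\<chi> i. of_int \<lfloor>real t * x $ i\<rfloor>)" by (simp add: e_def vec_eq_iff)
    then show ?thesis using p(1) by (auto simp: y_def lattice_def)
  qed
  ultimately have "0 \<le> m \<bullet> y" by (intro m) (simp add: cone_of_row)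
  then show False using t ie[of m] by (simp add: y_def inner_add_right)
qed

section \<open>Lattice bases adapted to the plane of a face\<close>

definition cols :: "real^3 \<Rightarrow> real^3 \<Rightarrow> real^3 \<Rightarrow> real^3^3" where
  "cols a b c = (\<chi> i j. if j = 1 then a $ i else if j = 2 then b $ i else c $ i)"

lemma cols_mult_vec: "cols a b c *v y = y $ 1 *\<^sub>R a + y $ 2 *\<^sub>R b + y $ 3 *\<^sub>R c"
  by (simp add: vec_eq_iff cols_def matrix_vector_mult_def sum_3 mult_ac)

lemma det_cols:
  "det (cols a b c) = a$1 * b$2 * c$3 + b$1 * c$2 * a$3 + c$1 * a$2 * b$3
    - a$1 * c$2 * b$3 - b$1 * a$2 * c$3 - c$1 * b$2 * a$3"
  by (simp add: det_3 cols_def)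

lemma matrix_mult_cols: "N ** cols a b c = cols (N *v a) (N *v b) (N *v c)"
  by (simp add: vec_eq_iff cols_def matrix_matrix_mult_def matrix_vector_mult_def)

lemma det_cols_lattice: "a \<in> lattice \<Longrightarrow> b \<in> lattice \<Longrightarrow> c \<in> lattice \<Longrightarrow> det (cols a b c) \<in> \<int>"
  by (auto simp: det_cols lattice_def)

lemma cols_SL3Z:
  "a \<in> lattice \<Longrightarrow> b \<in> lattice \<Longrightarrow> c \<in> lattice \<Longrightarrow> det (cols a b c) = 1 \<Longrightarrow> cols a b c \<in> SL3Z"
  by (auto simp: SL3Z_def SL3R_def lattice_def cols_def)

lemma columns_cols: "{a, b, c} \<subseteq> columns (cols a b c)"
proof -
  have "column 1 (cols a b c) = a" "column 2 (cols a b c) = b" "column 3 (cols a b c) = c"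
    by (simp_all add: column_def cols_def vec_eq_iff)
  moreover have "column i A \<in> columns A" for i and A :: "real^3^3" by (auto simp: columns_def)
  ultimately show ?thesis by (metis empty_subsetI insert_subset)
qed

lemma cramer_cols:
  fixes p q r x :: "real^3"
  assumes D: "D = det (cols p q r)" "D \<noteq> 0"
  shows "D *\<^sub>R x = det (cols x q r) *\<^sub>R p + det (cols p x r) *\<^sub>R q + det (cols p q x) *\<^sub>R r"
  unfolding D(1) by (simp add: vec_eq_iff forall_3 det_cols algebra_simps)

lemma det_cols_shear: "det (cols u w (k *\<^sub>R v + a *\<^sub>R u + b *\<^sub>R w)) = k * det (cols u w v)"
  by (simp add: det_cols algebra_simps)

lemma independent_triple:
  fixes f :: "(real^3) set"
  assumes "span f = UNIV"
  obtains p q r where "p \<in> f" "q \<in> f" "r \<in> f" "det (cols p q r) \<noteq> 0"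
proof -
  obtain B where B: "B \<subseteq> f" "independent B" "f \<subseteq> span B" "card B = dim f"
    using basis_exists[of f] by blast
  have "span B = UNIV" using B assms by (metis span_minimal subspace_span top.extremum_uniqueI)
  moreover have "card B = 3" using B assms using dim_span[of f] assms by simp
  then obtain p q r where pqr: "B = {p, q, r}" by (auto simp: card_3_iff)
  ultimately have "span (columns (cols p q r)) = UNIV" 
    using span_mono[OF columns_cols[of p q r]] by auto
  then obtain H where H: "cols p q r ** H = mat 1"
    using matrix_right_invertible_span_columns[of "cols p q r"] by (auto simp: span_vec_eq)
  have "det (cols p q r) * det H = 1" using arg_cong[OF H, of det] by (simp only: det_mul det_I)
  then have "det (cols p q r) \<noteq> 0" by auto
  moreover have "p \<in> f" "q \<in> f" "r \<in> f" using B(1) unfolding pqr by auto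
  ultimately show ?thesis by (intro that)
qed

text \<open>A smallest triangle is needed because its edges generate the lattice vectors parallel to
  the face. The minimum exists since the determinants are integers; a transposition corrects the
  sign.\<close>

lemma minimal_triple:
  assumes "span f = UNIV" "f \<subseteq> lattice"
  obtains p q r where "p \<in> f" "q \<in> f" "r \<in> f" "det (cols p q r) > 0"
    "\<And>a b c. a \<in> f \<Longrightarrow> b \<in> f \<Longrightarrow> c \<in> f \<Longrightarrow> det (cols a b c) \<noteq> 0 \<Longrightarrow> det (cols p q r) \<le> \<bar>det (cols a b c)\<bar>"
proof -
  let ?P = "\<lambda>(a, b, c). a \<in> f \<and> b \<in> f \<and> c \<in> f \<and> det (cols a b c) \<noteq> 0"
  let ?m = "\<lambda>(a, b, c). nat \<lfloor>\<bar>det (cols a b c)\<bar>\<rfloor>"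
  obtain a b c where "a \<in> f" "b \<in> f" "c \<in> f" "det (cols a b c) \<noteq> 0"
    by (rule independent_triple[OF assms(1)])
  then have abc: "?P (a, b, c)" by simp
  obtain t where tt: "?P t \<and> (\<forall>s. ?P s \<longrightarrow> ?m t \<le> ?m s)"
    using ex_has_least_nat[of ?P "(a, b, c)", OF abc, of ?m] by (elim exE)
  note t = conjunct1[OF tt] spec[OF conjunct2[OF tt], THEN mp]
  obtain p q r where pqr: "t = (p, q, r)" by (cases t)
  have le: "\<bar>det (cols p q r)\<bar> \<le> \<bar>det (cols a b c)\<bar>" if "a \<in> f" "b \<in> f" "c \<in> f" "det (cols a b c) \<noteq> 0" for a b c
  proof -
    have "?m (p,q,r) \<le> ?m (a,b,c)" using t(2)[of "(a,b,c)"] that unfolding pqr by blast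
    moreover have "\<bar>det (cols p q r)\<bar> \<in> \<int>" "\<bar>det (cols a b c)\<bar> \<in> \<int>"
      using assms(2) that t(1) unfolding pqr by (auto intro!: Ints_abs det_cols_lattice)
    ultimately show ?thesis by (auto elim!: Ints_cases)
  qed
  show ?thesis
  proof (cases "det (cols p q r) > 0")
    case True
    then show ?thesis using that[of p q r] t(1) le unfolding pqr by auto
  next
    case False
    have "det (cols p r q) = - det (cols p q r)" by (simp add: det_cols)
    then show ?thesis using False that[of p r q] t(1) le unfolding pqr by auto
  qed
qed

text \<open>The edges of a smallest triangle generate the lattice vectors with m \<bullet> x = 0. A
  lattice vector \<open>v\<close> with the least positive value of \<open>m\<close> completes them
  to a basis. The minimal determinant is the integer distance: the values of \<open>m\<close> on the
  lattice are the multiples of 1/d.\<close>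

lemma lattice_basis_of_face:
  assumes f: "f = {x \<in> cone_of N \<inter> lattice. m \<bullet> x = 1}" and sp: "span f = UNIV"
  obtains p q r v d where "p \<in> f" "q \<in> f" "r \<in> f" "v \<in> lattice" "(d::nat) \<ge> 1"
    "det (cols p q r) = real d" "m \<bullet> v = 1 / real d" "det (cols (q - p) (r - p) v) = 1"
proof -
  have fl: "f \<subseteq> lattice" using f by auto
  obtain p q r where pqr: "p \<in> f" "q \<in> f" "r \<in> f" and pos: "det (cols p q r) > 0"
    and min: "\<And>a b c. a \<in> f \<Longrightarrow> b \<in> f \<Longrightarrow> c \<in> f \<Longrightarrow> det (cols a b c) \<noteq> 0 \<Longrightarrow> det (cols p q r) \<le> \<bar>det (cols a b c)\<bar>"
    using minimal_triple[OF sp fl] by metis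
  define D where "D = det (cols p q r)"
  have m1: "m \<bullet> p = 1" "m \<bullet> q = 1" "m \<bullet> r = 1" and L: "p \<in> lattice" "q \<in> lattice" "r \<in> lattice"
    and PC: "p \<in> cone_of N" "q \<in> cone_of N" "r \<in> cone_of N"
    using pqr f by auto
  have DZ: "D \<in> \<int>" unfolding D_def by (intro det_cols_lattice L)
  have D: "D > 0" using pos by (simp add: D_def)
  have tri: "p + a *\<^sub>R (q - p) + b *\<^sub>R (r - p) \<in> cone_of N" if "0 \<le> a" "0 \<le> b" "a + b \<le> 1" for a b
  proof -
    have "(1 - a - b) *\<^sub>R p + a *\<^sub>R q + b *\<^sub>R r \<in> cone_of N"
      using that PC by (simp add: cone_of_row inner_add_right)
    then show ?thesis by (simp add: algebra_simps)
  qed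
  have mdet: "det (cols (p + a *\<^sub>R (q - p) + b *\<^sub>R (r - p)) q r) = (1 - a - b) * D"
    "det (cols p (p + a *\<^sub>R (q - p) + b *\<^sub>R (r - p)) r) = a * D"
    "det (cols p q (p + a *\<^sub>R (q - p) + b *\<^sub>R (r - p))) = b * D" for a b
    by (simp_all add: D_def det_cols algebra_simps)
  \<comment> \<open>Otherwise this point belongs to the face, and putting it in place of
    \<open>q\<close> or \<open>r\<close> gives a nonzero determinant below \<open>D\<close>.\<close>
  have small: "a = 0 \<and> b = 0" if ab: "0 \<le> a" "a < 1" "0 \<le> b" "b < 1" "a + b \<le> 1"
    and l: "p + a *\<^sub>R (q - p) + b *\<^sub>R (r - p) \<in> lattice" for a b
  proof -
    let ?z = "p + a *\<^sub>R (q - p) + b *\<^sub>R (r - p)"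
    have "m \<bullet> ?z = 1" by (simp add: inner_add_right inner_diff_right m1)
    then have z: "?z \<in> f" using l tri[of a b] ab by (simp add: f)
    have "a * D \<noteq> 0 \<Longrightarrow> D \<le> \<bar>a * D\<bar>" using min[of p ?z r] z pqr mdet(2)[of a b] by (simp add: D_def[symmetric])
    moreover have "b * D \<noteq> 0 \<Longrightarrow> D \<le> \<bar>b * D\<bar>" using min[of p q ?z] z pqr mdet(3)[of a b] by (simp add: D_def[symmetric])
    ultimately show ?thesis using ab D by (auto simp: abs_mult)
  qed
  have ker: "\<exists>a\<in>\<int>. \<exists>b\<in>\<int>. x = a *\<^sub>R (q - p) + b *\<^sub>R (r - p)" if x: "x \<in> lattice" "m \<bullet> x = 0" for x
  proof -
    define \<alpha> where "\<alpha> = det (cols x q r) / D"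
    define \<beta> where "\<beta> = det (cols p x r) / D"
    define \<gamma> where "\<gamma> = det (cols p q x) / D"
    have "D *\<^sub>R x = D *\<^sub>R (\<alpha> *\<^sub>R p + \<beta> *\<^sub>R q + \<gamma> *\<^sub>R r)"
      using cramer_cols[OF D_def, of x] D by (simp add: \<alpha>_def \<beta>_def \<gamma>_def scaleR_add_right)
    then have x1: "x = \<alpha> *\<^sub>R p + \<beta> *\<^sub>R q + \<gamma> *\<^sub>R r" using D by simp
    then have "\<alpha> = - \<beta> - \<gamma>" using x(2) by (simp add: inner_add_right m1)
    then have x2: "x = \<beta> *\<^sub>R (q - p) + \<gamma> *\<^sub>R (r - p)" using x1 by (simp add: scaleR_diff_left scaleR_diff_right)
    define a where "a = frac \<beta>"
    define b where "b = frac \<gamma>"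
    have ab: "0 \<le> a" "a < 1" "0 \<le> b" "b < 1" by (simp_all add: a_def b_def frac_lt_1)
    have y: "a *\<^sub>R (q - p) + b *\<^sub>R (r - p) = x - of_int \<lfloor>\<beta>\<rfloor> *\<^sub>R (q - p) - of_int \<lfloor>\<gamma>\<rfloor> *\<^sub>R (r - p)"
      unfolding x2 by (simp add: a_def b_def frac_def algebra_simps)
    have yl: "a *\<^sub>R (q - p) + b *\<^sub>R (r - p) \<in> lattice"
      unfolding y by (intro lattice_diff lattice_scale x L) auto
    have "a = 0 \<and> b = 0"
    proof (cases "a + b \<le> 1")
      case True
      have "p + a *\<^sub>R (q - p) + b *\<^sub>R (r - p) \<in> lattice"
        using lattice_add[OF L(1) yl] by (simp add: add.assoc)
      then show ?thesis using small ab True by blast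
    next
      case False
      \<comment> \<open>Here the point lies in the other half of the parallelogram; the reflection x
        -> q + r - x brings it into the triangle.\<close>
      have eq: "p + (1 - a) *\<^sub>R (q - p) + (1 - b) *\<^sub>R (r - p) = (q + r - p) - (a *\<^sub>R (q - p) + b *\<^sub>R (r - p))"
        by (simp add: scaleR_diff_left)
      have "p + (1 - a) *\<^sub>R (q - p) + (1 - b) *\<^sub>R (r - p) \<in> lattice"
        unfolding eq by (intro lattice_diff lattice_add L yl)
      then have "1 - a = 0 \<and> 1 - b = 0"
        using ab False by (intro small) auto
      then show ?thesis using ab by simp
    qed
    then have "\<beta> \<in> \<int>" "\<gamma> \<in> \<int>" by (simp_all add: a_def b_def frac_eq_0_iff)
    then show ?thesis using x2 by blast
  qed
  have mZ: "D * (m \<bullet> x) \<in> \<int>" if "x \<in> lattice" for x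
  proof -
    have "D * (m \<bullet> x) = m \<bullet> (D *\<^sub>R x)" by simp
    also have "\<dots> = det (cols x q r) + det (cols p x r) + det (cols p q x)"
      using cramer_cols[OF D_def, of x] D by (simp add: inner_add_right m1)
    finally show ?thesis using that L by (auto intro!: Ints_add det_cols_lattice)
  qed
  let ?P = "\<lambda>x. x \<in> lattice \<and> D * (m \<bullet> x) > 0"
  let ?M = "\<lambda>x. nat \<lfloor>D * (m \<bullet> x)\<rfloor>"
  have "?P p" using L D m1 by simp
  then obtain v where v: "?P v" "\<And>x. ?P x \<Longrightarrow> ?M v \<le> ?M x"
    using ex_has_least_nat[of ?P _ ?M] by blast
  define g where "g = D * (m \<bullet> v)"
  have g: "g > 0" "g \<in> \<int>" using v(1) mZ by (auto simp: g_def)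
  have gmin: "g \<le> D * (m \<bullet> x)" if "x \<in> lattice" "D * (m \<bullet> x) > 0" for x
  proof -
    have "?M v \<le> ?M x" using v(2) that by blast
    then show ?thesis using mZ[OF that(1)] g that(2) unfolding g_def[symmetric] by (auto elim!: Ints_cases)
  qed
  have dec: "\<exists>k\<in>\<int>. D * (m \<bullet> x) = k * g" if x: "x \<in> lattice" for x
  proof -
    define k where "k = \<lfloor>D * (m \<bullet> x) / g\<rfloor>"
    let ?y = "x - of_int k *\<^sub>R v"
    have yl: "?y \<in> lattice" using x v(1) by (intro lattice_diff lattice_scale) auto
    have e: "D * (m \<bullet> ?y) = D * (m \<bullet> x) - of_int k * g" by (simp add: g_def inner_diff_right algebra_simps)
    have "of_int k * g \<le> D * (m \<bullet> x)" "D * (m \<bullet> x) < (of_int k + 1) * g"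
      using g(1) floor_divide_lower[OF g(1), of "D * (m \<bullet> x)"] floor_divide_upper[OF g(1), of "D * (m \<bullet> x)"]
      by (simp_all add: k_def)
    then have "0 \<le> D * (m \<bullet> ?y)" "D * (m \<bullet> ?y) < g"
      unfolding e by (simp_all add: distrib_right)
    then have "D * (m \<bullet> ?y) = 0" using gmin[OF yl] by linarith
    then show ?thesis using e by (intro bexI[of _ "of_int k"]) auto
  qed
  define M where "M = cols (q - p) (r - p) v"
  have gen: "\<exists>z\<in>lattice. x = M *v z" if x: "x \<in> lattice" for x
  proof -
    obtain k where k: "k \<in> \<int>" "D * (m \<bullet> x) = k * g" using dec[OF x] by blast
    let ?y = "x - k *\<^sub>R v"
    have "D * (m \<bullet> ?y) = 0" using k(2) by (simp add: g_def inner_diff_right algebra_simps)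
    then have "m \<bullet> ?y = 0" using D by simp
    moreover have "?y \<in> lattice" using x v(1) k(1) by (intro lattice_diff lattice_scale) auto
    ultimately obtain a b where ab: "a \<in> \<int>" "b \<in> \<int>" "?y = a *\<^sub>R (q - p) + b *\<^sub>R (r - p)" using ker by blast
    then have "x = M *v vector [a, b, k]" by (simp add: M_def cols_mult_vec algebra_simps)
    moreover have "vector [a, b, k] \<in> lattice" using ab k by (simp add: lattice_def forall_3)
    ultimately show ?thesis by blast
  qed
  obtain Z where Z: "\<And>j. Z j \<in> lattice" "\<And>j. axis j 1 = M *v Z j"
  proof -
    have "axis j 1 \<in> lattice" for j :: 3 by (simp add: lattice_def axis_def)
    then have "\<forall>j. \<exists>z\<in>lattice. axis j 1 = M *v z" using gen by blast
    then show ?thesis using that by metis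
  qed
  have Zc: "mat 1 = M ** cols (Z 1) (Z 2) (Z 3)"
    unfolding matrix_mult_cols Z(2)[symmetric]
    by (simp add: vec_eq_iff forall_3 cols_def mat_def axis_def)
  have "det M \<in> \<int>" unfolding M_def using L v(1) by (intro det_cols_lattice lattice_diff) auto
  then obtain i where i: "det M = of_int i" by (rule Ints_cases)
  have "det (cols (Z 1) (Z 2) (Z 3)) \<in> \<int>" by (intro det_cols_lattice Z)
  then obtain j where j: "det (cols (Z 1) (Z 2) (Z 3)) = of_int j" by (rule Ints_cases)
  have "det M * det (cols (Z 1) (Z 2) (Z 3)) = 1" using arg_cong[OF Zc, of det] by (simp only: det_mul det_I)
  then have "of_int (i * j) = (of_int 1 :: real)" unfolding i j by simp
  then have "i * j = 1" by (simp only: of_int_eq_iff)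
  then have "\<bar>i\<bar> = 1" using abs_zmult_eq_1[of i j] by simp
  then have unit: "\<bar>det M\<bar> = 1" unfolding i by (metis of_int_abs of_int_1)
  obtain k where k: "k \<in> \<int>" "D = k * g" using dec[OF L(1)] m1 by auto
  have k0: "k > 0" using k(2) D g by (simp add: zero_less_mult_iff)
  obtain a b where ab: "p - k *\<^sub>R v = a *\<^sub>R (q - p) + b *\<^sub>R (r - p)"
  proof -
    have "D * (m \<bullet> (p - k *\<^sub>R v)) = 0" using k(2) by (simp add: g_def inner_diff_right algebra_simps m1)
    then have "m \<bullet> (p - k *\<^sub>R v) = 0" using D by simp
    moreover have "p - k *\<^sub>R v \<in> lattice" using L v(1) k(1) by (intro lattice_diff lattice_scale) auto
    ultimately show ?thesis using ker that by blast
  qed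
  \<comment> \<open>Expanding \<open>p\<close> in \<open>v\<close> and the edges gives D = k * det M
    with k > 0, which decides between the two signs of det M.\<close>
  have "D = det (cols (q - p) (r - p) p)" by (simp add: D_def det_cols algebra_simps)
  also have "\<dots> = det (cols (q - p) (r - p) (k *\<^sub>R v + a *\<^sub>R (q - p) + b *\<^sub>R (r - p)))"
  proof -
    have "k *\<^sub>R v + a *\<^sub>R (q - p) + b *\<^sub>R (r - p) = p"
      unfolding add.assoc ab[symmetric] by simp
    then show ?thesis by (simp only:)
  qed
  also have "\<dots> = k * det M" by (simp only: M_def det_cols_shear)
  finally have Dk: "D = k * det M" .
  then have M1: "det M = 1" using unit D k0 by (auto simp: abs_if zero_less_mult_iff split: if_splits)
  then have "D = k" using Dk by simp
  then have "g = 1" using k(2) k0 by simp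
  then have mv: "m \<bullet> v = 1 / D" using D by (simp add: g_def field_simps)
  obtain d :: nat where d: "D = real d" using DZ D by (metis Ints_cases less_imp_le of_int_0_le_iff of_int_of_nat_eq zero_le_imp_eq_int)
  show ?thesis
    using that[of p q r v d] pqr v(1) d D D_def mv M1 by (simp add: M_def)
qed

lemma inverse_third_coordinate:
  assumes M: "cols a b c ** \<gamma> = mat 1" and w: "w \<bullet> a = 0" "w \<bullet> b = 0" "w \<bullet> c = 1"
  shows "(\<gamma> *v x) $ 3 = w \<bullet> x"
proof -
  have "x = cols a b c *v (\<gamma> *v x)" by (simp add: matrix_vector_mul_assoc M)
  then have "w \<bullet> x = w \<bullet> (cols a b c *v (\<gamma> *v x))" by simp
  also have "\<dots> = (\<gamma> *v x) $ 3" by (simp add: cols_mult_vec inner_add_right w)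
  finally show ?thesis by simp
qed

lemma sail_face_representative:
  assumes "f \<in> sail_faces"
  shows "\<exists>\<gamma>\<in>SL3Z. \<exists>d::nat. act \<gamma> f \<subseteq> {x. x $ 3 = real d}"
proof -
  obtain C where C: "generic_cone C" "face_of_sail f C" using assms by (auto simp: sail_faces_def)
  then obtain N where N: "C = cone_of N" using cones_cone_of by (metis generic_cone_def)
  obtain m where m: "f = {x \<in> C \<inter> lattice. m \<bullet> x = 1}" "span f = UNIV" using face_data[OF C] by metis
  obtain p q r v d where b: "p \<in> f" "q \<in> f" "r \<in> f" "v \<in> lattice" "(d::nat) \<ge> 1"
    "det (cols p q r) = real d" "m \<bullet> v = 1 / real d" "det (cols (q - p) (r - p) v) = 1"
    by (rule lattice_basis_of_face[OF m(1)[unfolded N] m(2)])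
  have "cols (q - p) (r - p) v \<in> SL3Z"
    using b m by (intro cols_SL3Z lattice_diff) auto
  then obtain \<gamma> where \<gamma>: "\<gamma> \<in> SL3Z" "cols (q - p) (r - p) v ** \<gamma> = mat 1" using SL3Z_inverse by metis
  have "(\<gamma> *v x) $ 3 = (real d *\<^sub>R m) \<bullet> x" for x
    using b m by (intro inverse_third_coordinate[OF \<gamma>(2)]) (auto simp: inner_diff_right)
  then have "act \<gamma> f \<subseteq> {x. x $ 3 = real d}" using m by (auto simp: act_def)
  then show ?thesis using \<gamma>(1) by blast
qed

section \<open>White's theorem as a statement on residues\<close>

text \<open>With e = d - a the hypotheses become floor(m e / d) = floor(m b / d) + floor(m c / d)
  for 0 < m < d (\<open>Fe\<close>): the staircase of e is the sum of those of b and c. Let x be the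
  first jump of the c-staircase. It turns out that the b-staircase rises by x + 1 too, so the
  e-staircase climbs from at most t at x - 1 to at least t + 2 at x + 1. This needs 2 e > d, against
  \<open>e2\<close>.\<close>

lemma white_ordered:
  fixes a b c d :: nat
  assumes order: "c \<le> b" "b \<le> a" "2 \<le> c" "a < d" and sum: "a + b + c = d + 1"
    and res: "\<And>m. 0 < m \<Longrightarrow> m < d \<Longrightarrow> m * a mod d + m * b mod d + m * c mod d = m + d"
    and nz: "\<And>m. 0 < m \<Longrightarrow> m < d \<Longrightarrow> m * a mod d \<noteq> 0"
  shows False
proof -
  have d5: "d \<ge> 5" using order sum by linarith
  have F0: "m * a div d + m * b div d + m * c div d = m - 1" if m: "0 < m" "m < d" for m
  proof -
    have "d * (m * a div d) + m * a mod d + (d * (m * b div d) + m * b mod d) + (d * (m * c div d) + m * c mod d) = m * a + m * b + m * c"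
      by simp
    also have "\<dots> = m * d + m" using sum by (metis distrib_left mult.right_neutral)
    finally have "d * (m * a div d) + d * (m * b div d) + d * (m * c div d) + d = m * d"
      using res[OF m] by linarith
    then have "d * (m * a div d + m * b div d + m * c div d + 1) = d * m" by (simp add: distrib_left mult.commute)
    then have "m * a div d + m * b div d + m * c div d + 1 = m" using d5 by (metis mult_cancel1 not_numeral_le_zero)
    then show ?thesis by simp
  qed
  define e where "e = d - a"
  have e: "e = b + c - 1" "e + a = d" "e \<ge> 3" using order sum by (auto simp: e_def)
  have Fe: "m * e div d = m * b div d + m * c div d" if m: "0 < m" "m < d" for m
  proof -
    let ?r = "m * a mod d"
    have r: "0 < ?r" "?r < d" using nz[OF m] d5 by auto
    have "m * e + m * a = m * d" using e(2) by (metis distrib_left)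
    moreover have "m * a = d * (m * a div d) + ?r" by simp
    ultimately have eq: "m * e + d * (m * a div d) + ?r = m * d" by linarith
    have k: "m * a div d \<le> m - 1" using F0[OF m] by linarith
    have "m * e + ?r = m * d - d * (m * a div d)" using eq by linarith
    also have "\<dots> = d * (m - m * a div d)" by (simp add: diff_mult_distrib2 mult.commute)
    also have "\<dots> = d * (m - 1 - m * a div d) + d"
    proof -
      have "m - m * a div d = Suc (m - 1 - m * a div d)" using k m(1) by linarith
      then show ?thesis by simp
    qed
    finally have "m * e = d * (m - 1 - m * a div d) + (d - ?r)" using r by linarith
    moreover have "(d * k + s) div d = k" if "s < d" for k s using that by simp
    ultimately have "m * e div d = m - 1 - m * a div d" using r by (metis diff_less le_less_trans zero_le)
    then show ?thesis using F0[OF m] by linarith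
  qed
  \<comment> \<open>At m = 2 the three quotients have sum 1, but all would be 0 if 2 a < d.\<close>
  have e2: "2 * e \<le> d"
  proof -
    have "\<not> 2 * a < d"
    proof
      assume "2 * a < d"
      then have "2 * a div d = 0" "2 * b div d = 0" "2 * c div d = 0" using order by auto
      then show False using F0[of 2] d5 by simp
    qed
    then show ?thesis using e(2) by linarith
  qed
  define g where "g = d div e"
  have eg: "e * g \<le> d" "e * (g + 1) > d"
  proof -
    have "d = e * g + d mod e" by (simp add: g_def)
    moreover have "d mod e < e" using e(3) by simp
    ultimately show "e * g \<le> d" "e * (g + 1) > d" by (linarith, simp add: algebra_simps)
  qed
  have gd: "g + 1 < d"
  proof -
    have "3 * g \<le> e * g" using e(3) by simp
    then show ?thesis using eg(1) d5 by linarith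
  qed
  \<comment> \<open>At g + 1 the e-staircase has left 0, so that of b or c has, and b is the larger
    of the two.\<close>
  have bg: "b * (g + 1) \<ge> d"
  proof (rule ccontr)
    assume "\<not> ?thesis"
    then have *: "(g + 1) * b < d" by (simp add: mult.commute)
    moreover have "(g + 1) * c \<le> (g + 1) * b" using order(1) by (rule mult_le_mono2)
    ultimately have "(g + 1) * c < d" by linarith
    then have "(g + 1) * e div d = 0" using Fe[of "g + 1"] gd * by simp
    moreover have "(g + 1) * e div d \<ge> 1" using eg(2) d5 by (simp add: less_eq_div_iff_mult_less_eq mult.commute)
    ultimately show False by simp
  qed
  define x where "x = (LEAST m. d \<le> m * c)"
  have ex: "d \<le> d * c" using order by simp
  have x: "d \<le> x * c" unfolding x_def using ex by (rule LeastI)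
  have xmin: "m * c < d" if "m < x" for m using not_less_Least[of m "\<lambda>m. d \<le> m * c"] that unfolding x_def by simp
  have xd: "x + 1 < d"
  proof -
    have "d \<le> (d - 2) * c"
    proof -
      have "d \<le> (d - 2) * 2" using d5 by linarith
      also have "\<dots> \<le> (d - 2) * c" using order(3) by (rule mult_le_mono2)
      finally show ?thesis .
    qed
    then have "x \<le> d - 2" unfolding x_def by (rule Least_le)
    then show ?thesis using d5 by linarith
  qed
  have x2: "x \<ge> 2"
  proof (rule ccontr)
    assume "\<not> x \<ge> 2"
    then have "x * c \<le> 1 * c" by (intro mult_le_mono1) simp
    then show False using x order by linarith
  qed
  define t where "t = x * b div d"
  have ge: "k \<le> m div d \<longleftrightarrow> k * d \<le> m" for k m using d5 by (simp add: less_eq_div_iff_mult_less_eq)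
  have t1: "t \<ge> 1"
  proof -
    have "x * c \<le> x * b" using order(1) by (rule mult_le_mono2)
    then have "d \<le> x * b" using x by linarith
    then show ?thesis unfolding t_def ge by simp
  qed
  have Fex: "(t + 1) * d \<le> x * e"
  proof -
    have "x * c div d \<ge> 1" using x unfolding ge by simp
    then have "t + 1 \<le> x * e div d" using Fe[of x] xd x2 by (simp add: t_def)
    then show ?thesis unfolding ge .
  qed
  \<comment> \<open>The place where the b-staircase reaches the value \<open>t\<close> that it has
    at x. The e-staircase is still below \<open>t\<close> at y - 1 and at least t + 1 at x, so x - y
    is at least g, enough room for b to rise once more by x + 1.\<close>
  define y where "y = (LEAST m. t * d \<le> m * b)"
  have tx: "t * d \<le> x * b" unfolding t_def by (metis ge order_refl)
  have y: "t * d \<le> y * b" unfolding y_def using tx by (rule LeastI)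
  have yx: "y \<le> x" unfolding y_def using tx by (rule Least_le)
  have y0: "y > 0" using y t1 d5 by (cases y) auto
  have yb: "(y - 1) * b < t * d" using not_less_Least[of "y - 1" "\<lambda>m. t * d \<le> m * b"] y0 unfolding y_def by simp
  have ye: "(y - 1) * e < t * d"
  proof (cases "y = 1")
    case True
    then show ?thesis using t1 d5 by simp
  next
    case False
    have "(y - 1) * c < d" using xmin yx y0 by simp
    then have "(y - 1) * e div d = (y - 1) * b div d" using Fe[of "y - 1"] False y0 yx xd by simp
    then show ?thesis using yb ge[of t "(y - 1) * b"] ge[of t "(y - 1) * e"] by linarith
  qed
  have "y + g \<le> x"
  proof (rule ccontr)
    assume "\<not> ?thesis"
    then have "x \<le> y - 1 + g" by linarith
    then have "x * e \<le> (y - 1 + g) * e" by (rule mult_le_mono1)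
    also have "\<dots> = (y - 1) * e + e * g" by (metis add_mult_distrib mult.commute)
    also have "\<dots> < (t + 1) * d" using ye eg(1) by simp
    finally show False using Fex by simp
  qed
  then have "(y + g + 1) * b \<le> (x + 1) * b" by (intro mult_le_mono1) simp
  moreover have "(y + g + 1) * b = y * b + b * (g + 1)" by (metis add.assoc add_mult_distrib mult.commute)
  moreover have "(t + 1) * d = t * d + d" by simp
  ultimately have "(t + 1) * d \<le> (x + 1) * b" using y bg by linarith
  then have "t + 1 \<le> (x + 1) * b div d" unfolding ge .
  moreover have "1 \<le> (x + 1) * c div d" unfolding ge using x by simp
  ultimately have "t + 2 \<le> (x + 1) * e div d" using Fe[of "x + 1"] xd by simp
  then have A: "(t + 2) * d \<le> (x + 1) * e" unfolding ge .
  have B: "(x - 1) * e < (t + 1) * d"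
  proof -
    have "(x - 1) * c < d" using xmin x2 by simp
    then have "(x - 1) * e div d = (x - 1) * b div d" using Fe[of "x - 1"] x2 xd by simp
    also have "\<dots> \<le> t" unfolding t_def by (intro div_le_mono mult_le_mono1) simp
    finally show ?thesis using ge[of "t + 1" "(x - 1) * e"] by linarith
  qed
  have "(x + 1) * e = (x - 1) * e + 2 * e" using x2 by (simp add: distrib_right[symmetric])
  then show False using A B e2 by simp
qed

text \<open>The hypotheses are symmetric in a, b, c; equality of multisets transfers them to the
  ordering that \<open>white_ordered\<close> expects.\<close>

lemma white_residues:
  fixes a b c d :: nat
  assumes "0 < a" "a < d" "0 < b" "b < d" "0 < c" "c < d" and sum: "a + b + c = d + 1"
    and res: "\<And>m. 0 < m \<Longrightarrow> m < d \<Longrightarrow> m * a mod d + m * b mod d + m * c mod d = m + d"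
    and nz: "\<And>m. 0 < m \<Longrightarrow> m < d \<Longrightarrow> m * a mod d \<noteq> 0 \<and> m * b mod d \<noteq> 0 \<and> m * c mod d \<noteq> 0"
  shows "a = 1 \<or> b = 1 \<or> c = 1"
proof (rule ccontr)
  assume "\<not> ?thesis"
  then have ge2: "2 \<le> a" "2 \<le> b" "2 \<le> c" using assms by auto
  have perm: False if p: "z \<le> y" "y \<le> x" and m: "{#x, y, z#} = {#a, b, c#}" for x y z
  proof -
    have s: "f x + f y + f z = f a + f b + f c" for f :: "nat \<Rightarrow> nat"
      using arg_cong[OF m, of "\<lambda>M. sum_mset (image_mset f M)"] by simp
    have st: "set_mset {#x, y, z#} = set_mset {#a, b, c#}" using m by simp
    show False
    proof (rule white_ordered[OF p, of d])
      have "z \<in> {a, b, c}" "x \<in> {a, b, c}" using st by auto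
      then show "2 \<le> z" "x < d" using ge2 assms by auto
      show "x + y + z = d + 1" using s[of "\<lambda>x. x"] sum by simp
      show "m * x mod d + m * y mod d + m * z mod d = m + d" if "0 < m" "m < d" for m
        using s[of "\<lambda>x. m * x mod d"] res[OF that] by simp
      show "m * x mod d \<noteq> 0" if "0 < m" "m < d" for m using nz[OF that] st by auto
    qed
  qed
  consider "c \<le> b" "b \<le> a" | "b \<le> c" "c \<le> a" | "c \<le> a" "a \<le> b" | "a \<le> c" "c \<le> b" | "a \<le> b" "b \<le> c" | "b \<le> a" "a \<le> c"
    by linarith
  then show False
  proof cases
    case 1
    then show ?thesis using perm[of c b a] by simp
  next
    case 2
    then show ?thesis using perm[of b c a] by (simp add: add_mset_commute)
  next
    case 3
    then show ?thesis using perm[of c a b] by (simp add: add_mset_commute)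
  next
    case 4
    then show ?thesis using perm[of a c b] by (simp add: add_mset_commute)
  next
    case 5
    then show ?thesis using perm[of a b c] by (simp add: add_mset_commute)
  next
    case 6
    then show ?thesis using perm[of b a c] by (simp add: add_mset_commute)
  qed
qed

section \<open>Positivity of the supporting form and finiteness of the face\<close>

lemma finite_lattice_bounded:
  assumes "bounded S" shows "finite (S \<inter> lattice)"
proof -
  obtain M where M: "\<And>x. x \<in> S \<Longrightarrow> norm x \<le> M" using assms by (auto simp: bounded_iff)
  let ?A = "of_int ` {- \<lceil>M\<rceil>..\<lceil>M\<rceil>} :: real set"
  have "S \<inter> lattice \<subseteq> (\<lambda>g. \<chi> i. g i) ` PiE (UNIV :: 3 set) (\<lambda>_. ?A)"
  proof
    fix x assume x: "x \<in> S \<inter> lattice"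
    have "x $ i \<in> ?A" for i
    proof -
      obtain k where k: "x $ i = of_int k" using x by (auto simp: lattice_def elim: Ints_cases)
      have "\<bar>x $ i\<bar> \<le> M" using component_le_norm_cart[of x i] M[of x] x by auto
      then have "\<bar>of_int k :: real\<bar> \<le> of_int \<lceil>M\<rceil>" unfolding k by linarith
      then have "\<bar>k\<bar> \<le> \<lceil>M\<rceil>" by linarith
      then have "k \<in> {- \<lceil>M\<rceil>..\<lceil>M\<rceil>}" by (auto simp: abs_le_iff)
      then show ?thesis unfolding k by (rule imageI)
    qed
    then show "x \<in> (\<lambda>g. \<chi> i. g i) ` PiE (UNIV :: 3 set) (\<lambda>_. ?A)"
      by (intro image_eqI[of _ _ "\<lambda>i. x $ i"]) (auto simp: vec_eq_iff)
  qed
  moreover have "finite (PiE (UNIV :: 3 set) (\<lambda>_. ?A))" by (intro finite_PiE) auto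
  ultimately show ?thesis by (meson finite_imageI finite_subset)
qed

lemma bounded_preimage_matrix:
  fixes H N :: "real^3^3"
  assumes "H ** N = mat 1" "\<And>x i. x \<in> S \<Longrightarrow> \<bar>N $ i \<bullet> x\<bar> \<le> (M::real)"
  shows "bounded (S :: (real^3) set)"
proof -
  have "norm x \<le> (\<Sum>j\<in>UNIV. M * norm (H *v axis j 1))" if "x \<in> S" for x
  proof -
    have "norm x = norm (\<Sum>j\<in>UNIV. (N $ j \<bullet> x) *\<^sub>R (H *v axis j 1))"
      using matrix_inverse_expansion[OF assms(1), of x] by simp
    also have "\<dots> \<le> (\<Sum>j\<in>UNIV. M * norm (H *v axis j 1))"
      using assms(2)[OF that] by (intro sum_norm_le) (auto intro: mult_right_mono)
    finally show ?thesis .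
  qed
  then show ?thesis by (auto simp: bounded_iff)
qed

text \<open>The weight \<open>c i\<close> is the value of \<open>m\<close> on the i-th generating
  ray, nonnegative because lattice points follow the ray. If it were 0, the ray would lie in the
  plane x_3 = 0. Genericity keeps it off the second axis, so the cone would satisfy
  \<open>ray_in_plane\<close>.\<close>

lemma face_weights:
  assumes gen: "generic_cone C" and C: "C = cone_of N" "det N > 0"
    and f: "f = {x \<in> C \<inter> lattice. m \<bullet> x = 1}" and m: "\<And>x. x \<in> C \<inter> lattice \<Longrightarrow> x \<noteq> 0 \<Longrightarrow> 1 \<le> m \<bullet> x"
    and sp: "span f = UNIV" and fd: "f \<subseteq> {x. x $ 3 = real d}" and good: "\<not> ray_in_plane C"
  obtains c where "\<And>i. c i > 0" "\<And>x. m \<bullet> x = (\<Sum>i\<in>UNIV. c i * (N $ i \<bullet> x))"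
proof -
  obtain H where H: "N ** H = mat 1" "H ** N = mat 1" using det_pos_inverse[OF C(2)] .
  define c where "c = (\<lambda>i. m \<bullet> (H *v axis i 1))"
  have "f \<noteq> {}"
  proof
    assume "f = {}"
    then have "(UNIV :: (real^3) set) = {0}" using sp by simp
    then have "axis 1 1 = (0 :: real^3)" by blast
    then show False by simp
  qed
  then obtain p where p: "p \<in> f" by blast
  have pl: "p \<in> lattice" "p \<noteq> 0" using p f by auto
  have pp: "N $ i \<bullet> p > 0" for i
    using generic_row_nonzero[OF gen[unfolded C(1)] C(2) pl, of i] p f C(1) by (auto simp: cone_of_row less_le)
  have mn: "0 \<le> m \<bullet> y" if "y \<in> cone_of N \<inter> lattice" for y
    using m[of y] that C(1) by (cases "y = 0") auto
  have c0: "c i \<ge> 0" for i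
    unfolding c_def by (rule cone_nonneg_of_lattice[OF pl(1) pp _ mn])
      (auto simp: cone_of_row row_inverse_axis[OF H(1)])
  have md: "real d * (m \<bullet> x) = x $ 3" for x
  proof -
    have "linear (\<lambda>x. real d * (m \<bullet> x))" "linear (\<lambda>x :: real^3. x $ 3)"
      by (auto intro!: linearI simp: inner_add_right algebra_simps)
    moreover have "real d * (m \<bullet> y) = y $ 3" if "y \<in> f" for y using that f fd by auto
    ultimately show ?thesis using linear_eq_on_span[of "\<lambda>x. real d * (m \<bullet> x)" "\<lambda>x. x $ 3" f x] sp by simp
  qed
  have "c i \<noteq> 0" for i
  proof
    assume ci: "c i = 0"
    define x where "x = H *v axis i 1"
    have Nx: "N *v x = axis i 1" by (simp add: x_def matrix_vector_mul_assoc H)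
    have x3: "x $ 3 = 0" using md[of x] ci by (simp add: c_def x_def)
    have "x $ 1 \<noteq> 0"
    proof
      assume x1: "x $ 1 = 0"
      have xa: "x = x $ 2 *\<^sub>R axis 2 1" using x1 x3 by (simp add: vec_eq_iff forall_3 axis_def)
      have "\<exists>j::3. j \<noteq> i" by (metis zero_neq_one)
      then obtain j where j: "j \<noteq> i" by blast
      have "(N *v x) $ j = 0" using j by (simp add: Nx axis_def)
      then have "x $ 2 * (N $ j \<bullet> axis 2 1) = 0" using xa by (metis inner_scaleR_right matrix_vector_mul_component)
      moreover have "N $ j \<bullet> axis 2 1 \<noteq> 0"
        by (rule generic_row_nonzero[OF gen[unfolded C(1)] C(2)]) (auto simp: lattice_def axis_def vec_eq_iff)
      ultimately have "x = 0" using xa by simp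
      then have "axis i 1 = (0 :: real^3)" using Nx by simp
      then show False by simp
    qed
    then have "ray_in_plane C" unfolding ray_in_plane_def using C Nx x3 by blast
    then show False using good by simp
  qed
  then have cpos: "c i > 0" for i using c0[of i] by (simp add: less_le)
  have "m \<bullet> x = (\<Sum>i\<in>UNIV. c i * (N $ i \<bullet> x))" for x
  proof -
    have "m \<bullet> x = m \<bullet> (\<Sum>j\<in>UNIV. (N $ j \<bullet> x) *\<^sub>R (H *v axis j 1))"
      using matrix_inverse_expansion[OF H(2), of x] by simp
    then show ?thesis by (simp add: inner_sum_right c_def mult.commute)
  qed
  then show ?thesis using that cpos by blast
qed

lemma face_finite:
  assumes C: "C = cone_of N" "det N > 0" and f: "f = {x \<in> C \<inter> lattice. m \<bullet> x = 1}"
    and c: "\<And>i. c i > 0" "\<And>x. m \<bullet> x = (\<Sum>i\<in>UNIV. c i * (N $ i \<bullet> x))"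
  shows "finite f"
proof -
  obtain H where H: "N ** H = mat 1" "H ** N = mat 1" using det_pos_inverse[OF C(2)] .
  have "bounded {x \<in> C. m \<bullet> x = 1}"
  proof (rule bounded_preimage_matrix[OF H(2)])
    fix x i assume x: "x \<in> {x \<in> C. m \<bullet> x = 1}"
    have nn: "0 \<le> c j * (N $ j \<bullet> x)" for j using x C c(1)[of j] by (simp add: cone_of_row)
    have "c i * (N $ i \<bullet> x) \<le> 1"
      using x c(2)[of x] member_le_sum[of i UNIV "\<lambda>j. c j * (N $ j \<bullet> x)"] nn by simp
    then have "N $ i \<bullet> x \<le> 1 / c i" using c(1)[of i] by (simp add: field_simps)
    also have "\<dots> \<le> (\<Sum>j\<in>UNIV. 1 / c j)" using c(1) by (intro member_le_sum) (auto simp: less_imp_le)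
    finally show "\<bar>N $ i \<bullet> x\<bar> \<le> (\<Sum>j\<in>UNIV. 1 / c j)" using x C by (simp add: cone_of_row)
  qed
  then have "finite ({x \<in> C. m \<bullet> x = 1} \<inter> lattice)" by (rule finite_lattice_bounded)
  moreover have "f = {x \<in> C. m \<bullet> x = 1} \<inter> lattice" using f by auto
  ultimately show ?thesis by simp
qed

section \<open>Faces at small integer distance\<close>

text \<open>Both vectors are orthogonal to (1,1,1), so their cross product is parallel to it and the
  determinant is, up to sign, sqrt 3 times the area of their parallelogram.\<close>

lemma gram_det_sum_zero:
  fixes a b :: "real^3"
  assumes "a $ 1 + a $ 2 + a $ 3 = 0" "b $ 1 + b $ 2 + b $ 3 = 0"
  shows "(det (cols a b (\<chi> i. 1)))\<^sup>2 = 3 * ((a \<bullet> a) * (b \<bullet> b) - (a \<bullet> b)\<^sup>2)"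
proof -
  have a: "a $ 3 = - a $ 1 - a $ 2" and b: "b $ 3 = - b $ 1 - b $ 2" using assms by linarith+
  show ?thesis
    by (simp add: det_cols inner_vec_def sum_3 a b) (simp add: power2_eq_square algebra_simps)
qed

text \<open>Gauss reduction by minimality: finitely many admissible bases have bounded length. One
  with the least sum of squares cannot be improved by adding or subtracting one vector from the
  other, and these replacements keep the determinant with \<open>v\<close>.\<close>

lemma reduced_basis:
  fixes B H :: "real^3^3"
  assumes H: "H ** B = mat 1"
    and u: "u1 \<in> lattice" "u2 \<in> lattice" "m \<bullet> u1 = 0" "m \<bullet> u2 = 0" "det (cols u1 u2 v) = 1"
  obtains w1 w2 where "w1 \<in> lattice" "w2 \<in> lattice" "m \<bullet> w1 = 0" "m \<bullet> w2 = 0" "det (cols w1 w2 v) = 1"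
    "(B *v w1) \<bullet> (B *v w1) + (B *v w2) \<bullet> (B *v w2) \<le> (B *v u1) \<bullet> (B *v u1) + (B *v u2) \<bullet> (B *v u2)"
    "2 * \<bar>(B *v w1) \<bullet> (B *v w2)\<bar> \<le> (B *v w1) \<bullet> (B *v w1)"
    "2 * \<bar>(B *v w1) \<bullet> (B *v w2)\<bar> \<le> (B *v w2) \<bullet> (B *v w2)"
proof -
  define n where "n = (\<lambda>x. (B *v x) \<bullet> (B *v x))"
  define Q where "Q = (\<lambda>(x, y). n x + n y)"
  define R where "R = Q (u1, u2)"
  define S where "S = {x. n x \<le> R}"
  define X where "X = {(x, y). x \<in> lattice \<and> y \<in> lattice \<and> m \<bullet> x = 0 \<and> m \<bullet> y = 0 \<and> det (cols x y v) = 1 \<and> Q (x, y) \<le> R}"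
  have n0: "n x \<ge> 0" for x by (simp add: n_def)
  have "bounded S"
  proof (rule bounded_preimage_matrix[OF H])
    fix x i assume "x \<in> S"
    have "(B $ i \<bullet> x)\<^sup>2 \<le> n x"
      using member_le_sum[of i UNIV "\<lambda>i. (B $ i \<bullet> x)\<^sup>2"]
      by (simp add: n_def inner_vec_def[of "B *v x"] matrix_vector_mul_component power2_eq_square)
    then have "(B $ i \<bullet> x)\<^sup>2 \<le> R" using \<open>x \<in> S\<close> by (simp add: S_def)
    moreover have "\<bar>s\<bar> \<le> s\<^sup>2 + 1" for s :: real
    proof -
      have "0 \<le> (\<bar>s\<bar> - 1)\<^sup>2" by simp
      also have "\<dots> = s\<^sup>2 - 2 * \<bar>s\<bar> + 1" by (simp add: power2_diff)
      finally show ?thesis by linarith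
    qed
    ultimately show "\<bar>B $ i \<bullet> x\<bar> \<le> R + 1" by (meson add_right_mono order_trans)
  qed
  then have "finite ((S \<inter> lattice) \<times> (S \<inter> lattice))" using finite_lattice_bounded by blast
  moreover have "X \<subseteq> (S \<inter> lattice) \<times> (S \<inter> lattice)"
  proof
    fix t assume t: "t \<in> X"
    obtain x y where xy: "t = (x, y)" by (cases t)
    then have "x \<in> lattice" "y \<in> lattice" "n x + n y \<le> R" using t by (auto simp: X_def Q_def)
    then show "t \<in> (S \<inter> lattice) \<times> (S \<inter> lattice)" using n0[of x] n0[of y] by (simp add: xy S_def)
  qed
  ultimately have fin: "finite X" by (rule finite_subset[rotated])
  have "(u1, u2) \<in> X" using u by (simp add: X_def R_def)
  then have "Min (Q ` X) \<in> Q ` X" using fin by (intro Min_in) auto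
  then obtain t where t: "t \<in> X" "Q t = Min (Q ` X)" by auto
  obtain w1 w2 where w: "t = (w1, w2)" by (cases t)
  have min: "Q (w1, w2) \<le> Q (x, y)"
    if "x \<in> lattice" "y \<in> lattice" "m \<bullet> x = 0" "m \<bullet> y = 0" "det (cols x y v) = 1" for x y
  proof (cases "Q (x, y) \<le> R")
    case True
    then have "(x, y) \<in> X" using that by (simp add: X_def)
    then show ?thesis using t fin w by (metis Min_le finite_imageI imageI)
  next
    case False
    then show ?thesis using t w by (simp add: X_def)
  qed
  have W: "w1 \<in> lattice" "w2 \<in> lattice" "m \<bullet> w1 = 0" "m \<bullet> w2 = 0" "det (cols w1 w2 v) = 1" "Q (w1, w2) \<le> R"
    using t w by (auto simp: X_def)
  have n_add: "n (x + y) = n x + n y + 2 * ((B *v x) \<bullet> (B *v y))" for x y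
    by (simp add: n_def matrix_vector_right_distrib inner_add_left inner_add_right inner_commute)
  have n_diff: "n (x - y) = n x + n y - 2 * ((B *v x) \<bullet> (B *v y))" for x y
    by (simp add: n_def matrix_vector_mult_diff_distrib inner_diff_left inner_diff_right inner_commute)
  have "Q (w1, w2) \<le> Q (w1, w2 + w1)" "Q (w1, w2) \<le> Q (w1, w2 - w1)"
    "Q (w1, w2) \<le> Q (w1 + w2, w2)" "Q (w1, w2) \<le> Q (w1 - w2, w2)"
    using W by (auto intro!: min lattice_add lattice_diff simp: inner_add_right inner_diff_right)
      (simp_all add: det_cols algebra_simps)
  then have "2 * \<bar>(B *v w1) \<bullet> (B *v w2)\<bar> \<le> n w1" "2 * \<bar>(B *v w1) \<bullet> (B *v w2)\<bar> \<le> n w2"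
    by (auto simp: Q_def n_add n_diff inner_commute)
  then show ?thesis using that[of w1 w2] W by (simp add: Q_def R_def n_def)
qed

lemma dyadic_bracket:
  fixes t :: real
  assumes "t > 0" obtains i :: int where "2 powi i \<le> t" "t < 2 * 2 powi i"
proof
  have e: "2 powi i = 2 powr real_of_int i" for i :: int
    by (simp add: powr_real_of_int')
  show "2 powi \<lfloor>log 2 t\<rfloor> \<le> t"
    unfolding e using assms by (simp add: powr_le_iff)
  have "t < 2 powr (real_of_int \<lfloor>log 2 t\<rfloor> + 1)"
    using assms by (simp add: less_powr_iff)
  then show "t < 2 * 2 powi \<lfloor>log 2 t\<rfloor>"
    unfolding e by (simp add: powr_add)
qed

definition diag3 :: "real \<Rightarrow> real \<Rightarrow> real \<Rightarrow> real^3^3" where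
  "diag3 a b c = (\<chi> i j. if i = j then (if i = 1 then a else if i = 2 then b else c) else 0)"

lemma mult_diag3: "cols u v w ** diag3 a b c = cols (a *\<^sub>R u) (b *\<^sub>R v) (c *\<^sub>R w)"
  by (simp add: vec_eq_iff forall_3 matrix_matrix_mult_def sum_3 diag3_def cols_def)

lemma diag3_mult: "diag3 a b c ** diag3 a' b' c' = diag3 (a * a') (b * b') (c * c')"
  by (simp add: vec_eq_iff forall_3 matrix_matrix_mult_def sum_3 diag3_def)

lemma diag3_1: "diag3 1 1 1 = mat 1"
  by (simp add: vec_eq_iff forall_3 diag3_def mat_def)

lemma det_diag3: "det (diag3 a b c) = a * b * c"
  by (simp add: det_3 diag3_def)

text \<open>Matrices with columns of size 2^i, 2^j and 2^(-i-j) up to constants, brought into one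
  compact set by a diagonal matrix of determinant 1. The constant 42 = 2 * 19 + 4 comes from the
  last norm estimate of \<open>siegel_cover\<close>.\<close>

definition siegel_cell :: "int \<Rightarrow> int \<Rightarrow> (real^3) set set" where
  "siegel_cell i j = act (diag3 (1 / 2 powi i) (1 / 2 powi j) (2 powi i * 2 powi j)) ` cone_of ` bounded_mats 42 1"

lemma siegel_cell_member:
  assumes "norm a \<le> 2 * 2 powi i" "norm b \<le> 2 * 2 powi j" "norm c \<le> 42 / (2 powi i * 2 powi j)"
    "det (cols a b c) = 1"
  shows "cone_of (cols a b c) \<in> siegel_cell i j"
proof -
  let ?X = "2 powi i :: real" and ?Y = "2 powi j :: real"
  have pos: "?X > 0" "?Y > 0" by auto
  let ?K = "cols ((1 / ?X) *\<^sub>R a) ((1 / ?Y) *\<^sub>R b) ((?X * ?Y) *\<^sub>R c)"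
  have d1: "diag3 (1 / ?X) (1 / ?Y) (?X * ?Y) ** diag3 ?X ?Y (1 / (?X * ?Y)) = mat 1"
    "diag3 ?X ?Y (1 / (?X * ?Y)) ** diag3 (1 / ?X) (1 / ?Y) (?X * ?Y) = mat 1"
    using pos by (simp_all add: diag3_mult flip: diag3_1)
  have "?K ** diag3 ?X ?Y (1 / (?X * ?Y)) = cols a b c"
    using pos by (simp add: mult_diag3)
  then have "cone_of (cols a b c) = act (diag3 (1 / ?X) (1 / ?Y) (?X * ?Y)) (cone_of ?K)"
    using act_cone_of[OF d1] by simp
  moreover have "?K \<in> bounded_mats 42 1"
  proof -
    have "det ?K = 1" using assms(4) pos by (simp add: det_cols field_simps)
    moreover have "\<bar>a $ k\<bar> / ?X \<le> 42" for k
      unfolding pos_divide_le_eq[OF pos(1)]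
      using assms(1) component_le_norm_cart[of a k] pos by linarith
    moreover have "\<bar>b $ k\<bar> / ?Y \<le> 42" for k
      unfolding pos_divide_le_eq[OF pos(2)]
      using assms(2) component_le_norm_cart[of b k] pos by linarith
    moreover have "?X * ?Y * \<bar>c $ k\<bar> \<le> 42" for k
    proof -
      have "\<bar>c $ k\<bar> \<le> 42 / (?X * ?Y)" using assms(3) component_le_norm_cart[of c k] by linarith
      then show ?thesis using pos by (simp add: field_simps)
    qed
    ultimately show ?thesis
      using pos by (auto simp: bounded_mats_def cols_def abs_mult)
  qed
  ultimately show ?thesis unfolding siegel_cell_def by blast
qed

text \<open>In ray coordinates scaled so that \<open>m\<close> becomes a multiple of the coordinate
  sum, the face lies in a simplex of size \<open>l\<close>, comparable to the level spacing s = l/d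
  as d is bounded. A reduced basis of the plane lattice gives the first two columns. The third may
  be shifted along both of them many times before it outgrows the cell; the shifts form
  \<open>G\<close>.\<close>

lemma siegel_cover:
  assumes C: "C = cone_of N" "det N > 0"
    and f: "f = {x \<in> C \<inter> lattice. m \<bullet> x = 1}"
    and c: "\<And>i. c i > 0" "\<And>x. m \<bullet> x = (\<Sum>i\<in>UNIV. c i * (N $ i \<bullet> x))"
    and pqr: "p \<in> f" "q \<in> f" "r \<in> f" and v: "v \<in> lattice" "m \<bullet> v = 1 / real d" "det (cols (q - p) (r - p) v) = 1"
    and d: "1 \<le> d" "d \<le> (3::nat)"
  obtains i j :: int and G where "(2 powi i)\<^sup>2 * 2 powi j \<le> (18::real)" "2 powi i * (2 powi j)\<^sup>2 \<le> (18::real)"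
    "finite G" "G \<subseteq> SL3Z" "1 \<le> (2 powi i * 2 powi j) ^ 3 * real (card G)"
    "\<And>\<gamma>. \<gamma> \<in> G \<Longrightarrow> act \<gamma> f \<subseteq> {x. x $ 3 = real d} \<and> act \<gamma> C \<in> siegel_cell i j"
proof -
  define P where "P = c 1 * c 2 * c 3 * det N"
  have P: "P > 0" unfolding P_def using c(1) C(2) by simp
  define l where "l = 1 / root 3 P"
  have l: "l > 0" using P by (simp add: l_def)
  have l3: "l ^ 3 * P = 1" using P by (simp add: l_def power_divide odd_real_root_pow)
  \<comment> \<open>Weighting row i by \<open>c i\<close> makes the coordinate sum of
    \<open>B *v x\<close> equal to l (m \<bullet> x); the factor \<open>l\<close> normalizes det B
    to 1. Positive row factors leave the cone unchanged.\<close>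
  define B where "B = (\<chi> i j. l * c i * N $ i $ j)"
  have Brow: "B $ i \<bullet> x = l * c i * (N $ i \<bullet> x)" for i x
    by (simp add: B_def inner_vec_def sum_distrib_left mult_ac)
  have "det B = l ^ 3 * P"
    by (simp add: det_3 B_def P_def power3_eq_cube algebra_simps)
  then have detB: "det B = 1" using l3 by simp
  obtain H where H: "B ** H = mat 1" "H ** B = mat 1" using det_pos_inverse[of B] detB by auto
  have CB: "C = cone_of B"
  proof -
    have "0 \<le> l * c i * t \<longleftrightarrow> 0 \<le> t" for i t
      using mult_pos_pos[OF l c(1)[of i]] zero_le_mult_iff[of "l * c i" t] by linarith
    then show ?thesis by (simp add: C(1) cone_of_row Brow)
  qed
  define csum where "csum = (\<lambda>x::real^3. x $ 1 + x $ 2 + x $ 3)"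
  have oB: "csum (B *v x) = l * (m \<bullet> x)" for x
    by (simp add: csum_def matrix_vector_mul_component Brow c(2) sum_3 algebra_simps)
  define s where "s = l / real d"
  have s: "s > 0" using l d by (simp add: s_def)
  \<comment> \<open>The bound d \<le> 3 enters here: all lengths become multiples of the level
    spacing \<open>s\<close>.\<close>
  have ls: "l \<le> 3 * s" using l d by (simp add: s_def field_simps)
  have small: "norm (B *v x) \<le> l" if "x \<in> f" for x
  proof -
    have nn: "0 \<le> (B *v x) $ i" for i
      using that unfolding f CB by (simp add: cone_of_def)
    have "norm (B *v x) \<le> (\<Sum>i\<in>UNIV. \<bar>(B *v x) $ i\<bar>)" by (rule norm_le_l1_cart)
    also have "\<dots> = csum (B *v x)" using nn by (simp add: csum_def sum_3)
    also have "\<dots> = l" using that f by (simp add: oB)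
    finally show ?thesis .
  qed
  have edge: "(B *v (x - y)) \<bullet> (B *v (x - y)) \<le> 4 * l\<^sup>2" if "x \<in> f" "y \<in> f" for x y
  proof -
    have "norm (B *v (x - y)) \<le> 2 * l"
      using small[OF that(1)] small[OF that(2)] norm_triangle_ineq4[of "B *v x" "B *v y"]
      by (simp add: matrix_vector_mult_diff_distrib)
    then have "(norm (B *v (x - y)))\<^sup>2 \<le> (2 * l)\<^sup>2" by (intro power_mono) auto
    then show ?thesis by (simp add: power2_norm_eq_inner power_mult_distrib)
  qed
  have "q - p \<in> lattice" "r - p \<in> lattice" "m \<bullet> (q - p) = 0" "m \<bullet> (r - p) = 0"
    using pqr f by (auto intro!: lattice_diff simp: inner_diff_right)
  from reduced_basis[OF H(2) this v(3)] obtain w1 w2 where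
    w: "w1 \<in> lattice" "w2 \<in> lattice" "m \<bullet> w1 = 0" "m \<bullet> w2 = 0" "det (cols w1 w2 v) = 1"
    and wle: "(B *v w1) \<bullet> (B *v w1) + (B *v w2) \<bullet> (B *v w2)
      \<le> (B *v (q - p)) \<bullet> (B *v (q - p)) + (B *v (r - p)) \<bullet> (B *v (r - p))"
    and red: "2 * \<bar>(B *v w1) \<bullet> (B *v w2)\<bar> \<le> (B *v w1) \<bullet> (B *v w1)"
      "2 * \<bar>(B *v w1) \<bullet> (B *v w2)\<bar> \<le> (B *v w2) \<bullet> (B *v w2)" by metis
  define a where "a = B *v w1"
  define b where "b = B *v w2"
  have oab: "csum a = 0" "csum b = 0" using w by (simp_all add: a_def b_def oB)
  have ov: "csum (B *v v) = s" using v by (simp add: oB s_def)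
  have sq: "a \<bullet> a + b \<bullet> b \<le> 8 * l\<^sup>2"
    using wle edge[OF pqr(2,1)] edge[OF pqr(3,1)] by (simp add: a_def b_def)
  have na: "norm a \<le> 9 * s" and nb: "norm b \<le> 9 * s"
  proof -
    have l9: "(3 * l)\<^sup>2 = 9 * l\<^sup>2" by (simp add: power_mult_distrib)
    have "(norm a)\<^sup>2 \<le> (3 * l)\<^sup>2" "(norm b)\<^sup>2 \<le> (3 * l)\<^sup>2"
      unfolding power2_norm_eq_inner l9
      using sq inner_ge_zero[of a] inner_ge_zero[of b] zero_le_power2[of l] by linarith+
    then have "norm a \<le> 3 * l" "norm b \<le> 3 * l" using l by (auto intro: power2_le_imp_le)
    then show "norm a \<le> 9 * s" "norm b \<le> 9 * s" using ls by linarith+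
  qed
  have detab: "det (cols a b (B *v v)) = 1"
    using w(5) detB by (simp add: a_def b_def matrix_mult_cols[symmetric] det_mul)
  define e :: "real^3" where "e = (\<chi> i. 1)"
  have oe: "csum e = 3" by (simp add: csum_def e_def)
  have o_lin: "csum (x + y) = csum x + csum y" "csum (k *\<^sub>R x) = k * csum x" for x y k
    by (simp_all add: csum_def algebra_simps)
  \<comment> \<open>These coefficients come from solving Cramer's expansion of \<open>e\<close> in
    the basis a, b, B v for B v.\<close>
  define \<alpha> where "\<alpha> = - (s / 3) * det (cols e b (B *v v))"
  define \<beta> where "\<beta> = - (s / 3) * det (cols a e (B *v v))"
  have Bv: "B *v v = (s / 3) *\<^sub>R e + \<alpha> *\<^sub>R a + \<beta> *\<^sub>R b"
  proof -
    have e1: "e = det (cols e b (B *v v)) *\<^sub>R a + det (cols a e (B *v v)) *\<^sub>R b + det (cols a b e) *\<^sub>R (B *v v)"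
      using cramer_cols[OF detab[symmetric], of e] by simp
    then have "csum e = csum (det (cols e b (B *v v)) *\<^sub>R a + det (cols a e (B *v v)) *\<^sub>R b + det (cols a b e) *\<^sub>R (B *v v))" by metis
    then have "3 = det (cols a b e) * s" by (simp add: o_lin oab ov oe)
    then have dabe: "s / 3 * det (cols a b e) = 1" by (simp add: mult.commute)
    have "(s / 3) *\<^sub>R e = (s / 3) *\<^sub>R (det (cols e b (B *v v)) *\<^sub>R a + det (cols a e (B *v v)) *\<^sub>R b + det (cols a b e) *\<^sub>R (B *v v))"
      using e1 by metis
    also have "\<dots> = - \<alpha> *\<^sub>R a - \<beta> *\<^sub>R b + (s / 3 * det (cols a b e)) *\<^sub>R (B *v v)"
      by (simp add: \<alpha>_def \<beta>_def scaleR_add_right)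
    finally show ?thesis unfolding dabe by (simp add: algebra_simps)
  qed
  have dabe: "s / 3 * det (cols a b e) = 1"
    using detab unfolding Bv det_cols_shear by simp
  have gram: "(det (cols a b e))\<^sup>2 = 3 * ((a \<bullet> a) * (b \<bullet> b) - (a \<bullet> b)\<^sup>2)"
    unfolding e_def using oab by (intro gram_det_sum_zero) (simp_all add: csum_def)
  have dpos: "det (cols a b e) > 0"
    using dabe s zero_less_mult_pos[of "s / 3" "det (cols a b e)"] by simp
  have aa: "a \<bullet> a = (norm a)\<^sup>2" "b \<bullet> b = (norm b)\<^sup>2" by (simp_all add: power2_norm_eq_inner)
  have ab4: "4 * (a \<bullet> b)\<^sup>2 \<le> (a \<bullet> a) * (b \<bullet> b)"
  proof -
    have "(2 * \<bar>a \<bullet> b\<bar>) * (2 * \<bar>a \<bullet> b\<bar>) \<le> (a \<bullet> a) * (b \<bullet> b)"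
      using red by (intro mult_mono) (auto simp: a_def b_def)
    moreover have "(2 * \<bar>a \<bullet> b\<bar>) * (2 * \<bar>a \<bullet> b\<bar>) = 4 * (a \<bullet> b)\<^sup>2" by (simp add: power2_eq_square)
    ultimately show ?thesis by simp
  qed
  \<comment> \<open>For a reduced pair the Gram determinant puts det (cols a b e) between 3/2 and 3
    times |a| |b|. Together with \<open>dabe\<close> this pins s |a| |b| between 1 and 2.\<close>
  have up: "s * (norm a * norm b) \<le> 2"
  proof -
    have "(3 / 2 * (norm a * norm b))\<^sup>2 \<le> (det (cols a b e))\<^sup>2"
      unfolding gram using ab4 by (simp add: aa power_mult_distrib power_divide)
    then have "3 / 2 * (norm a * norm b) \<le> det (cols a b e)" using dpos by (auto intro: power2_le_imp_le)
    then have "s / 3 * (3 / 2 * (norm a * norm b)) \<le> s / 3 * det (cols a b e)" using s by (intro mult_left_mono) auto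
    then show ?thesis using dabe by simp
  qed
  have low: "s * (norm a * norm b) \<ge> 1"
  proof -
    have e9: "(3 * (norm a * norm b))\<^sup>2 = 9 * ((norm a)\<^sup>2 * (norm b)\<^sup>2)" by (simp add: power_mult_distrib)
    have le9: "3 * (M - K) \<le> 9 * M" if "0 \<le> K" "0 \<le> M" for M K :: real
      using that by (simp add: algebra_simps)
    have "(det (cols a b e))\<^sup>2 \<le> (3 * (norm a * norm b))\<^sup>2"
      unfolding gram aa e9 by (rule le9) simp_all
    then have "det (cols a b e) \<le> 3 * (norm a * norm b)" by (auto intro: power2_le_imp_le)
    then have "s / 3 * det (cols a b e) \<le> s / 3 * (3 * (norm a * norm b))" using s by (intro mult_left_mono) auto
    then show ?thesis using dabe by simp
  qed
  have "norm a > 0" "norm b > 0" using low by auto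
  then obtain i j :: int where X: "2 powi i \<le> norm a" "norm a < 2 * 2 powi i"
    and Y: "2 powi j \<le> norm b" "norm b < 2 * 2 powi j"
    using dyadic_bracket by metis
  define X where "X = (2 powi i :: real)"
  define Y where "Y = (2 powi j :: real)"
  have XY: "X > 0" "Y > 0" by (simp_all add: X_def Y_def)
  have Xa: "X \<le> norm a" "norm a < 2 * X" and Yb: "Y \<le> norm b" "norm b < 2 * Y"
    using X Y by (simp_all add: X_def Y_def)
  have sXY: "s * (X * Y) \<le> 2"
  proof -
    have "X * Y \<le> norm a * norm b" using Xa Yb XY by (intro mult_mono) auto
    then have "s * (X * Y) \<le> s * (norm a * norm b)" using s by simp
    then show ?thesis using up by linarith
  qed
  have le18: "X\<^sup>2 * Y \<le> 18" "X * Y\<^sup>2 \<le> 18"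
  proof -
    have "X \<le> 9 * s" "Y \<le> 9 * s" using na nb Xa Yb by linarith+
    then have "X * (X * Y) \<le> 9 * s * (X * Y)" "Y * (X * Y) \<le> 9 * s * (X * Y)"
      using XY by (auto intro!: mult_right_mono)
    then show "X\<^sup>2 * Y \<le> 18" "X * Y\<^sup>2 \<le> 18" using sXY by (auto simp: power2_eq_square mult_ac)
  qed
  define k1 where "k1 = \<lfloor>\<alpha>\<rfloor>"
  define k2 where "k2 = \<lfloor>\<beta>\<rfloor>"
  \<comment> \<open>Numbers of shifts: up to n1 steps of length at most 2 X, or n2 steps of length
    at most 2 Y, lengthen the third column by at most 2 / (X Y) each. The number of pairs, (n1 + 1)
    (n2 + 1), is at least 1 / (X Y)^3, the reciprocal of the weight.\<close>
  define n1 where "n1 = nat \<lfloor>1 / (X\<^sup>2 * Y)\<rfloor>"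
  define n2 where "n2 = nat \<lfloor>1 / (X * Y\<^sup>2)\<rfloor>"
  define z where "z = (\<lambda>(i :: nat, j :: nat). v + (real i - of_int k1) *\<^sub>R w1 + (real j - of_int k2) *\<^sub>R w2)"
  define g where "g = (\<lambda>t. SOME h. h \<in> SL3Z \<and> cols w1 w2 (z t) ** h = mat 1 \<and> h ** cols w1 w2 (z t) = mat 1)"
  have zl: "z t \<in> lattice" for t
    using v(1) w by (cases t) (auto simp: z_def intro!: lattice_add lattice_scale)
  have dz: "det (cols w1 w2 (z t)) = 1" for t
    using w(5) det_cols_shear[of w1 w2 1 v] by (cases t) (simp add: z_def)
  have g: "g t \<in> SL3Z" "cols w1 w2 (z t) ** g t = mat 1" "g t ** cols w1 w2 (z t) = mat 1" for t
  proof -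
    have "cols w1 w2 (z t) \<in> SL3Z" using w zl dz by (intro cols_SL3Z)
    then have "\<exists>h. h \<in> SL3Z \<and> cols w1 w2 (z t) ** h = mat 1 \<and> h ** cols w1 w2 (z t) = mat 1"
      using SL3Z_inverse by metis
    from someI_ex[OF this] show "g t \<in> SL3Z" "cols w1 w2 (z t) ** g t = mat 1" "g t ** cols w1 w2 (z t) = mat 1"
      by (simp_all add: g_def)
  qed
  let ?T = "{..n1} \<times> {..n2}"
  have mz: "m \<bullet> z t = 1 / real d" for t
    using v(2) w by (cases t) (simp add: z_def inner_add_right)
  have "act (g t) f \<subseteq> {x. x $ 3 = real d}" for t
  proof -
    have "(g t *v x) $ 3 = (real d *\<^sub>R m) \<bullet> x" for x
      using d w mz by (intro inverse_third_coordinate[OF g(2)]) auto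
    then show ?thesis using f by (auto simp: act_def)
  qed
  moreover have "act (g t) C \<in> siegel_cell i j" if t: "t \<in> ?T" for t
  proof -
    obtain t1 t2 where tt: "t = (t1, t2)" by (cases t)
    have Bz: "B *v z t = (s / 3) *\<^sub>R e + (frac \<alpha> + real t1) *\<^sub>R a + (frac \<beta> + real t2) *\<^sub>R b"
    proof -
      have "B *v z t = B *v v + (real t1 - of_int k1) *\<^sub>R a + (real t2 - of_int k2) *\<^sub>R b"
        by (simp add: tt z_def a_def b_def matrix_vector_right_distrib matrix_vector_mult_scaleR)
      then show ?thesis unfolding Bv frac_def k1_def k2_def by (simp add: algebra_simps)
    qed
    have "real t1 \<le> 1 / (X\<^sup>2 * Y)" "real t2 \<le> 1 / (X * Y\<^sup>2)"
    proof -
      have "real t1 \<le> real n1" "real t2 \<le> real n2" using t tt by auto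
      moreover have "real n1 \<le> 1 / (X\<^sup>2 * Y)" "real n2 \<le> 1 / (X * Y\<^sup>2)"
        using XY by (simp_all add: n1_def n2_def)
      ultimately show "real t1 \<le> 1 / (X\<^sup>2 * Y)" "real t2 \<le> 1 / (X * Y\<^sup>2)" by linarith+
    qed
    then have "real t1 * norm a \<le> 1 / (X\<^sup>2 * Y) * (2 * X)" "real t2 * norm b \<le> 1 / (X * Y\<^sup>2) * (2 * Y)"
      by (intro mult_mono; use Xa Yb XY in simp)+
    then have t12: "real t1 * norm a \<le> 2 / (X * Y)" "real t2 * norm b \<le> 2 / (X * Y)"
      using XY by (auto simp: power2_eq_square)
    have ne: "norm e \<le> 3" using norm_le_l1_cart[of e] by (simp add: e_def)
    have "norm (B *v z t) \<le> norm ((s / 3) *\<^sub>R e) + norm ((frac \<alpha> + real t1) *\<^sub>R a) + norm ((frac \<beta> + real t2) *\<^sub>R b)"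
      unfolding Bz by (meson add_mono norm_triangle_ineq order_refl order_trans)
    also have "\<dots> \<le> s + (norm a + 2 / (X * Y)) + (norm b + 2 / (X * Y))"
    proof (intro add_mono)
      show "norm ((s / 3) *\<^sub>R e) \<le> s" using ne s by simp
      have fr: "frac x * norm y \<le> norm y" for x and y :: "real^3"
        using frac_lt_1[of x] mult_right_mono[of "frac x" 1 "norm y"] by simp
      show "norm ((frac \<alpha> + real t1) *\<^sub>R a) \<le> norm a + 2 / (X * Y)"
        using t12(1) fr[of \<alpha> a] by (simp add: distrib_right)
      show "norm ((frac \<beta> + real t2) *\<^sub>R b) \<le> norm b + 2 / (X * Y)"
        using t12(2) fr[of \<beta> b] by (simp add: distrib_right)
    qed
    also have "\<dots> \<le> 19 * s + 4 / (X * Y)" using na nb by simp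
    also have "\<dots> \<le> 42 / (X * Y)"
    proof -
      have "s \<le> 2 / (X * Y)" using sXY XY by (simp add: field_simps)
      then show ?thesis by (simp add: field_simps)
    qed
    finally have nz: "norm (B *v z t) \<le> 42 / (X * Y)" .
    have "act (g t) C = cone_of (cols a b (B *v z t))"
      unfolding CB a_def b_def matrix_mult_cols[symmetric] by (rule act_cone_of[OF g(3) g(2)])
    moreover have "det (cols a b (B *v z t)) = 1"
      using dz[of t] detB by (simp add: a_def b_def matrix_mult_cols[symmetric] det_mul)
    ultimately show ?thesis
      using siegel_cell_member[of a i b j "B *v z t"] Xa Yb nz by (simp add: X_def Y_def)
  qed
  moreover have "inj_on g ?T"
  proof (rule inj_onI)
    fix x y assume "g x = g y"
    then have "cols w1 w2 (z x) = cols w1 w2 (z y)"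
      using g(2)[of x] g(3)[of y] by (metis matrix_mul_assoc matrix_mul_lid matrix_mul_rid)
    then have "cols w1 w2 (z x) *v axis 3 1 = cols w1 w2 (z y) *v axis 3 1" by simp
    then have zz: "z x = z y" by (simp add: cols_mult_vec axis_def)
    obtain x1 x2 y1 y2 where xy: "x = (x1, x2)" "y = (y1, y2)" by (cases x, cases y)
    define h1 where "h1 = real x1 - real y1"
    define h2 where "h2 = real x2 - real y2"
    have 0: "h1 *\<^sub>R w1 + h2 *\<^sub>R w2 = 0" using zz by (simp add: xy z_def h1_def h2_def algebra_simps)
    have "cols w1 w2 v *v vector [h1, h2, 0] = 0" using 0 by (simp add: cols_mult_vec)
    moreover have "cols w1 w2 v \<in> SL3R" using w(5) by (simp add: SL3R_def)
    ultimately have "vector [h1, h2, 0] = (0 :: real^3)"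
      using SL3R_linear_inj(2)[of "cols w1 w2 v"] by (metis injD matrix_vector_mult_0_right)
    then have "h1 = 0" "h2 = 0" by (auto simp: vec_eq_iff forall_3)
    then show "x = y" by (simp add: xy h1_def h2_def)
  qed
  then have cg: "real (card (g ` ?T)) = real (n1 + 1) * real (n2 + 1)"
    by (simp only: card_image card_cartesian_product card_atMost of_nat_mult Suc_eq_plus1)
  have num: "1 \<le> (X * Y) ^ 3 * (real (n1 + 1) * real (n2 + 1))"
  proof -
    have "1 / (X\<^sup>2 * Y) \<le> real (n1 + 1)" "1 / (X * Y\<^sup>2) \<le> real (n2 + 1)"
      unfolding n1_def n2_def by linarith+
    then have "1 / (X\<^sup>2 * Y) * (1 / (X * Y\<^sup>2)) \<le> real (n1 + 1) * real (n2 + 1)"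
      using XY by (intro mult_mono) auto
    then have "(X * Y) ^ 3 * (1 / (X\<^sup>2 * Y) * (1 / (X * Y\<^sup>2))) \<le> (X * Y) ^ 3 * (real (n1 + 1) * real (n2 + 1))"
      using XY by (intro mult_left_mono) auto
    moreover have "(X * Y) ^ 3 * (1 / (X\<^sup>2 * Y) * (1 / (X * Y\<^sup>2))) = 1"
      using XY by (simp add: power2_eq_square power3_eq_cube)
    ultimately show ?thesis by simp
  qed
  have "1 \<le> (X * Y) ^ 3 * real (card (g ` ?T))" unfolding cg by (rule num)
  ultimately show ?thesis
    using le18 g(1) by (intro that[of i j "g ` ?T"]) (auto simp: X_def Y_def simp del: of_nat_Suc)
qed

section \<open>Empty simplices\<close>

locale empty_cone =
  fixes B :: "real^3^3" and m :: "real^3" and d :: nat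
  assumes pos: "x \<in> lattice \<Longrightarrow> x \<noteq> 0 \<Longrightarrow> x \<in> cone_of B \<Longrightarrow> 0 < B $ i \<bullet> x"
    and empty: "x \<in> lattice \<Longrightarrow> x \<noteq> 0 \<Longrightarrow> x \<in> cone_of B \<Longrightarrow> 1 \<le> m \<bullet> x"
    and d: "4 \<le> d"
begin

definition face_point :: "real^3 \<Rightarrow> bool" where
  "face_point x \<longleftrightarrow> x \<in> lattice \<and> x \<in> cone_of B \<and> m \<bullet> x = 1"

text \<open>White's normal form of an empty simplex with vertices \<open>0, p, q, r\<close> and determinant \<open>d\<close>.\<close>

definition triple :: "real^3 \<Rightarrow> real^3 \<Rightarrow> real^3 \<Rightarrow> nat \<Rightarrow> nat \<Rightarrow> nat \<Rightarrow> nat \<Rightarrow> bool" where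
  "triple p q r k l \<alpha> \<beta> \<longleftrightarrow> face_point p \<and> face_point q \<and> face_point r \<and>
    k + l = d \<and> \<alpha> + \<beta> = d \<and> 0 < k \<and> 0 < l \<and> 0 < \<alpha> \<and> 0 < \<beta> \<and> k * \<alpha> mod d = 1 \<and>
    (1 / real d) *\<^sub>R (p - q + real k *\<^sub>R r) \<in> lattice"

lemma face_point_pos: "face_point x \<Longrightarrow> 0 < B $ i \<bullet> x"
  unfolding face_point_def using pos[of x i] by force

text \<open>Such a lattice point lies strictly between the origin and the plane of the face, so
  emptiness expels it from the cone. The inequalities between the rows come from this.\<close>

lemma row_negative:
  assumes "face_point p" "face_point q" "face_point r"
    and "(1 / real d) *\<^sub>R (a *\<^sub>R p + b *\<^sub>R q + c *\<^sub>R r) \<in> lattice" "0 < a + b + c" "a + b + c < real d"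
  obtains i where "a * (B $ i \<bullet> p) + b * (B $ i \<bullet> q) + c * (B $ i \<bullet> r) < 0"
proof -
  define x where "x = (1 / real d) *\<^sub>R (a *\<^sub>R p + b *\<^sub>R q + c *\<^sub>R r)"
  have mx: "m \<bullet> x = (a + b + c) / real d"
    using assms(1-3) by (simp add: face_point_def inner_add_right x_def)
  have "real d > 0" using d by simp
  then have "m \<bullet> x < 1" "m \<bullet> x > 0" unfolding mx using assms(5,6) by (simp_all add: divide_less_eq)
  then have "x \<noteq> 0" "\<not> 1 \<le> m \<bullet> x" by auto
  then have "x \<notin> cone_of B" using empty[of x] assms(4) unfolding x_def by blast
  then obtain i where "B $ i \<bullet> x < 0" by (auto simp: cone_of_row not_le)
  moreover have "B $ i \<bullet> x = (a * (B $ i \<bullet> p) + b * (B $ i \<bullet> q) + c * (B $ i \<bullet> r)) / real d"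
    by (simp add: x_def inner_add_right)
  ultimately have "a * (B $ i \<bullet> p) + b * (B $ i \<bullet> q) + c * (B $ i \<bullet> r) < 0"
    using d by (simp add: divide_less_0_iff)
  then show ?thesis by (rule that)
qed

text \<open>Replace the lattice point V = (p - q + k r) / d by r - V. The residues of k and \<alpha>
  modulo d change sign, so they stay inverse to each other.\<close>

lemma triple_swap:
  assumes "triple p q r k l \<alpha> \<beta>" shows "triple q p r l k \<beta> \<alpha>"
proof -
  have t: "face_point p" "face_point q" "face_point r" "k + l = d" "\<alpha> + \<beta> = d" "0 < k" "0 < l" "0 < \<alpha>" "0 < \<beta>"
    "k * \<alpha> mod d = 1" "(1 / real d) *\<^sub>R (p - q + real k *\<^sub>R r) \<in> lattice"
    using assms by (auto simp: triple_def)
  have "int (l * \<beta>) = int d * (int d - int \<alpha> - int k) + int (k * \<alpha>)"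
  proof -
    have l: "int l = int d - int k" and b: "int \<beta> = int d - int \<alpha>" using t(4,5) by linarith+
    show ?thesis unfolding of_nat_mult l b by (simp add: algebra_simps)
  qed
  then have "int (l * \<beta>) mod int d = int (k * \<alpha>) mod int d" by simp
  then have lb: "l * \<beta> mod d = 1" using t(10) by (metis of_nat_eq_iff zmod_int)
  have "(1 / real d) *\<^sub>R (q - p + real l *\<^sub>R r) = r - (1 / real d) *\<^sub>R (p - q + real k *\<^sub>R r)"
  proof -
    have l: "real l = real d - real k" using t(4) by linarith
    have "q - p + real l *\<^sub>R r = real d *\<^sub>R r - (p - q + real k *\<^sub>R r)" unfolding l by (simp add: algebra_simps)
    then have "(1 / real d) *\<^sub>R (q - p + real l *\<^sub>R r) = (1 / real d) *\<^sub>R (real d *\<^sub>R r - (p - q + real k *\<^sub>R r))"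
      by (simp only:)
    also have "\<dots> = r - (1 / real d) *\<^sub>R (p - q + real k *\<^sub>R r)" using d by (simp only: scaleR_diff_right) simp
    finally show ?thesis .
  qed
  moreover have "\<dots> \<in> lattice" using t by (intro lattice_diff) (auto simp: face_point_def)
  ultimately show ?thesis using t lb by (simp add: triple_def add.commute)
qed

lemma triple_right_row:
  assumes "triple p q r k l \<alpha> \<beta>"
  obtains i where "real k * (B $ i \<bullet> r) < B $ i \<bullet> q - B $ i \<bullet> p"
proof -
  have t: "face_point p" "face_point q" "face_point r" "k + l = d" "0 < k" "0 < l"
    "(1 / real d) *\<^sub>R (p - q + real k *\<^sub>R r) \<in> lattice"
    using assms by (auto simp: triple_def)
  have "(1 / real d) *\<^sub>R (1 *\<^sub>R p + (-1) *\<^sub>R q + real k *\<^sub>R r) \<in> lattice" using t(7) by simp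
  moreover have "0 < 1 + (-1) + real k" "1 + (-1) + real k < real d" using t by simp_all
  ultimately obtain i where "1 * (B $ i \<bullet> p) + (-1) * (B $ i \<bullet> q) + real k * (B $ i \<bullet> r) < 0"
    by (rule row_negative[OF t(1-3)])
  then show ?thesis using that[of i] by simp
qed

text \<open>The lattice points V = (p - q + k r) / d, r - V and (\<beta> p + \<alpha> q - r) / d lie
  below the plane of the face, hence outside the cone. The three inequalities name a row violated by
  each.\<close>

definition rows :: "real^3 \<Rightarrow> real^3 \<Rightarrow> real^3 \<Rightarrow> nat \<Rightarrow> nat \<Rightarrow> nat \<Rightarrow> nat \<Rightarrow> 3 \<Rightarrow> 3 \<Rightarrow> 3 \<Rightarrow> bool" where
  "rows p q r k l \<alpha> \<beta> \<rho> \<sigma> \<tau> \<longleftrightarrow> \<rho> \<noteq> \<sigma> \<and> \<rho> \<noteq> \<tau> \<and> \<sigma> \<noteq> \<tau> \<and>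
    real k * (B $ \<rho> \<bullet> r) < B $ \<rho> \<bullet> q - B $ \<rho> \<bullet> p \<and>
    real l * (B $ \<sigma> \<bullet> r) < B $ \<sigma> \<bullet> p - B $ \<sigma> \<bullet> q \<and>
    real \<beta> * (B $ \<tau> \<bullet> p) + real \<alpha> * (B $ \<tau> \<bullet> q) < B $ \<tau> \<bullet> r"

lemma rows_swap: "rows p q r k l \<alpha> \<beta> \<rho> \<sigma> \<tau> \<Longrightarrow> rows q p r l k \<beta> \<alpha> \<sigma> \<rho> \<tau>"
  by (auto simp: rows_def add.commute)

lemma third_index: "i = \<tau>" if "\<rho> \<noteq> \<sigma>" "\<rho> \<noteq> \<tau>" "\<sigma> \<noteq> \<tau>" "i \<noteq> \<rho>" "i \<noteq> \<sigma>" for i \<rho> \<sigma> \<tau> :: 3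
  using that exhaust_3[of i] exhaust_3[of \<rho>] exhaust_3[of \<sigma>] exhaust_3[of \<tau>] by auto

lemma bottom_row:
  assumes tr: "triple p q r k l \<alpha> \<beta>" and \<rho>: "real k * (B $ \<rho> \<bullet> r) < B $ \<rho> \<bullet> q - B $ \<rho> \<bullet> p"
    and \<sigma>: "real l * (B $ \<sigma> \<bullet> r) < B $ \<sigma> \<bullet> p - B $ \<sigma> \<bullet> q" and ne: "\<rho> \<noteq> \<tau>" "\<sigma> \<noteq> \<tau>"
  shows "rows p q r k l \<alpha> \<beta> \<rho> \<sigma> \<tau>"
proof -
  have t: "face_point p" "face_point q" "face_point r" "k + l = d" "\<alpha> + \<beta> = d" "0 < k" "0 < l" "0 < \<alpha>" "0 < \<beta>"
    "k * \<alpha> mod d = 1" "(1 / real d) *\<^sub>R (p - q + real k *\<^sub>R r) \<in> lattice"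
    using tr by (auto simp: triple_def)
  have pp: "0 < B $ i \<bullet> p" "0 < B $ i \<bullet> q" "0 < B $ i \<bullet> r" for i using t(1-3) face_point_pos by auto
  have rl: "\<rho> \<noteq> \<sigma>"
  proof
    assume "\<rho> = \<sigma>"
    then have "real k * (B $ \<rho> \<bullet> r) + real l * (B $ \<rho> \<bullet> r) < 0" using \<rho> \<sigma> by simp
    moreover have "real k * (B $ \<rho> \<bullet> r) + real l * (B $ \<rho> \<bullet> r) > 0" using pp t by (intro add_pos_pos mult_pos_pos) auto
    ultimately show False by simp
  qed
  define t0 where "t0 = k * \<alpha> div d"
  have "k * \<alpha> = d * t0 + 1" using t(10) by (metis t0_def mult_div_mod_eq)
  then have ka: "real k * real \<alpha> = real d * real t0 + 1" by (metis of_nat_1 of_nat_add of_nat_mult)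
  have be: "real \<beta> = real d - real \<alpha>" using t(5) by linarith
  \<comment> \<open>Modulo integral combinations of p and r this point is -\<alpha> V, since
    \<alpha> inverts k modulo d; so it belongs to the lattice.\<close>
  have "(1 / real d) *\<^sub>R (real \<beta> *\<^sub>R p + real \<alpha> *\<^sub>R q + (-1) *\<^sub>R r)
    = p - real \<alpha> *\<^sub>R ((1 / real d) *\<^sub>R (p - q + real k *\<^sub>R r)) + real t0 *\<^sub>R r"
  proof -
    have "real \<beta> *\<^sub>R p + real \<alpha> *\<^sub>R q + (-1) *\<^sub>R r
      = real d *\<^sub>R p - real \<alpha> *\<^sub>R (p - q) - (real d * real t0 + 1) *\<^sub>R r + (real d * real t0) *\<^sub>R r"
      unfolding be by (simp add: algebra_simps)
    also have "\<dots> = real d *\<^sub>R (p - real \<alpha> *\<^sub>R ((1 / real d) *\<^sub>R (p - q + real k *\<^sub>R r)) + real t0 *\<^sub>R r)"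
      unfolding ka[symmetric] using d by (simp add: algebra_simps)
    finally show ?thesis using d by simp
  qed
  also have "\<dots> \<in> lattice"
  proof -
    have "real \<alpha> *\<^sub>R ((1 / real d) *\<^sub>R (p - q + real k *\<^sub>R r)) \<in> lattice"
      by (rule lattice_scale[OF t(11)]) simp
    moreover have "real t0 *\<^sub>R r \<in> lattice" using t by (intro lattice_scale) (auto simp: face_point_def)
    ultimately show ?thesis using t(1) by (intro lattice_add lattice_diff) (auto simp: face_point_def)
  qed
  finally have W: "(1 / real d) *\<^sub>R (real \<beta> *\<^sub>R p + real \<alpha> *\<^sub>R q + (-1) *\<^sub>R r) \<in> lattice" .
  have "0 < real \<beta> + real \<alpha> + (-1)" "real \<beta> + real \<alpha> + (-1) < real d" using be d by simp_all
  then obtain i where i: "real \<beta> * (B $ i \<bullet> p) + real \<alpha> * (B $ i \<bullet> q) + (-1) * (B $ i \<bullet> r) < 0"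
    by (rule row_negative[OF t(1-3) W])
  have ge1: "x \<le> real n * x" if "0 < n" "0 < x" for n :: nat and x :: real
    using that mult_right_mono[of 1 "real n" x] by simp
  have "i \<noteq> \<rho>"
  proof
    assume e: "i = \<rho>"
    show False using i[unfolded e] \<rho> ge1[OF t(6) pp(3), of \<rho>] ge1[OF t(8) pp(2), of \<rho>] ge1[OF t(9) pp(1), of \<rho>] pp[of \<rho>] by linarith
  qed
  moreover have "i \<noteq> \<sigma>"
  proof
    assume e: "i = \<sigma>"
    show False using i[unfolded e] \<sigma> ge1[OF t(7) pp(3), of \<sigma>] ge1[OF t(8) pp(2), of \<sigma>] ge1[OF t(9) pp(1), of \<sigma>] pp[of \<sigma>] by linarith
  qed
  ultimately have "i = \<tau>" using third_index rl ne by blast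
  then show ?thesis using i \<rho> \<sigma> ne rl by (simp add: rows_def)
qed

lemma triple_rows:
  assumes tr: "triple p q r k l \<alpha> \<beta>"
  obtains \<rho> \<sigma> \<tau> where "rows p q r k l \<alpha> \<beta> \<rho> \<sigma> \<tau>"
proof -
  obtain \<rho> where \<rho>: "real k * (B $ \<rho> \<bullet> r) < B $ \<rho> \<bullet> q - B $ \<rho> \<bullet> p" using triple_right_row[OF tr] .
  obtain \<sigma> where \<sigma>: "real l * (B $ \<sigma> \<bullet> r) < B $ \<sigma> \<bullet> p - B $ \<sigma> \<bullet> q" using triple_right_row[OF triple_swap[OF tr]] .
  have "card {\<rho>, \<sigma>} < card (UNIV :: 3 set)" by (simp add: card_insert_if)
  then have "{\<rho>, \<sigma>} \<noteq> UNIV" by force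
  then obtain \<tau> where "\<tau> \<notin> {\<rho>, \<sigma>}" by blast
  then have "\<rho> \<noteq> \<tau>" "\<sigma> \<noteq> \<tau>" by auto
  then show ?thesis using bottom_row[OF tr \<rho> \<sigma>] that by blast
qed

text \<open>The lattice condition involves p and q only through p - q, so consecutive points of
  their line can replace them while they stay in the cone. The inequality in row \<tau> depends on
  the points themselves and is obtained afresh from emptiness.\<close>

lemma triple_along_row:
  assumes tr: "triple p q r k l \<alpha> \<beta>" and ro: "rows p q r k l \<alpha> \<beta> \<rho> \<sigma> \<tau>"
    and s: "\<And>j. s j = p + real j *\<^sub>R (q - p)" and C: "s n \<in> cone_of B" "s (n + 1) \<in> cone_of B"
  shows "triple (s n) (s (n + 1)) r k l \<alpha> \<beta>" "rows (s n) (s (n + 1)) r k l \<alpha> \<beta> \<rho> \<sigma> \<tau>"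
proof -
  have t: "face_point p" "face_point q" "face_point r" using tr by (auto simp: triple_def)
  have fp: "face_point (s j)" if "s j \<in> cone_of B" for j
    using t that by (auto simp: face_point_def s inner_add_right inner_diff_right intro!: lattice_add lattice_diff lattice_scale)
  have sd: "s n - s (n + 1) = p - q" by (simp add: s algebra_simps)
  show tr': "triple (s n) (s (n + 1)) r k l \<alpha> \<beta>"
    using tr fp[OF C(1)] fp[OF C(2)] unfolding triple_def sd by blast
  have diff: "B $ i \<bullet> s (n + 1) - B $ i \<bullet> s n = B $ i \<bullet> q - B $ i \<bullet> p" for i
    by (simp add: s inner_add_right inner_diff_right algebra_simps)
  show "rows (s n) (s (n + 1)) r k l \<alpha> \<beta> \<rho> \<sigma> \<tau>"
    using ro diff[of \<rho>] diff[of \<sigma>] by (intro bottom_row[OF tr']) (auto simp: rows_def)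
qed

text \<open>On the walk from p through q row \<rho> grows and row \<tau> does not fall, so the cone
  is left through row \<sigma>. One more step would make this row negative, hence the last step
  inside has more than halved it.\<close>

lemma slide:
  assumes tr: "triple p q r k l \<alpha> \<beta>" and ro: "rows p q r k l \<alpha> \<beta> \<rho> \<sigma> \<tau>"
    and s: "\<And>j. s j = p + real j *\<^sub>R (q - p)" and le: "B $ \<tau> \<bullet> p \<le> B $ \<tau> \<bullet> q"
  obtains n where "\<And>j. j \<le> n + 1 \<Longrightarrow> s j \<in> cone_of B"
    "2 * (B $ \<sigma> \<bullet> s (n + 1)) < B $ \<sigma> \<bullet> s n"
proof -
  have t: "face_point p" "face_point q" "face_point r" "0 < k" "0 < l" using tr by (auto simp: triple_def)
  have pp: "0 < B $ i \<bullet> p" "0 < B $ i \<bullet> q" "0 < B $ i \<bullet> r" for i using t(1-3) face_point_pos by auto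
  have row: "B $ i \<bullet> s j = B $ i \<bullet> p + real j * (B $ i \<bullet> q - B $ i \<bullet> p)" for i j
    by (simp add: s inner_add_right inner_diff_right)
  have kr: "0 < real k * (B $ \<rho> \<bullet> r)" "0 < real l * (B $ \<sigma> \<bullet> r)" using pp t by auto
  have up: "B $ \<rho> \<bullet> p < B $ \<rho> \<bullet> q" and down: "B $ \<sigma> \<bullet> p - B $ \<sigma> \<bullet> q > 0"
    using ro kr by (auto simp: rows_def)
  obtain j0 :: nat where "B $ \<sigma> \<bullet> p < real j0 * (B $ \<sigma> \<bullet> p - B $ \<sigma> \<bullet> q)"
    using ex_less_of_nat_mult[OF down] by blast
  then have "B $ \<sigma> \<bullet> s j0 < 0" by (simp add: row algebra_simps)
  then have ex: "s j0 \<notin> cone_of B" by (auto simp: cone_of_row not_le)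
  define J where "J = (LEAST j. s j \<notin> cone_of B)"
  have J: "s J \<notin> cone_of B" unfolding J_def using ex by (rule LeastI)
  have below: "s j \<in> cone_of B" if "j < J" for j using not_less_Least[of j] that unfolding J_def by blast
  have "s 0 = p" "s 1 = q" by (simp_all add: s)
  then have "s 0 \<in> cone_of B" "s 1 \<in> cone_of B" using t(1,2) unfolding face_point_def by simp_all
  then have "J \<noteq> 0" "J \<noteq> 1" using J by metis+
  then obtain n where n: "J = n + 2" by (metis add_2_eq_Suc' not0_implies_Suc One_nat_def)
  obtain i where i: "B $ i \<bullet> s J < 0" using J by (auto simp: cone_of_row not_le)
  have nn: "0 \<le> real J * x" if "0 \<le> x" for x using that by simp
  have inc: "0 \<le> B $ j \<bullet> s J" if "B $ j \<bullet> p \<le> B $ j \<bullet> q" for j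
    unfolding row using that pp(1)[of j] nn[of "B $ j \<bullet> q - B $ j \<bullet> p"] by linarith
  have "i \<noteq> \<rho>" using i inc[of \<rho>] up by auto
  moreover have "i \<noteq> \<tau>" using i inc[of \<tau>] le by auto
  ultimately have "i = \<sigma>" using third_index[of \<rho> \<tau> \<sigma> i] ro by (auto simp: rows_def)
  then have "2 * (B $ \<sigma> \<bullet> s (n + 1)) < B $ \<sigma> \<bullet> s n" using i unfolding row n by (simp add: algebra_simps)
  then show ?thesis using that[of n] below n by simp
qed

text \<open>The factors 2 keep the determinant away from 0 once every row is divided by its dominant
  entry, see \<open>white_det_normalized\<close>.\<close>

definition good :: "real^3 \<Rightarrow> real^3 \<Rightarrow> real^3 \<Rightarrow> nat \<Rightarrow> nat \<Rightarrow> nat \<Rightarrow> nat \<Rightarrow> 3 \<Rightarrow> 3 \<Rightarrow> 3 \<Rightarrow> bool" where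
  "good p q r k l \<alpha> \<beta> \<rho> \<sigma> \<tau> \<longleftrightarrow> triple p q r k l \<alpha> \<beta> \<and> rows p q r k l \<alpha> \<beta> \<rho> \<sigma> \<tau> \<and>
    2 * (B $ \<tau> \<bullet> p) < B $ \<tau> \<bullet> r \<and> 2 * (B $ \<tau> \<bullet> q) < B $ \<tau> \<bullet> r \<and>
    (2 * (B $ \<rho> \<bullet> p) < B $ \<rho> \<bullet> q \<or> 2 * (B $ \<sigma> \<bullet> q) < B $ \<sigma> \<bullet> p)"

lemma good_swap: "good p q r k l \<alpha> \<beta> \<rho> \<sigma> \<tau> \<Longrightarrow> good q p r l k \<beta> \<alpha> \<sigma> \<rho> \<tau>"
  using triple_swap rows_swap by (auto simp: good_def)

definition solution :: "real \<Rightarrow> bool" where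
  "solution D \<longleftrightarrow> (\<exists>p q r k l \<alpha> \<beta> \<rho> \<sigma> \<tau>. good p q r k l \<alpha> \<beta> \<rho> \<sigma> \<tau> \<and> \<bar>det (cols p q r)\<bar> = D)"

lemma det_slide:
  assumes "\<And>j. s j = p + real j *\<^sub>R (q - p)"
  shows "det (cols (s n) (s (n + 1)) r) = det (cols p q r)"
  unfolding assms by (simp add: det_cols algebra_simps)

text \<open>For k, l \<ge> 2 also \<alpha>, \<beta> \<ge> 2, so row \<tau> already provides its two
  factors 2, at any place of the line. Sliding provides the third.\<close>

lemma middle_one:
  assumes tr: "triple p q r k l \<alpha> \<beta>" and k: "2 \<le> k" "2 \<le> l" and ro: "rows p q r k l \<alpha> \<beta> \<rho> \<sigma> \<tau>"
    and le: "B $ \<tau> \<bullet> p \<le> B $ \<tau> \<bullet> q"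
  shows "solution \<bar>det (cols p q r)\<bar>"
proof -
  have a2: "2 \<le> \<alpha>" if "triple p q r k l \<alpha> \<beta>" "2 \<le> k" for p q r k l \<alpha> \<beta>
  proof (rule ccontr)
    assume "\<not> 2 \<le> \<alpha>"
    then have "\<alpha> = 1" using that by (auto simp: triple_def)
    then show False using that d by (auto simp: triple_def)
  qed
  have ab: "2 \<le> \<alpha>" "2 \<le> \<beta>" using a2[OF tr k(1)] a2[OF triple_swap[OF tr] k(2)] .
  define s where "s = (\<lambda>j::nat. p + real j *\<^sub>R (q - p))"
  have s: "s j = p + real j *\<^sub>R (q - p)" for j by (simp add: s_def)
  obtain n where n: "\<And>j. j \<le> n + 1 \<Longrightarrow> s j \<in> cone_of B" "2 * (B $ \<sigma> \<bullet> s (n + 1)) < B $ \<sigma> \<bullet> s n"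
    using slide[OF tr ro s le] by metis
  have tr': "triple (s n) (s (n + 1)) r k l \<alpha> \<beta>" and ro': "rows (s n) (s (n + 1)) r k l \<alpha> \<beta> \<rho> \<sigma> \<tau>"
    using triple_along_row[OF tr ro s] n(1) by auto
  have pp: "0 < B $ \<tau> \<bullet> s n" "0 < B $ \<tau> \<bullet> s (n + 1)" using tr' face_point_pos by (auto simp: triple_def)
  have "2 * (B $ \<tau> \<bullet> s n) \<le> real \<beta> * (B $ \<tau> \<bullet> s n)" "2 * (B $ \<tau> \<bullet> s (n + 1)) \<le> real \<alpha> * (B $ \<tau> \<bullet> s (n + 1))"
    using ab pp by (auto intro!: mult_right_mono)
  moreover have "real \<beta> * (B $ \<tau> \<bullet> s n) + real \<alpha> * (B $ \<tau> \<bullet> s (n + 1)) < B $ \<tau> \<bullet> r"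
    using ro' by (simp add: rows_def)
  ultimately have "2 * (B $ \<tau> \<bullet> s n) < B $ \<tau> \<bullet> r" "2 * (B $ \<tau> \<bullet> s (n + 1)) < B $ \<tau> \<bullet> r"
    using pp by linarith+
  then have "good (s n) (s (n + 1)) r k l \<alpha> \<beta> \<rho> \<sigma> \<tau>"
    using tr' ro' n(2) unfolding good_def by blast
  then show ?thesis using det_slide[OF s, of n r] unfolding solution_def by metis
qed

lemma det_cols_swap: "det (cols q p r) = - det (cols p q r)" "det (cols r q p) = - det (cols p q r)"
  by (simp_all add: det_cols)

lemma middle:
  assumes tr: "triple p q r k l \<alpha> \<beta>" and k: "2 \<le> k" "2 \<le> l"
  shows "solution \<bar>det (cols p q r)\<bar>"
proof -
  obtain \<rho> \<sigma> \<tau> where ro: "rows p q r k l \<alpha> \<beta> \<rho> \<sigma> \<tau>" using triple_rows[OF tr] .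
  show ?thesis
  proof (cases "B $ \<tau> \<bullet> p \<le> B $ \<tau> \<bullet> q")
    case True
    then show ?thesis using middle_one[OF tr k ro] by simp
  next
    case False
    then show ?thesis using middle_one[OF triple_swap[OF tr] k(2,1) rows_swap[OF ro]] False det_cols_swap(1)[of q p r] by simp
  qed
qed

lemma triple_1:
  assumes "triple p q r 1 l \<alpha> \<beta>" shows "\<alpha> = 1" "l = d - 1" "\<beta> = d - 1" "real l = real d - 1" "real \<beta> = real d - 1"
proof -
  show a: "\<alpha> = 1" using assms by (auto simp: triple_def)
  show "l = d - 1" "\<beta> = d - 1" "real l = real d - 1" "real \<beta> = real d - 1"
    using assms a d by (auto simp: triple_def)
qed

text \<open>For k = 1 also \<alpha> = 1, and row \<tau> no longer gives a factor 2 for q. A further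
  lattice point below the plane compensates: q - V = (-p + (d + 1) q - r) / d. It cannot violate row
  \<rho>, where q dominates.\<close>

lemma extra_row:
  assumes tr: "triple p q r 1 l \<alpha> \<beta>" and ro: "rows p q r 1 l \<alpha> \<beta> \<rho> \<sigma> \<tau>"
  shows "real (d + 1) * (B $ \<tau> \<bullet> q) < B $ \<tau> \<bullet> p + B $ \<tau> \<bullet> r \<or> real (d + 1) * (B $ \<sigma> \<bullet> q) < B $ \<sigma> \<bullet> p + B $ \<sigma> \<bullet> r"
proof -
  have t: "face_point p" "face_point q" "face_point r" "(1 / real d) *\<^sub>R (p - q + real 1 *\<^sub>R r) \<in> lattice"
    using tr by (auto simp: triple_def)
  have pp: "0 < B $ i \<bullet> p" "0 < B $ i \<bullet> q" "0 < B $ i \<bullet> r" for i using t(1-3) face_point_pos by auto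
  have "(1 / real d) *\<^sub>R ((-1) *\<^sub>R p + real (d + 1) *\<^sub>R q + (-1) *\<^sub>R r) = q - (1 / real d) *\<^sub>R (p - q + real 1 *\<^sub>R r)"
  proof -
    have "(-1) *\<^sub>R p + real (d + 1) *\<^sub>R q + (-1) *\<^sub>R r = real d *\<^sub>R q - (p - q + real 1 *\<^sub>R r)" by (simp add: algebra_simps)
    then have "(1 / real d) *\<^sub>R ((-1) *\<^sub>R p + real (d + 1) *\<^sub>R q + (-1) *\<^sub>R r) = (1 / real d) *\<^sub>R (real d *\<^sub>R q - (p - q + real 1 *\<^sub>R r))"
      by (simp only:)
    also have "\<dots> = q - (1 / real d) *\<^sub>R (p - q + real 1 *\<^sub>R r)" using d by (simp only: scaleR_diff_right) simp
    finally show ?thesis .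
  qed
  also have "\<dots> \<in> lattice" using t by (intro lattice_diff) (auto simp: face_point_def)
  finally have W: "(1 / real d) *\<^sub>R ((-1) *\<^sub>R p + real (d + 1) *\<^sub>R q + (-1) *\<^sub>R r) \<in> lattice" .
  have "0 < (-1) + real (d + 1) + (-1)" "(-1) + real (d + 1) + (-1) < real d" using d by simp_all
  then obtain i where i: "(-1) * (B $ i \<bullet> p) + real (d + 1) * (B $ i \<bullet> q) + (-1) * (B $ i \<bullet> r) < 0"
    by (rule row_negative[OF t(1-3) W])
  have "i \<noteq> \<rho>"
  proof
    assume e: "i = \<rho>"
    have "B $ \<rho> \<bullet> q \<le> real (d + 1) * (B $ \<rho> \<bullet> q)"
      using pp(2)[of \<rho>] mult_right_mono[of 1 "real (d + 1)" "B $ \<rho> \<bullet> q"] by simp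
    moreover have "B $ \<rho> \<bullet> r < B $ \<rho> \<bullet> q - B $ \<rho> \<bullet> p" using ro by (simp add: rows_def)
    ultimately show False using i[unfolded e] pp[of \<rho>] by linarith
  qed
  then have "i = \<sigma> \<or> i = \<tau>" using third_index[of \<rho> \<sigma> \<tau> i] ro by (auto simp: rows_def)
  then show ?thesis using i by auto
qed

text \<open>Eliminating x gives d y < z. With d \<ge> 4 this is a factor 4, which leaves a factor 2
  after one doubling in a slide.\<close>

lemma hold_bound:
  fixes x y z :: real
  assumes h: "real (d + 1) * y < x + z" and b: "real (d - 1) * x + y < z" "0 < x" "0 < y"
  shows "real d * y < z" "4 * y < z" "2 * x < z"
proof -
  have d1: "real (d - 1) = real d - 1" "real d \<ge> 4" using d by auto
  have "(real d - 1) * (real (d + 1) * y) < (real d - 1) * (x + z)" using h d1 by (intro mult_strict_left_mono) auto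
  also have "\<dots> = (real d - 1) * x + (real d - 1) * z" by (simp add: distrib_left)
  also have "\<dots> < z - y + (real d - 1) * z" using b d1 by simp
  finally have "real d * (real d * y) < real d * z" by (simp add: algebra_simps)
  then show dy: "real d * y < z" using d1 by simp
  have "4 * y \<le> real d * y" using d1 b by (intro mult_right_mono) auto
  then show "4 * y < z" using dy by linarith
  have "3 * x \<le> real (d - 1) * x" using d1 b by (intro mult_right_mono) auto
  then show "2 * x < z" using b by linarith
qed

text \<open>If the extra inequality also holds in row \<sigma>, the given triple is good. Otherwise
  slide in the direction in which row \<tau> does not fall, and exclude row \<sigma> as the carrier
  of the extra inequality. Towards q, it would drop by a factor 4 and the walk would leave the cone
  one step too early. Towards p, its failure at the start is inherited along the line.\<close>

lemma end_case_hold: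
  assumes tr: "triple p q r 1 l \<alpha> \<beta>" and ro: "rows p q r 1 l \<alpha> \<beta> \<rho> \<sigma> \<tau>"
    and hold: "real (d + 1) * (B $ \<tau> \<bullet> q) < B $ \<tau> \<bullet> p + B $ \<tau> \<bullet> r"
  shows "solution \<bar>det (cols p q r)\<bar>"
proof -
  note t1 = triple_1[OF tr]
  have zb: "real d * (B $ \<tau> \<bullet> q') < B $ \<tau> \<bullet> r \<and> 4 * (B $ \<tau> \<bullet> q') < B $ \<tau> \<bullet> r \<and> 2 * (B $ \<tau> \<bullet> p') < B $ \<tau> \<bullet> r"
    if "triple p' q' r 1 l \<alpha> \<beta>" "rows p' q' r 1 l \<alpha> \<beta> \<rho> \<sigma> \<tau>"
      "real (d + 1) * (B $ \<tau> \<bullet> q') < B $ \<tau> \<bullet> p' + B $ \<tau> \<bullet> r" for p' q'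
  proof -
    have "0 < B $ \<tau> \<bullet> p'" "0 < B $ \<tau> \<bullet> q'" using that(1) face_point_pos by (auto simp: triple_def)
    moreover have "real (d - 1) * (B $ \<tau> \<bullet> p') + B $ \<tau> \<bullet> q' < B $ \<tau> \<bullet> r"
      using that(2) t1 by (simp add: rows_def)
    ultimately show ?thesis using hold_bound[OF that(3)] by blast
  qed
  have yb: "4 * (B $ \<sigma> \<bullet> q') < B $ \<sigma> \<bullet> p'"
    if "triple p' q' r 1 l \<alpha> \<beta>" "rows p' q' r 1 l \<alpha> \<beta> \<rho> \<sigma> \<tau>"
      "real (d + 1) * (B $ \<sigma> \<bullet> q') < B $ \<sigma> \<bullet> p' + B $ \<sigma> \<bullet> r" for p' q'
  proof -
    have "0 < B $ \<sigma> \<bullet> r" "0 < B $ \<sigma> \<bullet> q'" using that(1) face_point_pos by (auto simp: triple_def)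
    moreover have "real (d - 1) * (B $ \<sigma> \<bullet> r) + B $ \<sigma> \<bullet> q' < B $ \<sigma> \<bullet> p'"
      using that(2) t1 by (simp add: rows_def)
    moreover have "real (d + 1) * (B $ \<sigma> \<bullet> q') < B $ \<sigma> \<bullet> r + B $ \<sigma> \<bullet> p'" using that(3) by linarith
    ultimately show ?thesis using hold_bound by blast
  qed
  have qpos: "0 < B $ i \<bullet> q'" "0 < B $ i \<bullet> p'" if "triple p' q' r 1 l \<alpha> \<beta>" for p' q' i
    using that face_point_pos by (auto simp: triple_def)
  show ?thesis
  proof (cases "real (d + 1) * (B $ \<sigma> \<bullet> q) < B $ \<sigma> \<bullet> p + B $ \<sigma> \<bullet> r")
    case True
    have "2 * (B $ \<tau> \<bullet> q) < B $ \<tau> \<bullet> r" "2 * (B $ \<sigma> \<bullet> q) < B $ \<sigma> \<bullet> p"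
      using zb[OF tr ro hold] yb[OF tr ro True] qpos[OF tr, of \<tau>] qpos[OF tr, of \<sigma>] by linarith+
    then have "good p q r 1 l \<alpha> \<beta> \<rho> \<sigma> \<tau>"
      using tr ro zb[OF tr ro hold] unfolding good_def by blast
    then show ?thesis unfolding solution_def by blast
  next
    case y_fails: False
    show ?thesis
    proof (cases "B $ \<tau> \<bullet> p \<le> B $ \<tau> \<bullet> q")
      case True
      define s where "s = (\<lambda>j::nat. p + real j *\<^sub>R (q - p))"
      have s: "s j = p + real j *\<^sub>R (q - p)" for j by (simp add: s_def)
      obtain n where n: "\<And>j. j \<le> n + 1 \<Longrightarrow> s j \<in> cone_of B" "2 * (B $ \<sigma> \<bullet> s (n + 1)) < B $ \<sigma> \<bullet> s n"
        using slide[OF tr ro s True] by metis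
      have tr': "triple (s j) (s (j + 1)) r 1 l \<alpha> \<beta>" and ro': "rows (s j) (s (j + 1)) r 1 l \<alpha> \<beta> \<rho> \<sigma> \<tau>" if "j \<le> n" for j
        using triple_along_row[OF tr ro s] n(1) that by auto
      have "2 * (B $ \<tau> \<bullet> s n) < B $ \<tau> \<bullet> r \<and> 2 * (B $ \<tau> \<bullet> s (n + 1)) < B $ \<tau> \<bullet> r"
      proof (cases n)
        case 0
        then show ?thesis using zb[OF tr ro hold] qpos[OF tr, of \<tau>] by (simp add: s)
      next
        case (Suc n')
        note tr1 = tr'[of n'] and ro1 = ro'[of n']
        \<comment> \<open>The extra inequality is used one pair before the end: the factor 4
          obtained there survives this extrapolation as a factor 2.\<close>
        have step: "B $ i \<bullet> s (n + 1) = 2 * (B $ i \<bullet> s (n' + 1)) - B $ i \<bullet> s n'" for i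
          by (simp add: s Suc inner_add_right inner_diff_right algebra_simps)
        have "0 < B $ \<sigma> \<bullet> s (n + 1)" using qpos[OF tr'[of n]] by simp
        then have "\<not> 4 * (B $ \<sigma> \<bullet> s (n' + 1)) < B $ \<sigma> \<bullet> s n'"
          using step[of \<sigma>] qpos[OF tr1, of \<sigma>] Suc by simp
        then have "\<not> real (d + 1) * (B $ \<sigma> \<bullet> s (n' + 1)) < B $ \<sigma> \<bullet> s n' + B $ \<sigma> \<bullet> r"
          using yb[OF tr1 ro1] Suc by auto
        then have "real (d + 1) * (B $ \<tau> \<bullet> s (n' + 1)) < B $ \<tau> \<bullet> s n' + B $ \<tau> \<bullet> r"
          using extra_row[OF tr1 ro1] Suc by auto
        from zb[OF tr1 ro1 this] have "4 * (B $ \<tau> \<bullet> s (n' + 1)) < B $ \<tau> \<bullet> r" using Suc by auto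
        then show ?thesis using step[of \<tau>] qpos[OF tr1, of \<tau>] Suc by simp
      qed
      then have "good (s n) (s (n + 1)) r 1 l \<alpha> \<beta> \<rho> \<sigma> \<tau>"
        using tr'[of n] ro'[of n] n(2) unfolding good_def by blast
      then show ?thesis using det_slide[OF s, of n r] unfolding solution_def by metis
    next
      case False
      define s where "s = (\<lambda>j::nat. q + real j *\<^sub>R (p - q))"
      have s: "s j = q + real j *\<^sub>R (p - q)" for j by (simp add: s_def)
      have le: "B $ \<tau> \<bullet> q \<le> B $ \<tau> \<bullet> p" using False by simp
      obtain n where n: "\<And>j. j \<le> n + 1 \<Longrightarrow> s j \<in> cone_of B" "2 * (B $ \<rho> \<bullet> s (n + 1)) < B $ \<rho> \<bullet> s n"
        using slide[OF triple_swap[OF tr] rows_swap[OF ro] s le] by metis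
      have tr': "triple (s (n + 1)) (s n) r 1 l \<alpha> \<beta>" and ro': "rows (s (n + 1)) (s n) r 1 l \<alpha> \<beta> \<rho> \<sigma> \<tau>"
        using triple_along_row[OF triple_swap[OF tr] rows_swap[OF ro] s, of n] n(1) triple_swap rows_swap by auto
      have "\<not> real (d + 1) * (B $ \<sigma> \<bullet> s n) < B $ \<sigma> \<bullet> s (n + 1) + B $ \<sigma> \<bullet> r"
      proof -
        have "0 < real l * (B $ \<sigma> \<bullet> r)" using tr face_point_pos by (auto simp: triple_def)
        then have "B $ \<sigma> \<bullet> q < B $ \<sigma> \<bullet> p" using ro by (simp add: rows_def)
        then have "0 \<le> real d * (real n * (B $ \<sigma> \<bullet> p - B $ \<sigma> \<bullet> q))" by simp
        moreover have "real (d + 1) * (B $ \<sigma> \<bullet> s n) - B $ \<sigma> \<bullet> s (n + 1)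
          = real (d + 1) * (B $ \<sigma> \<bullet> q) - B $ \<sigma> \<bullet> p + real d * (real n * (B $ \<sigma> \<bullet> p - B $ \<sigma> \<bullet> q))"
          by (simp add: s inner_add_right inner_diff_right algebra_simps)
        ultimately show ?thesis using y_fails by linarith
      qed
      then have "real (d + 1) * (B $ \<tau> \<bullet> s n) < B $ \<tau> \<bullet> s (n + 1) + B $ \<tau> \<bullet> r"
        using extra_row[OF tr' ro'] by blast
      note z = zb[OF tr' ro' this]
      then have "2 * (B $ \<tau> \<bullet> s n) < B $ \<tau> \<bullet> r" using qpos[OF tr', of \<tau>] by linarith
      then have "good (s (n + 1)) (s n) r 1 l \<alpha> \<beta> \<rho> \<sigma> \<tau>"
        using tr' ro' n(2) z unfolding good_def by blast
      moreover have "\<bar>det (cols (s (n + 1)) (s n) r)\<bar> = \<bar>det (cols p q r)\<bar>"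
        using det_slide[OF s, of n r] det_cols_swap(1)[of "s (n + 1)" "s n" r] det_cols_swap(1)[of q p r] by simp
      ultimately show ?thesis unfolding solution_def by blast
    qed
  qed
qed

text \<open>For k = 1 the lattice condition and row \<rho> are symmetric in p and r, and exchanging
  these points exchanges the roles of \<sigma> and \<tau>. So it suffices that the extra inequality
  holds in row \<tau>.\<close>

lemma end_case:
  assumes tr: "triple p q r 1 l \<alpha> \<beta>"
  shows "solution \<bar>det (cols p q r)\<bar>"
proof -
  obtain \<rho> \<sigma> \<tau> where ro: "rows p q r 1 l \<alpha> \<beta> \<rho> \<sigma> \<tau>" using triple_rows[OF tr] .
  note t1 = triple_1[OF tr]
  from extra_row[OF tr ro] show ?thesis
  proof
    assume "real (d + 1) * (B $ \<tau> \<bullet> q) < B $ \<tau> \<bullet> p + B $ \<tau> \<bullet> r"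
    then show ?thesis by (rule end_case_hold[OF tr ro])
  next
    assume h: "real (d + 1) * (B $ \<sigma> \<bullet> q) < B $ \<sigma> \<bullet> p + B $ \<sigma> \<bullet> r"
    have "triple r q p 1 l \<alpha> \<beta>" using tr by (simp add: triple_def algebra_simps)
    moreover have "rows r q p 1 l \<alpha> \<beta> \<rho> \<tau> \<sigma>"
      using ro t1 by (auto simp: rows_def)
    moreover have "real (d + 1) * (B $ \<sigma> \<bullet> q) < B $ \<sigma> \<bullet> r + B $ \<sigma> \<bullet> p" using h by linarith
    ultimately have "solution \<bar>det (cols r q p)\<bar>" by (rule end_case_hold)
    then show ?thesis using det_cols_swap(2)[of r q p] by simp
  qed
qed

lemma oriented_good_triple:
  assumes tr: "triple p q r k l \<alpha> \<beta>" and D: "\<bar>det (cols p q r)\<bar> = real d"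
  obtains p q r k l \<alpha> \<beta> \<rho> \<sigma> \<tau> where "good p q r k l \<alpha> \<beta> \<rho> \<sigma> \<tau>" "det (cols p q r) = real d"
proof -
  have "solution (real d)"
  proof -
    consider "k = 1" | "l = 1" | "2 \<le> k" "2 \<le> l" using tr by (auto simp: triple_def) linarith
    then show ?thesis
    proof cases
      case 1
      then show ?thesis using end_case tr D by metis
    next
      case 2
      then show ?thesis using end_case[of q p r k \<beta> \<alpha>] triple_swap[OF tr] D det_cols_swap(1)[of q p r] by simp
    next
      case 3
      then show ?thesis using middle[OF tr] D by simp
    qed
  qed
  then obtain p q r k l \<alpha> \<beta> \<rho> \<sigma> \<tau> where g: "good p q r k l \<alpha> \<beta> \<rho> \<sigma> \<tau>" "\<bar>det (cols p q r)\<bar> = real d"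
    unfolding solution_def by blast
  show ?thesis
  proof (cases "det (cols p q r) \<ge> 0")
    case True
    then show ?thesis using that[OF g(1)] g(2) by simp
  next
    case False
    then show ?thesis using that[OF good_swap[OF g(1)]] g(2) False det_cols_swap(1)[of q p r] by simp
  qed
qed

end

section \<open>From emptiness to White's normal form\<close>

context empty_cone
begin

text \<open>Multiplication by a permutes the nonzero residues, so some k has k a = 1 modulo d. The
  lattice point of index k then has residues 1, d - 1, k; subtracting q gives the normal form with
  \<alpha> = a.\<close>

lemma triple_of_residues:
  assumes fp: "face_point p" "face_point q" "face_point r" and ab: "a + b = d" "0 < a" "0 < b"
    and nz: "\<And>n. 0 < n \<Longrightarrow> n < d \<Longrightarrow> n * a mod d \<noteq> 0"
    and res: "\<And>n. 0 < n \<Longrightarrow> n < d \<Longrightarrow> n * a mod d + n * b mod d + n * 1 mod d = n + d"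
    and lat: "\<And>n. (1 / real d) *\<^sub>R (real (n * a mod d) *\<^sub>R p + real (n * b mod d) *\<^sub>R q + real (n * 1 mod d) *\<^sub>R r) \<in> lattice"
  obtains k l where "triple p q r k l a b"
proof -
  have "inj_on (\<lambda>n. n * a mod d) {1..<d}"
  proof (rule linorder_inj_onI)
    fix x y assume xy: "x < y" "x \<in> {1..<d}" "y \<in> {1..<d}"
    show "x * a mod d \<noteq> y * a mod d"
    proof
      assume "x * a mod d = y * a mod d"
      then have "d dvd y * a - x * a" using xy by (metis mod_eq_dvd_iff_nat mult_le_mono1 less_imp_le)
      then have "(y - x) * a mod d = 0" by (simp add: diff_mult_distrib)
      moreover have "0 < y - x" "y - x < d" using xy by auto
      ultimately show False using nz[of "y - x"] by simp
    qed
  qed auto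
  moreover have "(\<lambda>n. n * a mod d) ` {1..<d} \<subseteq> {1..<d}"
    using nz d by (auto simp: Suc_le_eq)
  ultimately have "(\<lambda>n. n * a mod d) ` {1..<d} = {1..<d}" by (intro endo_inj_surj) auto
  then have "1 \<in> (\<lambda>n. n * a mod d) ` {1..<d}" using d by auto
  then obtain k where "k \<in> {1..<d}" "1 = k * a mod d" by blast
  then have k: "0 < k" "k < d" "k * a mod d = 1" by simp_all
  have kb: "k * b mod d = d - 1" using res[OF k(1,2)] k d by simp
  have "(1 / real d) *\<^sub>R (p - q + real k *\<^sub>R r)
    = (1 / real d) *\<^sub>R (real (k * a mod d) *\<^sub>R p + real (k * b mod d) *\<^sub>R q + real (k * 1 mod d) *\<^sub>R r) - q"
  proof -
    have d1: "real (d - 1) = real d - 1" using d by simp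
    have "real (k * a mod d) *\<^sub>R p + real (k * b mod d) *\<^sub>R q + real (k * 1 mod d) *\<^sub>R r
      = (p - q + real k *\<^sub>R r) + real d *\<^sub>R q"
      unfolding k(3) kb d1 using k by (simp add: algebra_simps)
    then show ?thesis using d by (simp only: scaleR_add_right) simp
  qed
  also have "\<dots> \<in> lattice" using lat fp by (intro lattice_diff) (auto simp: face_point_def)
  finally have "triple p q r k (d - k) a b" using fp ab k by (simp add: triple_def)
  then show ?thesis by (rule that)
qed

text \<open>Reducing the coordinates of n v modulo integral combinations of p, q, r gives a lattice
  point \<open>Y n\<close> of the cone at level S n / d. Emptiness and S n = n modulo d force S n
  \<ge> d + n. The residues for n and d - n add up to at most d in each coordinate, so S n + S (d -
  n) is at most 3 d. Hence equality holds throughout and no residue is 0, as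
  \<open>white_residues\<close> requires.\<close>

lemma white_triple:
  assumes fp: "face_point p" "face_point q" "face_point r" and det: "det (cols p q r) = real d"
    and v: "v \<in> lattice" "m \<bullet> v = 1 / real d"
  obtains p' q' r' k l \<alpha> \<beta> where "triple p' q' r' k l \<alpha> \<beta>" "\<bar>det (cols p' q' r')\<bar> = real d"
proof -
  have L: "p \<in> lattice" "q \<in> lattice" "r \<in> lattice" and m1: "m \<bullet> p = 1" "m \<bullet> q = 1" "m \<bullet> r = 1"
    using fp by (auto simp: face_point_def)
  have d0: "real d > 0" "d > 0" using d by auto
  obtain A where A: "det (cols v q r) = of_int A" using det_cols_lattice[OF v(1) L(2,3)] by (auto elim: Ints_cases)
  obtain B' where B': "det (cols p v r) = of_int B'" using det_cols_lattice[OF L(1) v(1) L(3)] by (auto elim: Ints_cases)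
  obtain C where C: "det (cols p q v) = of_int C" using det_cols_lattice[OF L(1,2) v(1)] by (auto elim: Ints_cases)
  have dv: "real d *\<^sub>R v = of_int A *\<^sub>R p + of_int B' *\<^sub>R q + of_int C *\<^sub>R r"
    using cramer_cols[OF det[symmetric], of v] d0 by (simp add: A B' C)
  have "m \<bullet> (real d *\<^sub>R v) = m \<bullet> (of_int A *\<^sub>R p + of_int B' *\<^sub>R q + of_int C *\<^sub>R r)" by (simp only: dv)
  then have "1 = of_int A + of_int B' + (of_int C :: real)" using v(2) d0 by (simp add: inner_add_right m1)
  then have ABC: "A + B' + C = 1" by linarith
  define a where "a = nat (A mod int d)"
  define b where "b = nat (B' mod int d)"
  define c where "c = nat (C mod int d)"
  have ia: "int a = A mod int d" "int b = B' mod int d" "int c = C mod int d"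
    using d0 by (simp_all add: a_def b_def c_def)
  have red: "\<exists>t. int (n * x mod d) = int n * X - int d * t" if "int x = X mod int d" for n x X
  proof -
    have "int (n * x mod d) = int n * X mod int d" using that by (simp add: zmod_int mod_mult_right_eq)
    then show ?thesis by (metis minus_div_mult_eq_mod mult.commute)
  qed
  define Y where "Y = (\<lambda>n. (1 / real d) *\<^sub>R (real (n * a mod d) *\<^sub>R p + real (n * b mod d) *\<^sub>R q + real (n * c mod d) *\<^sub>R r))"
  have Yl: "Y n \<in> lattice" for n
  proof -
    obtain ta where ta: "int (n * a mod d) = int n * A - int d * ta" using red[OF ia(1)] by blast
    obtain tb where tb: "int (n * b mod d) = int n * B' - int d * tb" using red[OF ia(2)] by blast
    obtain tc where tc: "int (n * c mod d) = int n * C - int d * tc" using red[OF ia(3)] by blast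
    have R: "real (n * a mod d) = real n * of_int A - real d * of_int ta"
      "real (n * b mod d) = real n * of_int B' - real d * of_int tb"
      "real (n * c mod d) = real n * of_int C - real d * of_int tc"
      using arg_cong[OF ta, of real_of_int] arg_cong[OF tb, of real_of_int] arg_cong[OF tc, of real_of_int] by simp_all
    have "real (n * a mod d) *\<^sub>R p + real (n * b mod d) *\<^sub>R q + real (n * c mod d) *\<^sub>R r
      = real n *\<^sub>R (of_int A *\<^sub>R p + of_int B' *\<^sub>R q + of_int C *\<^sub>R r)
        - real d *\<^sub>R (of_int ta *\<^sub>R p + of_int tb *\<^sub>R q + of_int tc *\<^sub>R r)"
      unfolding R by (simp add: algebra_simps)
    also have "\<dots> = real d *\<^sub>R (real n *\<^sub>R v - (of_int ta *\<^sub>R p + of_int tb *\<^sub>R q + of_int tc *\<^sub>R r))"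
      unfolding dv[symmetric] by (simp add: algebra_simps)
    finally have "Y n = real n *\<^sub>R v - (of_int ta *\<^sub>R p + of_int tb *\<^sub>R q + of_int tc *\<^sub>R r)"
      using d0 by (simp add: Y_def)
    then show ?thesis using v L by (auto intro!: lattice_diff lattice_add lattice_scale)
  qed
  define S where "S = (\<lambda>n. n * a mod d + n * b mod d + n * c mod d)"
  have Smod: "S n mod d = n mod d" for n
  proof -
    have sum3: "(x mod e + y mod e + z mod e) mod e = (x + y + z) mod e" for x y z e :: int
      by (metis mod_add_eq mod_mod_trivial)
    have "int (S n) = int n * A mod int d + int n * B' mod int d + int n * C mod int d"
      unfolding S_def by (simp add: zmod_int ia mod_mult_right_eq)
    then have "int (S n) mod int d = (int n * A + int n * B' + int n * C) mod int d"
      by (simp only: sum3)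
    also have "int n * A + int n * B' + int n * C = int n * (A + B' + C)" by (simp add: distrib_left)
    finally show ?thesis by (simp add: ABC flip: zmod_int)
  qed
  have Sge: "d + n \<le> S n" if n: "0 < n" "n < d" for n
  proof -
    have "m \<bullet> Y n = real (S n) / real d" by (simp add: Y_def S_def inner_add_right m1)
    moreover have "S n > 0" using Smod[of n] n by (intro gr0I) auto
    ultimately have "Y n \<noteq> 0" using d0 by auto
    moreover have "Y n \<in> cone_of B"
      using fp by (simp add: Y_def cone_of_row inner_add_right face_point_def)
    ultimately have "1 \<le> real (S n) / real d" using empty[OF Yl] \<open>m \<bullet> Y n = _\<close> by metis
    then have "d \<le> S n" using d0 by simp
    then have "1 \<le> S n div d" using d0 by (simp add: Suc_le_eq div_greater_zero_iff)
    then have "d * 1 \<le> d * (S n div d)" by (rule mult_le_mono2)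
    moreover have "S n = d * (S n div d) + n" using Smod[of n] n by (metis mod_less mult_div_mod_eq)
    ultimately show ?thesis by linarith
  qed
  have pair: "n * x mod d + (d - n) * x mod d \<le> d \<and> (n * x mod d = 0 \<longrightarrow> n * x mod d + (d - n) * x mod d < d)"
    if n: "0 < n" "n < d" for n x
  proof -
    have "(n * x mod d + (d - n) * x mod d) mod d = (n * x + (d - n) * x) mod d" by (simp add: mod_add_eq)
    also have "n * x + (d - n) * x = d * x" using n by (simp add: distrib_right[symmetric])
    finally have "(n * x mod d + (d - n) * x mod d) mod d = 0" by simp
    moreover have "n * x mod d < d" "(d - n) * x mod d < d" using d0 by auto
    ultimately show ?thesis
      by (smt (verit, best) add_less_mono le_mod_geq mod_less not_le_imp_less add_0 less_diff_conv2 linorder_not_less order_less_imp_le diff_is_0_eq)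
  qed
  have exact: "S n = n + d \<and> n * a mod d \<noteq> 0 \<and> n * b mod d \<noteq> 0 \<and> n * c mod d \<noteq> 0" if n: "0 < n" "n < d" for n
  proof -
    have "d + n \<le> S n" "d + (d - n) \<le> S (d - n)" using Sge[OF n] Sge[of "d - n"] n by auto
    then show ?thesis using pair[OF n, of a] pair[OF n, of b] pair[OF n, of c] n unfolding S_def by linarith
  qed
  have abc: "0 < a" "a < d" "0 < b" "b < d" "0 < c" "c < d" "a + b + c = d + 1"
  proof -
    show l: "a < d" "b < d" "c < d" using ia d0 by (metis of_nat_less_iff pos_mod_bound of_nat_0_less_iff)+
    show "0 < a" "0 < b" "0 < c" "a + b + c = d + 1"
      using exact[of 1] d l by (auto simp: S_def)
  qed
  have "a = 1 \<or> b = 1 \<or> c = 1"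
    using exact unfolding S_def by (intro white_residues[OF abc]) auto
  then consider "c = 1" | "a = 1" | "b = 1" by blast
  then show ?thesis
  proof cases
    case 1
    then obtain k l where "triple p q r k l a b"
      using triple_of_residues[OF fp, of a b] abc exact Yl by (auto simp: S_def Y_def)
    then show ?thesis using that det by simp
  next
    case 2
    have "(1 / real d) *\<^sub>R (real (n * b mod d) *\<^sub>R q + real (n * c mod d) *\<^sub>R r + real (n * 1 mod d) *\<^sub>R p) \<in> lattice" for n
      using Yl[of n] 2 by (simp add: Y_def add_ac)
    note lat = this
    have res: "n * b mod d + n * c mod d + n * 1 mod d = n + d" if "0 < n" "n < d" for n
      using exact[OF that] 2 by (simp add: S_def)
    have "\<exists>k l. triple q r p k l b c"
      by (rule triple_of_residues[OF fp(2,3,1) _ _ _ _ res lat]) (use abc exact 2 in auto)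
    then obtain k l where "triple q r p k l b c" by blast
    moreover have "det (cols q r p) = det (cols p q r)" by (simp add: det_cols)
    ultimately show ?thesis using that det by simp
  next
    case 3
    have "(1 / real d) *\<^sub>R (real (n * c mod d) *\<^sub>R r + real (n * a mod d) *\<^sub>R p + real (n * 1 mod d) *\<^sub>R q) \<in> lattice" for n
      using Yl[of n] 3 by (simp add: Y_def add_ac)
    note lat = this
    have res: "n * c mod d + n * a mod d + n * 1 mod d = n + d" if "0 < n" "n < d" for n
      using exact[OF that] 3 by (simp add: S_def)
    have "\<exists>k l. triple r p q k l c a"
      by (rule triple_of_residues[OF fp(3,1,2) _ _ _ _ res lat]) (use abc exact 3 in auto)
    then obtain k l where "triple r p q k l c a" by blast
    moreover have "det (cols r p q) = det (cols p q r)" by (simp add: det_cols)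
    ultimately show ?thesis using that det by simp
  qed
qed

end

text \<open>The columns of \<open>N\<close> are the points \<open>p, q, r\<close> of \<open>triple\<close> in coordinates along the rays of the
  cone; \<open>white_mat\<close> expresses them in a lattice basis.\<close>

definition white_open :: "nat \<Rightarrow> nat \<Rightarrow> nat \<Rightarrow> (real^3^3) set" where
  "white_open k l \<alpha> = {N. (\<forall>i j. 0 < N $ i $ j) \<and>
    real l * N $ 1 $ 3 < N $ 1 $ 1 - N $ 1 $ 2 \<and>
    real k * N $ 2 $ 3 < N $ 2 $ 2 - N $ 2 $ 1 \<and>
    (real (k + l) - real \<alpha>) * N $ 3 $ 1 + real \<alpha> * N $ 3 $ 2 < N $ 3 $ 3 \<and>
    2 * N $ 3 $ 1 < N $ 3 $ 3 \<and> 2 * N $ 3 $ 2 < N $ 3 $ 3 \<and>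
    (2 * N $ 2 $ 1 < N $ 2 $ 2 \<or> 2 * N $ 1 $ 2 < N $ 1 $ 1)}"

definition white_mat :: "nat \<Rightarrow> nat \<Rightarrow> real^3^3" where
  "white_mat k l = cols (vector [real (k + l), 1, - real k]) (axis 2 1) (axis 3 1)"

definition white_cell :: "nat \<Rightarrow> nat \<Rightarrow> nat \<Rightarrow> (real^3) set set" where
  "white_cell k l \<alpha> = act (white_mat k l) ` cone_of ` white_open k l \<alpha>"

lemma det_white_mat: "det (white_mat k l) = real (k + l)"
  by (simp add: white_mat_def det_cols axis_def)

text \<open>The vectors V = (p - q + k r) / d, q, r have determinant 1 and form a lattice basis. In
  it p = d V + q - k r is the first column of \<open>white_mat\<close>, and \<open>m\<close> has the
  coordinates k/d, 1, 1.\<close>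

lemma white_cover:
  assumes gen: "generic_cone C" and C: "C = cone_of B" "det B > 0"
    and f: "f = {x \<in> C \<inter> lattice. m \<bullet> x = 1}" and m: "\<And>x. x \<in> C \<inter> lattice \<Longrightarrow> x \<noteq> 0 \<Longrightarrow> 1 \<le> m \<bullet> x"
    and pqr: "p \<in> f" "q \<in> f" "r \<in> f" "det (cols p q r) = real d"
    and v: "v \<in> lattice" "m \<bullet> v = 1 / real d" and d: "4 \<le> d"
  obtains k l \<alpha> \<gamma> where "0 < k" "0 < l" "\<alpha> < k + l" "4 \<le> k + l" "k * \<alpha> mod (k + l) = 1" "\<gamma> \<in> SL3Z"
    "act \<gamma> f \<subseteq> {x. vector [real k / real (k + l), 1, 1] \<bullet> x = 1}" "act \<gamma> C \<in> white_cell k l \<alpha>"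
proof -
  interpret empty_cone B m d
  proof
    show "0 < B $ i \<bullet> x" if "x \<in> lattice" "x \<noteq> 0" "x \<in> cone_of B" for x i
      using generic_row_nonzero[OF gen[unfolded C(1)] C(2) that(1,2), of i] that(3) by (auto simp: cone_of_row less_le)
    show "1 \<le> m \<bullet> x" if "x \<in> lattice" "x \<noteq> 0" "x \<in> cone_of B" for x using m that C(1) by blast
  qed (rule d)
  have fp: "face_point x \<longleftrightarrow> x \<in> f" for x by (auto simp: face_point_def f C(1))
  obtain p q r k l \<alpha> \<beta> where "triple p q r k l \<alpha> \<beta>" "\<bar>det (cols p q r)\<bar> = real d"
    using white_triple[of p q r v] pqr v fp by metis
  then obtain p q r k l \<alpha> \<beta> \<rho> \<sigma> \<tau> where g: "good p q r k l \<alpha> \<beta> \<rho> \<sigma> \<tau>" and D: "det (cols p q r) = real d"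
    by (rule oriented_good_triple)
  have tr: "triple p q r k l \<alpha> \<beta>" and ro: "rows p q r k l \<alpha> \<beta> \<rho> \<sigma> \<tau>" using g by (auto simp: good_def)
  have t: "face_point p" "face_point q" "face_point r" "k + l = d" "\<alpha> + \<beta> = d" "0 < k" "0 < l" "0 < \<alpha>" "0 < \<beta>"
    "k * \<alpha> mod d = 1" "(1 / real d) *\<^sub>R (p - q + real k *\<^sub>R r) \<in> lattice"
    using tr by (auto simp: triple_def)
  have pp: "0 < B $ i \<bullet> p" "0 < B $ i \<bullet> q" "0 < B $ i \<bullet> r" for i using t(1-3) face_point_pos by auto
  define V where "V = (1 / real d) *\<^sub>R (p - q + real k *\<^sub>R r)"
  define M where "M = cols V q r"
  have dV: "real d *\<^sub>R V = p - q + real k *\<^sub>R r" using d by (simp add: V_def)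
  have "det (cols (real d *\<^sub>R V) q r) = real d * det M" by (simp add: M_def det_cols algebra_simps)
  moreover have "det (cols (real d *\<^sub>R V) q r) = det (cols p q r)" unfolding dV by (simp add: det_cols algebra_simps)
  ultimately have "det M = 1" using D d by simp
  then have "M \<in> SL3Z" unfolding M_def using t by (intro cols_SL3Z) (auto simp: V_def face_point_def)
  then obtain \<gamma> where \<gamma>: "\<gamma> \<in> SL3Z" "M ** \<gamma> = mat 1" "\<gamma> ** M = mat 1" using SL3Z_inverse by metis
  have mpqr: "m \<bullet> p = 1" "m \<bullet> q = 1" "m \<bullet> r = 1" using t by (auto simp: face_point_def)
  have mV: "m \<bullet> V = real k / real d" by (simp add: V_def inner_add_right inner_diff_right mpqr)
  have plane: "act \<gamma> f \<subseteq> {x. vector [real k / real (k + l), 1, 1] \<bullet> x = 1}"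
  proof
    fix y assume "y \<in> act \<gamma> f"
    then obtain x where x: "x \<in> f" "y = \<gamma> *v x" by (auto simp: act_def)
    have "x = M *v y" by (simp add: x matrix_vector_mul_assoc \<gamma>)
    then have "m \<bullet> x = y $ 1 * (real k / real d) + y $ 2 + y $ 3"
      by (simp add: M_def cols_mult_vec inner_add_right mV mpqr)
    moreover have "m \<bullet> x = 1" using x f by auto
    ultimately show "y \<in> {x. vector [real k / real (k + l), 1, 1] \<bullet> x = 1}"
      using t(4) by (simp add: inner_vec_def sum_3 mult.commute)
  qed
  define Q where "Q = B ** cols p q r"
  have Qrow: "Q $ i $ 1 = B $ i \<bullet> p" "Q $ i $ 2 = B $ i \<bullet> q" "Q $ i $ 3 = B $ i \<bullet> r" for i
  proof -
    have "Q = cols (B *v p) (B *v q) (B *v r)" by (simp only: Q_def matrix_mult_cols)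
    then show "Q $ i $ 1 = B $ i \<bullet> p" "Q $ i $ 2 = B $ i \<bullet> q" "Q $ i $ 3 = B $ i \<bullet> r"
      by (simp_all add: cols_def matrix_vector_mul_component)
  qed
  \<comment> \<open>The order \<sigma>, \<rho>, \<tau> places the dominant entry of each row on the
    diagonal; the cone does not depend on the order.\<close>
  define N :: "real^3^3" where "N = (\<chi> i. if i = 1 then Q $ \<sigma> else if i = 2 then Q $ \<rho> else Q $ \<tau>)"
  have N: "N $ 1 = Q $ \<sigma>" "N $ 2 = Q $ \<rho>" "N $ 3 = Q $ \<tau>" by (simp_all add: N_def)
  have ne: "\<rho> \<noteq> \<sigma>" "\<rho> \<noteq> \<tau>" "\<sigma> \<noteq> \<tau>" using ro by (auto simp: rows_def)
  have all: "(\<forall>i. P i) \<longleftrightarrow> P \<sigma> \<and> P \<rho> \<and> P \<tau>" for P using third_index[OF ne] by metis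
  have "cone_of N = {x. 0 \<le> Q $ \<sigma> \<bullet> x \<and> 0 \<le> Q $ \<rho> \<bullet> x \<and> 0 \<le> Q $ \<tau> \<bullet> x}"
    unfolding cone_of_row forall_3 N ..
  moreover have "cone_of Q = {x. 0 \<le> Q $ \<sigma> \<bullet> x \<and> 0 \<le> Q $ \<rho> \<bullet> x \<and> 0 \<le> Q $ \<tau> \<bullet> x}"
    unfolding cone_of_row all ..
  ultimately have coneN: "cone_of N = cone_of Q" by simp
  have "N \<in> white_open k l \<alpha>"
  proof -
    have b: "real (k + l) - real \<alpha> = real \<beta>" using t(4,5) by linarith
    show ?thesis unfolding white_open_def mem_Collect_eq b forall_3 N Qrow
      using g ro pp by (auto simp: good_def rows_def)
  qed
  moreover have "act \<gamma> C = act (white_mat k l) (cone_of N)"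
  proof -
    obtain W where W: "white_mat k l ** W = mat 1" "W ** white_mat k l = mat 1"
      using det_pos_inverse[of "white_mat k l"] t by (auto simp: det_white_mat)
    have "M *v vector [real (k + l), 1, - real k] = real d *\<^sub>R V + q - real k *\<^sub>R r"
      by (simp add: M_def cols_mult_vec t(4)[symmetric])
    also have "\<dots> = p" by (simp add: dV)
    finally have "M ** white_mat k l = cols p q r"
      by (simp add: white_mat_def matrix_mult_cols) (simp add: M_def cols_mult_vec axis_def)
    then have Q: "Q = B ** M ** white_mat k l" by (simp add: Q_def matrix_mul_assoc[symmetric])
    have "act (white_mat k l) (cone_of N) = cone_of (Q ** W)" unfolding coneN by (rule act_cone_of[OF W])
    also have "Q ** W = B ** M" unfolding Q by (simp add: matrix_mul_assoc[symmetric] W)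
    also have "cone_of (B ** M) = act \<gamma> C" unfolding C(1) by (rule act_cone_of[OF \<gamma>(3,2), symmetric])
    finally show ?thesis by simp
  qed
  ultimately have "act \<gamma> C \<in> white_cell k l \<alpha>" by (auto simp: white_cell_def)
  then show ?thesis using that[of k l \<alpha> \<gamma>] t d \<gamma>(1) plane by auto
qed

section \<open>Cells at large integer distance\<close>

text \<open>The determinant is at least 1 - y2 x1 - a (1 - y2) - b (1 - x1), and a + b \<le> 3/4
  because k + l \<ge> 4. If x1 < 1/2, this bound is affine in y2 and at least 1/4 at both y2 = 0 and
  y2 = 1. The other case is symmetric.\<close>

lemma white_det_normalized:
  fixes x1 x3 y2 y3 z1 z2 k l :: real
  assumes pos: "0 < x1" "0 < x3" "0 < y2" "0 < y3" "0 < z1" "0 < z2"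
    and kl: "1 \<le> k" "1 \<le> l" "4 \<le> k + l"
    and R: "k * x3 < 1 - x1" and L: "l * y3 < 1 - y2" and z: "2 * z1 < 1" "2 * z2 < 1"
    and or: "2 * x1 < 1 \<or> 2 * y2 < 1"
  shows "1 / 4 \<le> z1 * (y2 * x3 - y3) + z2 * (y3 * x1 - x3) + (1 - y2 * x1)"
proof -
  have kx: "0 < k * x3" and ly: "0 < l * y3" using pos kl by auto
  have u1: "x1 < 1" "y2 < 1" using kx R ly L by linarith+
  define a where "a = 1 / (2 * l)"
  define b where "b = 1 / (2 * k)"
  have a: "a \<le> 1 / 2" and b: "b \<le> 1 / 2" using kl by (simp_all add: a_def b_def field_simps)
  have ab: "a + b \<le> 3 / 4"
  proof (cases "2 \<le> l")
    case True
    then have "a \<le> 1 / 4" by (simp add: a_def field_simps)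
    then show ?thesis using b by linarith
  next
    case False
    then have "b \<le> 1 / 4" using kl by (simp add: b_def field_simps)
    then show ?thesis using a by linarith
  qed
  have ab0: "0 \<le> a" "0 \<le> b" using kl by (simp_all add: a_def b_def)
  have x3: "x3 \<le> 2 * b * (1 - x1)" using R kl by (simp add: b_def field_simps)
  have y3: "y3 \<le> 2 * a * (1 - y2)" using L kl by (simp add: a_def field_simps)
  have "z1 * (y2 * x3 - y3) \<ge> - (a * (1 - y2))"
  proof -
    have "z1 * (y2 * x3 - y3) \<ge> z1 * (- y3)" using pos by (intro mult_left_mono) auto
    moreover have "z1 * y3 \<le> (1 / 2) * (2 * a * (1 - y2))" using pos z y3 by (intro mult_mono) auto
    ultimately show ?thesis by simp
  qed
  moreover have "z2 * (y3 * x1 - x3) \<ge> - (b * (1 - x1))"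
  proof -
    have "z2 * (y3 * x1 - x3) \<ge> z2 * (- x3)" using pos by (intro mult_left_mono) auto
    moreover have "z2 * x3 \<le> (1 / 2) * (2 * b * (1 - x1))" using pos z x3 by (intro mult_mono) auto
    ultimately show ?thesis by simp
  qed
  moreover have "1 / 4 \<le> 1 - y2 * x1 - a * (1 - y2) - b * (1 - x1)"
    using or
  proof
    assume h: "2 * x1 < 1"
    have bx: "0 \<le> b * x1" using ab0 pos by simp
    have T0: "1 / 4 \<le> 1 - a - b * (1 - x1)" using ab bx by (simp add: algebra_simps)
    have T1: "1 / 4 \<le> (1 - x1) * (1 - b)"
      using h b mult_mono[of "1/2" "1 - x1" "1/2" "1 - b"] by simp
    have "1 / 4 = (1 - y2) * (1 / 4) + y2 * (1 / 4)" by (simp add: field_simps)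
    also have "\<dots> \<le> (1 - y2) * (1 - a - b * (1 - x1)) + y2 * ((1 - x1) * (1 - b))"
      using T0 T1 u1 pos by (intro add_mono mult_left_mono) auto
    also have "\<dots> = 1 - y2 * x1 - a * (1 - y2) - b * (1 - x1)" by (simp add: algebra_simps)
    finally show ?thesis .
  next
    assume h: "2 * y2 < 1"
    have ay: "0 \<le> a * y2" using ab0 pos by simp
    have T0: "1 / 4 \<le> 1 - b - a * (1 - y2)" using ab ay by (simp add: algebra_simps)
    have T1: "1 / 4 \<le> (1 - y2) * (1 - a)"
      using h a mult_mono[of "1/2" "1 - y2" "1/2" "1 - a"] by simp
    have "1 / 4 = (1 - x1) * (1 / 4) + x1 * (1 / 4)" by (simp add: field_simps)
    also have "\<dots> \<le> (1 - x1) * (1 - b - a * (1 - y2)) + x1 * ((1 - y2) * (1 - a))"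
      using T0 T1 u1 pos by (intro add_mono mult_left_mono) auto
    also have "\<dots> = 1 - y2 * x1 - a * (1 - y2) - b * (1 - x1)" by (simp add: algebra_simps)
    finally show ?thesis .
  qed
  ultimately show ?thesis by linarith
qed

definition scale_rows :: "(3 \<Rightarrow> real) \<Rightarrow> real^3^3 \<Rightarrow> real^3^3" where
  "scale_rows c N = (\<chi> i j. c i * N $ i $ j)"

lemma det_scale_rows: "det (scale_rows c N) = c 1 * c 2 * c 3 * det N"
  by (simp add: det_3 scale_rows_def algebra_simps)

lemma scale_rows_mult: "scale_rows c N ** T = scale_rows c (N ** T)"
  by (simp add: vec_eq_iff scale_rows_def matrix_matrix_mult_def sum_distrib_left mult.assoc)

lemma cone_of_scale_rows:
  assumes "\<And>i. c i > 0" shows "cone_of (scale_rows c N) = cone_of N"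
proof -
  have "scale_rows c N $ i \<bullet> x = c i * (N $ i \<bullet> x)" for i x
    by (simp add: scale_rows_def inner_vec_def sum_distrib_left mult.assoc)
  moreover have "0 \<le> c i * t \<longleftrightarrow> 0 \<le> t" for i t
    using assms[of i] zero_le_mult_iff[of "c i" t] by linarith
  ultimately show ?thesis by (simp add: cone_of_row)
qed

lemma white_open_scale_rows:
  assumes "N \<in> white_open k l \<alpha>" "\<And>i. c i > 0" shows "scale_rows c N \<in> white_open k l \<alpha>"
proof -
  have lt: "c i * a < c i * b" if "a < b" for i a b using that assms(2)[of i] by simp
  have N: "\<forall>i j. 0 < N $ i $ j"
    "real l * N $ 1 $ 3 < N $ 1 $ 1 - N $ 1 $ 2" "real k * N $ 2 $ 3 < N $ 2 $ 2 - N $ 2 $ 1"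
    "(real (k + l) - real \<alpha>) * N $ 3 $ 1 + real \<alpha> * N $ 3 $ 2 < N $ 3 $ 3"
    "2 * N $ 3 $ 1 < N $ 3 $ 3" "2 * N $ 3 $ 2 < N $ 3 $ 3"
    "2 * N $ 2 $ 1 < N $ 2 $ 2 \<or> 2 * N $ 1 $ 2 < N $ 1 $ 1"
    using assms(1) unfolding white_open_def by blast+
  have "real l * (c 1 * N $ 1 $ 3) < c 1 * N $ 1 $ 1 - c 1 * N $ 1 $ 2"
    using lt[OF N(2), of 1] by (simp add: algebra_simps)
  moreover have "real k * (c 2 * N $ 2 $ 3) < c 2 * N $ 2 $ 2 - c 2 * N $ 2 $ 1"
    using lt[OF N(3), of 2] by (simp add: algebra_simps)
  moreover have "(real (k + l) - real \<alpha>) * (c 3 * N $ 3 $ 1) + real \<alpha> * (c 3 * N $ 3 $ 2) < c 3 * N $ 3 $ 3"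
    using lt[OF N(4), of 3] by (simp add: algebra_simps)
  moreover have "2 * (c 3 * N $ 3 $ 1) < c 3 * N $ 3 $ 3" "2 * (c 3 * N $ 3 $ 2) < c 3 * N $ 3 $ 3"
    using lt[OF N(5), of 3] lt[OF N(6), of 3] by simp_all
  moreover have "2 * (c 2 * N $ 2 $ 1) < c 2 * N $ 2 $ 2 \<or> 2 * (c 1 * N $ 1 $ 2) < c 1 * N $ 1 $ 1"
    using N(7) lt[of "2 * N $ 2 $ 1" "N $ 2 $ 2" 2] lt[of "2 * N $ 1 $ 2" "N $ 1 $ 1" 1] by auto
  moreover have "\<forall>i j. 0 < c i * N $ i $ j" using N(1) assms(2) by simp
  ultimately show ?thesis unfolding white_open_def scale_rows_def by simp
qed

text \<open>Division of each row by its diagonal entry keeps the cone and brings the matrix into a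
  compact family.\<close>

lemma white_open_normalize:
  assumes N: "N \<in> white_open k l \<alpha>" and kl: "0 < k" "0 < l" "4 \<le> k + l"
  obtains c where "\<And>i. c i > 0" "\<And>i j. 0 < scale_rows c N $ i $ j" "\<And>i j. scale_rows c N $ i $ j \<le> 1"
    "1 / 4 \<le> det (scale_rows c N)" "scale_rows c N \<in> white_open k l \<alpha>"
proof -
  define c where "c = (\<lambda>i. 1 / N $ i $ i)"
  have Np: "0 < N $ i $ j" for i j using N by (simp add: white_open_def)
  then have c: "c i > 0" for i by (simp add: c_def)
  define M where "M = scale_rows c N"
  have M: "M \<in> white_open k l \<alpha>" unfolding M_def using N c by (rule white_open_scale_rows)
  have diag: "M $ i $ i = 1" for i using Np[of i i] by (simp add: M_def scale_rows_def c_def)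
  have m: "0 < M $ i $ j" for i j using M by (simp add: white_open_def)
  have k1: "1 \<le> real k" "1 \<le> real l" "4 \<le> real k + real l" using kl by linarith+
  have R: "real k * M $ 2 $ 3 < 1 - M $ 2 $ 1" and L: "real l * M $ 1 $ 3 < 1 - M $ 1 $ 2"
    and z: "2 * M $ 3 $ 1 < 1" "2 * M $ 3 $ 2 < 1" and or: "2 * M $ 2 $ 1 < 1 \<or> 2 * M $ 1 $ 2 < 1"
    using M by (auto simp: white_open_def diag)
  have "1 / 4 \<le> M $ 3 $ 1 * (M $ 1 $ 2 * M $ 2 $ 3 - M $ 1 $ 3)
      + M $ 3 $ 2 * (M $ 1 $ 3 * M $ 2 $ 1 - M $ 2 $ 3) + (1 - M $ 1 $ 2 * M $ 2 $ 1)"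
    by (rule white_det_normalized[OF m m m m m m k1 R L z or])
  also have "\<dots> = det M" by (simp add: det_3 diag algebra_simps)
  finally have D: "1 / 4 \<le> det M" .
  have "M $ 2 $ 3 \<le> real k * M $ 2 $ 3" "M $ 1 $ 3 \<le> real l * M $ 1 $ 3"
    using k1 m[of 2 3] m[of 1 3] by (auto intro: mult_right_mono[of 1, simplified])
  then have "M $ 2 $ 3 \<le> 1" "M $ 2 $ 1 \<le> 1" "M $ 1 $ 3 \<le> 1" "M $ 1 $ 2 \<le> 1" "M $ 3 $ 1 \<le> 1" "M $ 3 $ 2 \<le> 1"
    using R L z m[of 2 1] m[of 1 2] m[of 2 3] m[of 1 3] by linarith+
  then have "\<forall>i j. M $ i $ j \<le> 1" unfolding forall_3 by (simp add: diag)
  then show ?thesis using that[of c] c m D M by (simp add: M_def)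
qed

lemma white_open_det_pos:
  assumes N: "N \<in> white_open k l \<alpha>" and kl: "0 < k" "0 < l" "4 \<le> k + l"
  shows "0 < det N"
proof -
  obtain c where c: "\<And>i. c i > (0::real)" "1 / 4 \<le> det (scale_rows c N)" using white_open_normalize[OF assms] by metis
  have "0 < c 1 * c 2 * c 3" using c(1) by simp
  moreover have "0 < c 1 * c 2 * c 3 * det N" using c(2) by (simp add: det_scale_rows)
  ultimately show ?thesis by (metis zero_less_mult_pos)
qed

lemma open_white_open: "open (white_open k l \<alpha>)"
  unfolding white_open_def forall_3
  by (intro open_Collect_conj open_Collect_disj open_Collect_less continuous_intros)

text \<open>Volume-preserving translations: the first moves the bottom side of the triangle cut out of the
  plane of the face, the second moves the other two sides near the apex.\<close>

definition bottom_shift :: "real \<Rightarrow> real^3^3" where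
  "bottom_shift a = cols (vector [1, 0, a]) (vector [0, 1, a]) (vector [0, 0, 1])"

definition apex_shift :: "real \<Rightarrow> real \<Rightarrow> real^3^3" where
  "apex_shift b s = cols (vector [1, 0, 0]) (vector [0, 1, 0]) (vector [s - b, b, 1])"

lemma bottom_shift_mult: "bottom_shift a ** bottom_shift a' = bottom_shift (a + a')" "bottom_shift 0 = mat 1"
  and apex_shift_mult: "apex_shift b s ** apex_shift b' s' = apex_shift (b + b') (s + s')" "apex_shift 0 0 = mat 1"
  and det_shifts: "det (bottom_shift a) = 1" "det (apex_shift b s) = 1"
  by (simp_all add: bottom_shift_def apex_shift_def vec_eq_iff forall_3 cols_def matrix_matrix_mult_def sum_3 mat_def det_3)

lemma mult_bottom_shift:
  "(N ** bottom_shift a) $ i $ 1 = N $ i $ 1 + a * N $ i $ 3"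
  "(N ** bottom_shift a) $ i $ 2 = N $ i $ 2 + a * N $ i $ 3"
  "(N ** bottom_shift a) $ i $ 3 = N $ i $ 3"
  by (simp_all add: bottom_shift_def cols_def matrix_matrix_mult_def sum_3)

lemma mult_apex_shift:
  "(N ** apex_shift b s) $ i $ 1 = N $ i $ 1"
  "(N ** apex_shift b s) $ i $ 2 = N $ i $ 2"
  "(N ** apex_shift b s) $ i $ 3 = N $ i $ 3 + b * (N $ i $ 2 - N $ i $ 1) + s * N $ i $ 1"
  by (simp_all add: apex_shift_def cols_def matrix_matrix_mult_def sum_3 algebra_simps)

text \<open>One cone with one assignment of rows, \<open>M\<close>, in two translates. Undoing them
  leaves apex entries X in (0, dy/l) in row 1 and in (0, dx/k) in row 2, which bounds two
  combinations of b - b' and s - s'. Eliminating b - b' bounds s - s'. Once s = s', each of the two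
  bounds b - b', and once also b = b', row 3 bounds a - a'.\<close>

lemma shifts_separate:
  fixes M :: "real^3^3"
  assumes kl: "0 < k" "0 < l" and \<alpha>: "\<alpha> < k + l"
    and 1: "M ** apex_shift (- b) (- s) ** bottom_shift (- a) \<in> white_open k l \<alpha>"
    and 2: "M ** apex_shift (- b') (- s') ** bottom_shift (- a') \<in> white_open k l \<alpha>"
    and a: "0 \<le> a" "0 \<le> a'"
  shows "\<bar>s - s'\<bar> * (real k * real l) < real (k + l)"
    and "s = s' \<Longrightarrow> \<bar>b - b'\<bar> * real k < 1" "s = s' \<Longrightarrow> \<bar>b - b'\<bar> * real l < 1"
    and "s = s' \<Longrightarrow> b = b' \<Longrightarrow> \<bar>a - a'\<bar> * real (k + l) < 1"
proof -
  define X where "X = (\<lambda>i b s. M $ i $ 3 - b * (M $ i $ 2 - M $ i $ 1) - s * M $ i $ 1)"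
  have ent: "(M ** apex_shift (- b) (- s) ** bottom_shift (- a)) $ i $ 1 = M $ i $ 1 - a * X i b s"
    "(M ** apex_shift (- b) (- s) ** bottom_shift (- a)) $ i $ 2 = M $ i $ 2 - a * X i b s"
    "(M ** apex_shift (- b) (- s) ** bottom_shift (- a)) $ i $ 3 = X i b s" for i a b s
    by (simp_all add: mult_bottom_shift mult_apex_shift X_def)
  have facts: "0 < X i b s" "0 < M $ i $ 1 - a * X i b s" "0 < M $ i $ 2 - a * X i b s"
    "real l * X 1 b s < M $ 1 $ 1 - M $ 1 $ 2" "real k * X 2 b s < M $ 2 $ 2 - M $ 2 $ 1"
    "(real (k + l) - real \<alpha>) * (M $ 3 $ 1 - a * X 3 b s) + real \<alpha> * (M $ 3 $ 2 - a * X 3 b s) < X 3 b s"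
    if w: "M ** apex_shift (- b) (- s) ** bottom_shift (- a) \<in> white_open k l \<alpha>" for a b s i
  proof -
    have w': "\<forall>i j. 0 < (M ** apex_shift (- b) (- s) ** bottom_shift (- a)) $ i $ j"
      using w unfolding white_open_def by blast
    show "0 < X i b s" "0 < M $ i $ 1 - a * X i b s" "0 < M $ i $ 2 - a * X i b s"
      using spec[OF spec[OF w', of i], of 3] spec[OF spec[OF w', of i], of 1] spec[OF spec[OF w', of i], of 2]
      unfolding ent by auto
    show "real l * X 1 b s < M $ 1 $ 1 - M $ 1 $ 2" "real k * X 2 b s < M $ 2 $ 2 - M $ 2 $ 1"
      "(real (k + l) - real \<alpha>) * (M $ 3 $ 1 - a * X 3 b s) + real \<alpha> * (M $ 3 $ 2 - a * X 3 b s) < X 3 b s"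
      using w unfolding white_open_def mem_Collect_eq ent by (elim conjE; linarith)+
  qed
  note f1 = facts[OF 1] and f2 = facts[OF 2]
  define x where "x = M $ 2 $ 1"
  define dx where "dx = M $ 2 $ 2 - M $ 2 $ 1"
  define y where "y = M $ 1 $ 1"
  define dy where "dy = M $ 1 $ 1 - M $ 1 $ 2"
  have kp: "real k > 0" "real l > 0" using kl by auto
  have "0 \<le> a * X i b s" for i using a f1(1)[of i] by simp
  then have x0: "0 < x" and y2: "0 < M $ 1 $ 2" using f1(2)[of 2] f1(3)[of 1] unfolding x_def by (smt (verit))+
  have dx0: "0 < dx" and dy0: "0 < dy"
    using f1(1)[of 2] f1(1)[of 1] f1(4,5) mult_pos_pos[OF kp(1), of "X 2 b s"] mult_pos_pos[OF kp(2), of "X 1 b s"]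
    unfolding dx_def dy_def by linarith+
  have ydy: "dy \<le> y" using y2 by (simp add: y_def dy_def)
  have lt: "\<bar>u - v\<bar> * c < w" if "0 < u" "0 < v" "c * u < w" "c * v < w" "0 < c" for u v c w :: real
  proof -
    have "\<bar>u - v\<bar> \<le> max u v" using that by auto
    then have "\<bar>u - v\<bar> * c \<le> max u v * c" using that by (intro mult_right_mono) auto
    also have "\<dots> < w" using that by (auto simp: max_def mult.commute)
    finally show ?thesis .
  qed
  have "X 2 b' s' - X 2 b s = (b - b') * dx + (s - s') * x"
    by (simp add: X_def dx_def x_def algebra_simps)
  then have A: "\<bar>(b - b') * dx + (s - s') * x\<bar> * real k < dx"
    using lt[OF f2(1) f1(1) f2(5)[folded dx_def] f1(5)[folded dx_def] kp(1)] by simp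
  have "X 1 b' s' - X 1 b s = (s - s') * y - (b - b') * dy"
    by (simp add: X_def dy_def y_def algebra_simps)
  then have Bd: "\<bar>(s - s') * y - (b - b') * dy\<bar> * real l < dy"
    using lt[OF f2(1) f1(1) f2(4)[folded dy_def] f1(4)[folded dy_def] kp(2)] by simp
  show "\<bar>s - s'\<bar> * (real k * real l) < real (k + l)"
  proof -
    \<comment> \<open>dy times the first combination plus dx times the second: b - b'
      cancels.\<close>
    have "((b - b') * dx + (s - s') * x) * dy + ((s - s') * y - (b - b') * dy) * dx = (s - s') * (x * dy + y * dx)"
      by (simp add: algebra_simps)
    then have "\<bar>s - s'\<bar> * (x * dy + y * dx) = \<bar>((b - b') * dx + (s - s') * x) * dy + ((s - s') * y - (b - b') * dy) * dx\<bar>"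
      using x0 dx0 dy0 ydy by (simp add: abs_mult)
    also have "\<dots> \<le> \<bar>(b - b') * dx + (s - s') * x\<bar> * dy + \<bar>(s - s') * y - (b - b') * dy\<bar> * dx"
      using dx0 dy0 by (intro order_trans[OF abs_triangle_ineq]) (simp add: abs_mult)
    finally have "\<bar>s - s'\<bar> * (x * dy + y * dx) * (real k * real l)
      \<le> (\<bar>(b - b') * dx + (s - s') * x\<bar> * dy + \<bar>(s - s') * y - (b - b') * dy\<bar> * dx) * (real k * real l)"
      using kp by (intro mult_right_mono) auto
    also have "\<dots> = (\<bar>(b - b') * dx + (s - s') * x\<bar> * real k) * (dy * real l) + (\<bar>(s - s') * y - (b - b') * dy\<bar> * real l) * (dx * real k)"
      by (simp add: algebra_simps)
    also have "\<dots> < dx * (dy * real l) + dy * (dx * real k)"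
      using A Bd dx0 dy0 kp by (intro add_strict_mono mult_strict_right_mono) auto
    finally have "\<bar>s - s'\<bar> * (x * dy + y * dx) * (real k * real l) < dx * dy * real (k + l)" by (simp add: algebra_simps)
    moreover have "\<bar>s - s'\<bar> * (dx * dy) * (real k * real l) \<le> \<bar>s - s'\<bar> * (x * dy + y * dx) * (real k * real l)"
    proof -
      have "dx * dy \<le> dx * y" using ydy dx0 by (intro mult_left_mono) auto
      moreover have "0 < x * dy" using x0 dy0 by simp
      ultimately have "dx * dy \<le> x * dy + y * dx" by (simp add: mult.commute)
      then show ?thesis using kp by (intro mult_right_mono mult_left_mono) auto
    qed
    ultimately have "(dx * dy) * (\<bar>s - s'\<bar> * (real k * real l)) < (dx * dy) * real (k + l)" by (simp add: mult_ac)
    then show ?thesis using dx0 dy0 by simp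
  qed
  show "\<bar>b - b'\<bar> * real k < 1" if "s = s'"
  proof -
    have "dx * (\<bar>b - b'\<bar> * real k) < dx * 1" using A that dx0 by (simp add: abs_mult mult_ac)
    then show ?thesis using dx0 by (simp only: mult_less_cancel_left_pos)
  qed
  show "\<bar>b - b'\<bar> * real l < 1" if "s = s'"
  proof -
    have "dy * (\<bar>b - b'\<bar> * real l) < dy * 1" using Bd that dy0 by (simp add: abs_mult mult_ac)
    then show ?thesis using dy0 by (simp only: mult_less_cancel_left_pos)
  qed
  show "\<bar>a - a'\<bar> * real (k + l) < 1" if "s = s'" "b = b'"
  proof -
    define Z where "Z = X 3 b s"
    define W where "W = (real (k + l) - real \<alpha>) * M $ 3 $ 1 + real \<alpha> * M $ 3 $ 2"
    have Z: "Z > 0" using f1(1) by (simp add: Z_def)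
    have up: "W - a * Z * real (k + l) < Z" "W - a' * Z * real (k + l) < Z"
      using f1(6) f2(6) that by (simp_all add: W_def Z_def algebra_simps)
    have W0: "0 < W - c * Z * real (k + l)" if "0 < M $ 3 $ 1 - c * Z" "0 < M $ 3 $ 2 - c * Z" for c
    proof -
      have "0 < (real (k + l) - real \<alpha>) * (M $ 3 $ 1 - c * Z)" using \<alpha> that by (intro mult_pos_pos) auto
      moreover have "0 \<le> real \<alpha> * (M $ 3 $ 2 - c * Z)" using that by simp
      moreover have "(real (k + l) - real \<alpha>) * (M $ 3 $ 1 - c * Z) + real \<alpha> * (M $ 3 $ 2 - c * Z) = W - c * Z * real (k + l)"
        by (simp add: W_def algebra_simps)
      ultimately show ?thesis by linarith
    qed
    have "0 < W - a * Z * real (k + l)" "0 < W - a' * Z * real (k + l)"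
      using W0[of a] W0[of a'] f1(2,3)[of 3] f2(2,3)[of 3] that by (auto simp: Z_def)
    then have "\<bar>a * Z * real (k + l) - a' * Z * real (k + l)\<bar> < Z" using up by linarith
    moreover have "a * Z * real (k + l) - a' * Z * real (k + l) = Z * ((a - a') * real (k + l))"
      by (simp add: algebra_simps)
    ultimately have "Z * (\<bar>a - a'\<bar> * real (k + l)) < Z * 1" using Z by (simp add: abs_mult)
    then show ?thesis using Z by (simp only: mult_less_cancel_left_pos)
  qed
qed

context
  fixes \<mu> :: "(real^3) set measure"
  assumes \<mu>: "invariant_measure \<mu>"
begin

lemma cone_of_white_open_sets:
  assumes kl: "0 < k" "0 < l" "4 \<le> k + l"
  shows "cone_of ` white_open k l \<alpha> \<in> sets \<mu>"
  by (rule openin_sets[OF \<mu> openin_cone_of_image[OF open_white_open white_open_det_pos[OF _ kl]]])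

lemma white_cell_sets:
  assumes kl: "0 < k" "0 < l" "4 \<le> k + l"
  shows "white_cell k l \<alpha> \<in> sets \<mu>"
  unfolding white_cell_def using kl
  by (intro sets_act_pos[OF \<mu>] cone_of_white_open_sets) (auto simp: det_white_mat)

text \<open>The grid steps 1 / max k l, (k + l) / (k l) and 1 / (k + l) are the separations from
  \<open>shifts_separate\<close>. With parameters in [0,1] the grid has at least k l (k + l) / 2
  points, whence 54 = 2 * 27. The 27 counts the maps between row indices, one for each possible
  assignment of rows in \<open>cone_of_eq\<close>.\<close>

lemma white_cell_bound:
  assumes kl: "0 < k" "0 < l" "4 \<le> k + l" and \<alpha>: "\<alpha> < k + l"
  shows "of_nat (k * l * (k + l)) * emeasure \<mu> (white_cell k l \<alpha>) \<le> 54 * emeasure \<mu> (cone_of ` bounded_mats 4 (1 / 4))"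
proof -
  let ?E = "cone_of ` white_open k l \<alpha>" and ?K = "cone_of ` bounded_mats 4 (1 / 4)"
  have E: "?E \<in> sets \<mu>" by (rule cone_of_white_open_sets[OF kl])
  have Ec: "?E \<subseteq> cones" using sets.sets_into_space[OF E] by (simp add: space_invariant[OF \<mu>])
  have K: "?K \<in> sets \<mu>" using bounded_mats_measure[OF \<mu>, of "1/4" 4] by simp
  have kp: "real k > 0" "real l > 0" using kl by auto
  define n where "n = nat \<lceil>real k * real l / real (k + l)\<rceil>"
  define T where "T = {..<max k l} \<times> {..<n} \<times> {..<k + l}"
  define fb where "fb = (\<lambda>(i :: nat, j :: nat, h :: nat). real i / real (max k l))"
  define fs where "fs = (\<lambda>(i :: nat, j :: nat, h :: nat). real j * real (k + l) / (real k * real l))"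
  define fa where "fa = (\<lambda>(i :: nat, j :: nat, h :: nat). real h / real (k + l))"
  define A where "A = (\<lambda>t. bottom_shift (fa t) ** apex_shift (fb t) (fs t))"
  define A' where "A' = (\<lambda>t. apex_shift (- fb t) (- fs t) ** bottom_shift (- fa t))"
  define G where "G = (\<lambda>t. act (A' t) ` ?E)"
  have inv: "A' t ** A t = mat 1" "A t ** A' t = mat 1" for t
  proof -
    have "A' t ** A t = apex_shift (- fb t) (- fs t) ** (bottom_shift (- fa t) ** bottom_shift (fa t)) ** apex_shift (fb t) (fs t)"
      by (simp only: A_def A'_def matrix_mul_assoc)
    then show "A' t ** A t = mat 1" by (simp add: bottom_shift_mult apex_shift_mult)
    have "A t ** A' t = bottom_shift (fa t) ** (apex_shift (fb t) (fs t) ** apex_shift (- fb t) (- fs t)) ** bottom_shift (- fa t)"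
      by (simp only: A_def A'_def matrix_mul_assoc)
    then show "A t ** A' t = mat 1" by (simp add: bottom_shift_mult apex_shift_mult)
  qed
  have detA: "det (A' t) = 1" for t by (simp add: A'_def det_mul det_shifts)
  have detA2: "det (A t) = 1" for t by (simp add: A_def det_mul det_shifts)
  have G: "C \<in> G t \<longleftrightarrow> (\<exists>N\<in>white_open k l \<alpha>. C = cone_of (N ** A t))" for C t
  proof -
    have "G t = (\<lambda>N. cone_of (N ** A t)) ` white_open k l \<alpha>"
      by (simp add: G_def image_image act_cone_of[OF inv])
    then show ?thesis by auto
  qed
  have range: "0 \<le> fb t" "fb t \<le> 1" "0 \<le> fs t" "fs t \<le> 1" "0 \<le> fa t" "fa t \<le> 1" if t: "t \<in> T" for t
  proof -
    obtain i j h where tt: "t = (i, j, h)" by (cases t)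
    have b: "i < max k l" "j < n" "h < k + l" using t by (auto simp: T_def tt)
    show "0 \<le> fb t" "0 \<le> fs t" "0 \<le> fa t" by (simp_all add: tt fb_def fs_def fa_def)
    show "fb t \<le> 1" "fa t \<le> 1" using b by (simp_all add: tt fb_def fa_def)
    have "real j < real k * real l / real (k + l)" using b(2) unfolding n_def by (simp add: zless_nat_eq_int_zless less_ceiling_iff)
    then have "real j * real (k + l) < real k * real l" using kl by (simp add: pos_less_divide_eq)
    then show "fs t \<le> 1" using kp by (simp add: tt fs_def pos_divide_le_eq)
  qed
  have cT: "of_nat (card T) * emeasure \<mu> ?E \<le> of_nat 27 * emeasure \<mu> ?K"
  proof (rule multiplicity_bound[OF \<mu>, of _ G])
    show "finite T" by (simp add: T_def)
    fix t assume t: "t \<in> T"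
    show "G t \<in> sets \<mu>" unfolding G_def by (intro sets_act_pos[OF \<mu>] E) (simp add: detA)
    show "emeasure \<mu> (G t) = emeasure \<mu> ?E" unfolding G_def by (intro emeasure_act_pos[OF \<mu>] Ec) (simp add: detA)
    show "G t \<subseteq> ?K"
    proof
      fix C assume "C \<in> G t"
      then obtain N where N: "N \<in> white_open k l \<alpha>" "C = cone_of (N ** A t)" unfolding G by blast
      obtain c where c: "\<And>i. c i > (0::real)" "\<And>i j. 0 < scale_rows c N $ i $ j" "\<And>i j. scale_rows c N $ i $ j \<le> 1"
        "1 / 4 \<le> det (scale_rows c N)" using white_open_normalize[OF N(1) kl] by metis
      let ?N = "scale_rows c N"
      have C: "C = cone_of (?N ** A t)" unfolding scale_rows_mult by (simp add: cone_of_scale_rows[OF c(1)] N(2))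
      have NA: "?N ** A t = ?N ** bottom_shift (fa t) ** apex_shift (fb t) (fs t)" by (simp add: A_def matrix_mul_assoc)
      note r = range[OF t]
      have u: "0 \<le> x * y \<and> x * y \<le> z" if "0 \<le> x" "x \<le> 1" "0 \<le> y" "y \<le> z" for x y z :: real
        using that mult_mono[of x 1 y z] by simp
      \<comment> \<open>The worst column is the third, with contributions 1 + 1 + 2; this explains
        the bound 4.\<close>
      have ent: "\<bar>(?N ** A t) $ i $ 1\<bar> \<le> 4 \<and> \<bar>(?N ** A t) $ i $ 2\<bar> \<le> 4 \<and> \<bar>(?N ** A t) $ i $ 3\<bar> \<le> 4" for i
      proof -
        note p = c(2)[of i 1] c(2)[of i 2] c(2)[of i 3] c(3)[of i 1] c(3)[of i 2] c(3)[of i 3]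
        have a3: "0 \<le> fa t * ?N $ i $ 3 \<and> fa t * ?N $ i $ 3 \<le> 1" using r p by (intro u) auto
        have bd: "\<bar>fb t * (?N $ i $ 2 - ?N $ i $ 1)\<bar> \<le> 1"
        proof -
          have "\<bar>?N $ i $ 2 - ?N $ i $ 1\<bar> \<le> 1" using p by linarith
          then show ?thesis using r u[of "fb t" "\<bar>?N $ i $ 2 - ?N $ i $ 1\<bar>" 1] by (simp add: abs_mult)
        qed
        have s3: "0 \<le> fs t * (?N $ i $ 1 + fa t * ?N $ i $ 3) \<and> fs t * (?N $ i $ 1 + fa t * ?N $ i $ 3) \<le> 2"
          using r p a3 by (intro u) auto
        have e3: "?N $ i $ 2 + fa t * ?N $ i $ 3 - (?N $ i $ 1 + fa t * ?N $ i $ 3) = ?N $ i $ 2 - ?N $ i $ 1" by simp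
        show ?thesis
          unfolding NA mult_apex_shift mult_bottom_shift e3 using p a3 bd s3 by linarith
      qed
      have "\<bar>(?N ** A t) $ i $ j\<bar> \<le> 4" for i j
        using ent[of i] exhaust_3[of j] by auto
      then have "?N ** A t \<in> bounded_mats 4 (1 / 4)" using c(4) by (simp add: bounded_mats_def det_mul detA2)
      then show "C \<in> ?K" unfolding C by blast
    qed
  next
    fix C
    let ?T = "{t \<in> T. C \<in> G t}"
    show "card ?T \<le> 27"
    proof (cases "?T = {}")
      case True
      then show ?thesis by (simp only: card.empty)
    next
      case False
      then obtain t0 where "C \<in> G t0" by blast
      then obtain N1 where N1: "N1 \<in> white_open k l \<alpha>" "C = cone_of (N1 ** A t0)" unfolding G by blast
      define N0 where "N0 = N1 ** A t0"
      have N0: "det N0 > 0" "C = cone_of N0"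
        using white_open_det_pos[OF N1(1) kl] N1(2) by (simp_all add: N0_def det_mul detA2)
      have ex: "\<exists>\<pi>. (\<chi> i. N0 $ \<pi> i) ** A' t \<in> white_open k l \<alpha>" if t: "t \<in> ?T" for t
      proof -
        obtain N where N: "N \<in> white_open k l \<alpha>" "C = cone_of (N ** A t)" using t unfolding mem_Collect_eq G by blast
        have "det (N ** A t) > 0" using white_open_det_pos[OF N(1) kl] by (simp add: det_mul detA2)
        then obtain \<pi> c where \<pi>: "\<And>i. c i > (0::real)" "\<And>i j. (N ** A t) $ i $ j = c i * N0 $ \<pi> i $ j"
          using cone_of_eq[of N0 "N ** A t"] N0 N(2) by metis
        have e: "scale_rows (\<lambda>i. 1 / c i) (N ** A t) = (\<chi> i. N0 $ \<pi> i)"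
          using \<pi>(1) by (simp add: scale_rows_def vec_eq_iff \<pi>(2) less_imp_neq[symmetric])
        have "(\<chi> i. N0 $ \<pi> i) ** A' t = scale_rows (\<lambda>i. 1 / c i) (N ** A t ** A' t)"
          unfolding e[symmetric] by (rule scale_rows_mult)
        also have "N ** A t ** A' t = N" by (simp add: matrix_mul_assoc[symmetric] inv)
        finally show ?thesis using white_open_scale_rows[OF N(1), of "\<lambda>i. 1 / c i"] \<pi>(1) by (intro exI[of _ \<pi>]) simp
      qed
      then have "\<forall>t\<in>?T. \<exists>\<pi>. (\<chi> i. N0 $ \<pi> i) ** A' t \<in> white_open k l \<alpha>" by blast
      from bchoice[OF this] obtain \<pi> where \<pi>: "\<forall>t\<in>?T. (\<chi> i. N0 $ \<pi> t i) ** A' t \<in> white_open k l \<alpha>"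
        by (elim exE)
      have "inj_on \<pi> ?T"
      proof (rule inj_onI)
        fix t u assume tu: "t \<in> ?T" "u \<in> ?T" "\<pi> t = \<pi> u"
        define M where "M = (\<chi> i. N0 $ \<pi> u i)"
        have "M ** apex_shift (- fb t) (- fs t) ** bottom_shift (- fa t) \<in> white_open k l \<alpha>"
          "M ** apex_shift (- fb u) (- fs u) ** bottom_shift (- fa u) \<in> white_open k l \<alpha>"
          using bspec[OF \<pi> tu(1)] bspec[OF \<pi> tu(2)] by (simp_all add: M_def tu(3) A'_def matrix_mul_assoc)
        note sep = shifts_separate[OF kl(1,2) \<alpha> this]
        have ge: "0 \<le> fa t" "0 \<le> fa u" using range tu by auto
        obtain i j h where t: "t = (i, j, h)" by (cases t)
        obtain i' j' h' where u: "u = (i', j', h')" by (cases u)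
        have "fs t - fs u = (real j - real j') * (real (k + l) / (real k * real l))"
          by (simp add: fs_def t u left_diff_distrib diff_divide_distrib)
        then have "\<bar>fs t - fs u\<bar> * (real k * real l) = \<bar>real j - real j'\<bar> * real (k + l)"
          using kp by (simp add: abs_mult)
        then have "\<bar>real j - real j'\<bar> * real (k + l) < 1 * real (k + l)" using sep(1)[OF ge] by simp
        then have "\<bar>real j - real j'\<bar> < 1" by (rule mult_right_less_imp_less) simp
        then have j: "j = j'" by linarith
        then have s: "fs t = fs u" by (simp add: fs_def t u)
        have "\<bar>fb t - fb u\<bar> * real (max k l) < 1"
          using sep(2,3)[OF ge s] by (simp add: max_def)
        moreover have "fb t - fb u = (real i - real i') / real (max k l)" by (simp add: fb_def t u diff_divide_distrib)
        ultimately have "\<bar>real i - real i'\<bar> < 1" using kl by (simp add: abs_divide)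
        then have i: "i = i'" by linarith
        then have b: "fb t = fb u" by (simp add: fb_def t u)
        have "\<bar>fa t - fa u\<bar> * real (k + l) < 1" by (rule sep(4)[OF ge s b])
        moreover have "fa t - fa u = (real h - real h') / real (k + l)" by (simp add: fa_def t u diff_divide_distrib)
        ultimately have "\<bar>real h - real h'\<bar> < 1" using kl by (simp add: abs_divide)
        then have "h = h'" by linarith
        then show "t = u" using i j t u by simp
      qed
      then have "card ?T \<le> card (UNIV :: (3 \<Rightarrow> 3) set)" by (rule card_inj_on_le) auto
      then show ?thesis by (simp add: card_fun)
    qed
  qed (rule K)
  have "k * l * (k + l) \<le> 2 * card T"
  proof -
    have "real k * real l / real (k + l) \<le> real n" by (simp add: n_def)
    then have "real k * real l \<le> real n * real (k + l)" using kl by (simp add: pos_divide_le_eq)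
    then have "k * l \<le> n * (k + l)" by (metis of_nat_le_iff of_nat_mult)
    moreover have "k + l \<le> 2 * max k l" by simp
    ultimately have "(k * l) * (k + l) \<le> (n * (k + l)) * (2 * max k l)" by (rule mult_le_mono)
    then show ?thesis by (simp add: T_def card_cartesian_product mult_ac)
  qed
  then have "of_nat (k * l * (k + l)) * emeasure \<mu> ?E \<le> of_nat (2 * card T) * emeasure \<mu> ?E"
    by (intro mult_right_mono) (simp_all only: of_nat_le_iff zero_le)
  also have "\<dots> = 2 * (of_nat (card T) * emeasure \<mu> ?E)" by (simp add: mult.assoc)
  also have "\<dots> \<le> 2 * (of_nat 27 * emeasure \<mu> ?K)" using cT by (rule mult_left_mono) simp
  finally have "of_nat (k * l * (k + l)) * emeasure \<mu> ?E \<le> 2 * (of_nat 27 * emeasure \<mu> ?K)" .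
  moreover have "emeasure \<mu> (white_cell k l \<alpha>) = emeasure \<mu> ?E"
    unfolding white_cell_def using kl by (intro emeasure_act_pos[OF \<mu>] Ec) (simp add: det_white_mat)
  ultimately have "of_nat (k * l * (k + l)) * emeasure \<mu> (white_cell k l \<alpha>) \<le> 2 * (of_nat 27 * emeasure \<mu> ?K)" by simp
  also have "\<dots> = 54 * emeasure \<mu> ?K" by (simp add: mult.assoc[symmetric])
  finally show ?thesis .
qed

lemma siegel_cell_measure: "siegel_cell i j \<in> sets \<mu>" "emeasure \<mu> (siegel_cell i j) = emeasure \<mu> (cone_of ` bounded_mats 42 1)"
proof -
  have K: "cone_of ` bounded_mats 42 1 \<in> sets \<mu>" using bounded_mats_measure[OF \<mu>, of 1 42] by simp
  have "cone_of ` bounded_mats 42 1 \<subseteq> cones" using sets.sets_into_space[OF K] by (simp add: space_invariant[OF \<mu>])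
  then show "siegel_cell i j \<in> sets \<mu>" "emeasure \<mu> (siegel_cell i j) = emeasure \<mu> (cone_of ` bounded_mats 42 1)"
    unfolding siegel_cell_def using K
    by (auto intro!: sets_act_pos[OF \<mu>] emeasure_act_pos[OF \<mu>] simp: det_diag3)
qed

end

section \<open>Summation over the cells\<close>

lemma nn_integral_count_space_le_inj:
  assumes "inj_on g A" "\<And>x. x \<in> A \<Longrightarrow> f x \<le> h (g x)"
  shows "(\<integral>\<^sup>+x. f x \<partial>count_space A) \<le> (\<integral>\<^sup>+y. h y \<partial>count_space UNIV)"
proof -
  have "(\<integral>\<^sup>+x. f x \<partial>count_space A) \<le> (\<integral>\<^sup>+x. h (g x) \<partial>count_space A)"
    using assms(2) by (intro nn_integral_mono) simp
  also have "\<dots> = (\<integral>\<^sup>+y. h y \<partial>count_space (g ` A))"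
    using assms(1) by (intro nn_integral_bij_count_space inj_on_imp_bij_betw)
  also have "\<dots> \<le> (\<integral>\<^sup>+y. h y \<partial>count_space UNIV)"
    by (auto simp: nn_integral_count_space_indicator intro!: nn_integral_mono split: split_indicator)
  finally show ?thesis .
qed

lemma nn_integral_count_space_product:
  fixes f :: "'a \<Rightarrow> ennreal" and g :: "'b \<Rightarrow> ennreal"
  shows "(\<integral>\<^sup>+p. f (fst p) * g (snd p) \<partial>count_space UNIV)
    = (\<integral>\<^sup>+x. f x \<partial>count_space UNIV) * (\<integral>\<^sup>+y. g y \<partial>count_space UNIV)"
  by (simp add: nn_integral_fst_count_space[symmetric] nn_integral_cmult nn_integral_multc)

lemma nn_integral_count_space_summable:
  fixes f :: "nat \<Rightarrow> real"
  assumes "summable f" "\<And>n. 0 \<le> f n"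
  shows "(\<integral>\<^sup>+n. ennreal (f n) \<partial>count_space UNIV) < \<infinity>"
  using assms by (simp add: nn_integral_count_space_nat suminf_ennreal2)

type_synonym cell_index = "(nat \<times> int \<times> int) + (nat \<times> nat \<times> nat)"

text \<open>The inequalities are the restrictions found in \<open>siegel_cover\<close>. The
  component d selects the plane of the face; all d share the same cells.\<close>

definition siegel_indices :: "(nat \<times> int \<times> int) set" where
  "siegel_indices = {(d, i, j). d \<le> 3 \<and> (2 powi i)\<^sup>2 * 2 powi j \<le> (18::real) \<and> 2 powi i * (2 powi j)\<^sup>2 \<le> (18::real)}"

definition white_indices :: "(nat \<times> nat \<times> nat) set" where
  "white_indices = {(k, l, \<alpha>). 0 < k \<and> 0 < l \<and> \<alpha> < k + l \<and> 4 \<le> k + l \<and> k * \<alpha> mod (k + l) = 1}"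

lemma powi_double: "2 powi (2 * i) = (2 powi i :: real)\<^sup>2"
  using power_int_add[of "2::real" i i] by (simp add: power2_eq_square)

lemma powi_triple: "2 powi (3 * i) = (2 powi i :: real) ^ 3"
  using power_int_add[of "2::real" "2 * i" i] by (simp add: powi_double power2_eq_square power3_eq_cube)

text \<open>In the natural numbers u = 4 - (2 i + j) and v = 4 - (i + 2 j) the weight is 2^(8 - u -
  v), so the sum is geometric. Of 2048 = 2^8 * 2^3 the second factor pays for an auxiliary 2^(-d)
  with d \<le> 3, which turns the majorant into a product of three equal series.\<close>

lemma siegel_weights_finite:
  "(\<integral>\<^sup>+(d, i, j). ennreal ((2 powi i * 2 powi j) ^ 3) \<partial>count_space siegel_indices) < \<infinity>"
proof -
  define g :: "nat \<times> int \<times> int \<Rightarrow> nat \<times> nat \<times> nat" where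
    "g = (\<lambda>(d, i, j). (d, nat (4 - (2 * i + j)), nat (4 - (i + 2 * j))))"
  define p where "p = (\<lambda>n::nat. ennreal ((1 / 2) ^ n))"
  define P where "P = (\<integral>\<^sup>+n. p n \<partial>count_space UNIV)"
  have P: "P < \<infinity>" unfolding P_def p_def by (intro nn_integral_count_space_summable) auto
  have le4: "2 * i + j \<le> 4" "i + 2 * j \<le> 4" if "(d, i, j) \<in> siegel_indices" for d i j
  proof -
    have pw: "(2 powi i)\<^sup>2 * 2 powi j = (2 powi (2 * i + j) :: real)" "2 powi i * (2 powi j)\<^sup>2 = (2 powi (i + 2 * j) :: real)"
      by (simp_all add: power_int_add powi_double)
    \<comment> \<open>Because 18 < 2^5.\<close>
    have small: "n \<le> 4" if "2 powi n \<le> (18::real)" for n :: int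
    proof (rule ccontr)
      assume "\<not> n \<le> 4"
      then have "(2::real) powi 5 \<le> 2 powi n" by (intro power_int_increasing) auto
      then show False using that by simp
    qed
    have "(2 powi i)\<^sup>2 * 2 powi j \<le> (18::real)" "2 powi i * (2 powi j)\<^sup>2 \<le> (18::real)"
      using that by (auto simp: siegel_indices_def)
    then show "2 * i + j \<le> 4" "i + 2 * j \<le> 4"
      unfolding pw by (auto intro: small)
  qed
  have "inj_on g siegel_indices"
  proof (rule inj_onI)
    fix x y assume xy: "x \<in> siegel_indices" "y \<in> siegel_indices" "g x = g y"
    obtain d i j d' i' j' where e: "x = (d, i, j)" "y = (d', i', j')" by (cases x, cases y)
    have "d = d'" "4 - (2 * i + j) = 4 - (2 * i' + j')" "4 - (i + 2 * j) = 4 - (i' + 2 * j')"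
      using xy le4[of d i j] le4[of d' i' j'] unfolding e g_def by (auto simp: eq_nat_nat_iff)
    then show "x = y" unfolding e by simp
  qed
  moreover have "(case x of (d, i, j) \<Rightarrow> ennreal ((2 powi i * 2 powi j) ^ 3))
    \<le> ennreal 2048 * (case g x of (d, u, v) \<Rightarrow> p d * (p u * p v))" if x: "x \<in> siegel_indices" for x
  proof -
    obtain d i j where e: "x = (d, i, j)" by (cases x)
    define u where "u = nat (4 - (2 * i + j))"
    define v where "v = nat (4 - (i + 2 * j))"
    have uv: "int u = 4 - (2 * i + j)" "int v = 4 - (i + 2 * j)"
      using le4[of d i j] x unfolding e by (simp_all add: u_def v_def)
    have "(2 powi i * 2 powi j :: real) ^ 3 = 2 powi (3 * (i + j))"
      by (simp only: powi_triple) (simp add: power_int_add)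
    also have "3 * (i + j) = 8 - int u - int v" unfolding uv by simp
    also have "2 powi (8 - int u - int v) = 256 * ((1 / 2) ^ u * (1 / 2) ^ v :: real)"
    proof -
      have "(2::real) powi (8 - int u - int v) = 2 powi 8 / 2 powi int u / 2 powi int v"
        by (simp only: power_int_diff simp_thms zero_neq_numeral[symmetric] numeral_neq_zero not_False_eq_True)
      then show ?thesis by (simp only: power_int_of_nat power_one_over) simp
    qed
    also have "\<dots> \<le> 2048 * ((1 / 2) ^ d * ((1 / 2) ^ u * (1 / 2) ^ v))"
    proof -
      have "(1 / 2 :: real) ^ 3 \<le> (1 / 2) ^ d"
        using x unfolding e by (intro power_decreasing) (auto simp: siegel_indices_def)
      then have "256 \<le> 2048 * (1 / 2 :: real) ^ d" by (simp add: power3_eq_cube)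
      then have "256 * ((1 / 2) ^ u * (1 / 2) ^ v) \<le> 2048 * (1 / 2 :: real) ^ d * ((1 / 2) ^ u * (1 / 2) ^ v)"
        by (intro mult_right_mono) auto
      then show ?thesis by (simp only: mult.assoc)
    qed
    finally have "(2 powi i * 2 powi j) ^ 3 \<le> 2048 * ((1 / 2) ^ d * ((1 / 2) ^ u * (1 / 2 :: real) ^ v))" .
    then have "ennreal ((2 powi i * 2 powi j) ^ 3) \<le> ennreal (2048 * ((1 / 2) ^ d * ((1 / 2) ^ u * (1 / 2 :: real) ^ v)))"
      by (rule ennreal_leI)
    then show ?thesis by (simp add: e g_def p_def u_def v_def ennreal_mult)
  qed
  ultimately have "(\<integral>\<^sup>+(d, i, j). ennreal ((2 powi i * 2 powi j) ^ 3) \<partial>count_space siegel_indices)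
    \<le> (\<integral>\<^sup>+(d, u, v). ennreal 2048 * (p d * (p u * p v)) \<partial>count_space UNIV)"
    by (intro nn_integral_count_space_le_inj[of g]) (auto simp only: case_prod_beta)
  also have "\<dots> = ennreal 2048 * (\<integral>\<^sup>+x. p (fst x) * (p (fst (snd x)) * p (snd (snd x))) \<partial>count_space UNIV)"
    by (subst nn_integral_cmult[symmetric]) (simp_all add: case_prod_unfold)
  also have "(\<integral>\<^sup>+x. p (fst x) * (p (fst (snd x)) * p (snd (snd x))) \<partial>count_space UNIV) = P * (P * P)"
    using nn_integral_count_space_product[of p "\<lambda>y. p (fst y) * p (snd y)"] nn_integral_count_space_product[of p p]
    by (simp add: P_def)
  also have "ennreal 2048 * (P * (P * P)) < \<infinity>" using P by (simp add: ennreal_mult_less_top)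
  finally show ?thesis .
qed

section \<open>Both kinds of cells in one family\<close>

definition cell :: "cell_index \<Rightarrow> (real^3) set set" where
  "cell = case_sum (\<lambda>(d, i, j). siegel_cell i j) (\<lambda>(k, l, \<alpha>). white_cell k l \<alpha>)"

definition weight :: "cell_index \<Rightarrow> ennreal" where
  "weight = case_sum (\<lambda>(d, i, j). ennreal ((2 powi i * 2 powi j) ^ 3)) (\<lambda>_. 1)"

definition face_plane :: "cell_index \<Rightarrow> real^3" where
  "face_plane = case_sum (\<lambda>(d, i, j). (1 / real d) *\<^sub>R axis 3 1) (\<lambda>(k, l, \<alpha>). vector [real k / real (k + l), 1, 1])"

context
  fixes \<mu> :: "(real^3) set measure"
  assumes \<mu>: "invariant_measure \<mu>"
begin

text \<open>The parameter \<alpha> adds no summation, being the inverse of k modulo k + l. From k +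
  l \<ge> sqrt (k l) the bound 1 / (k l (k + l)) is at most k^(-3/2) l^(-3/2), so the double sum is
  dominated by a product of two convergent series.\<close>

lemma white_cells_finite:
  "(\<integral>\<^sup>+(k, l, \<alpha>). emeasure \<mu> (white_cell k l \<alpha>) \<partial>count_space white_indices) < \<infinity>"
proof -
  let ?K = "cone_of ` bounded_mats 4 (1 / 4)"
  define q where "q = (\<lambda>n::nat. ennreal (real n powr (- 3 / 2)))"
  define P where "P = (\<integral>\<^sup>+n. q n \<partial>count_space UNIV)"
  have P: "P < \<infinity>" unfolding P_def q_def
    by (intro nn_integral_count_space_summable) (auto simp: summable_real_powr_iff)
  have K: "emeasure \<mu> ?K < \<infinity>" using bounded_mats_measure[OF \<mu>, of "1/4" 4] by simp
  define g :: "nat \<times> nat \<times> nat \<Rightarrow> nat \<times> nat" where "g = (\<lambda>(k, l, \<alpha>). (k, l))"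
  have "inj_on g white_indices"
  proof (rule inj_onI)
    fix x y assume xy: "x \<in> white_indices" "y \<in> white_indices" "g x = g y"
    obtain k l \<alpha> \<beta> where e: "x = (k, l, \<alpha>)" "y = (k, l, \<beta>)" using xy(3) unfolding g_def by (cases x, cases y) auto
    have a: "\<alpha> < k + l" "\<beta> < k + l" "k * \<alpha> mod (k + l) = 1" "k * \<beta> mod (k + l) = 1"
      using xy unfolding e white_indices_def by auto
    have "\<alpha> * (k * \<beta>) mod (k + l) = \<alpha>" using a by (metis mod_mult_right_eq mult.right_neutral mod_less)
    moreover have "\<beta> * (k * \<alpha>) mod (k + l) = \<beta>" using a by (metis mod_mult_right_eq mult.right_neutral mod_less)
    ultimately have "\<alpha> = \<beta>" by (simp add: mult_ac)
    then show "x = y" by (simp add: e)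
  qed
  moreover have "(case x of (k, l, \<alpha>) \<Rightarrow> emeasure \<mu> (white_cell k l \<alpha>))
    \<le> 54 * emeasure \<mu> ?K * (q (fst (g x)) * q (snd (g x)))" if x: "x \<in> white_indices" for x
  proof -
    obtain k l \<alpha> where e: "x = (k, l, \<alpha>)" by (cases x)
    have kl: "0 < k" "0 < l" "4 \<le> k + l" "\<alpha> < k + l" using x by (auto simp: e white_indices_def)
    define t where "t = real (k * l * (k + l))"
    have t: "t > 0" using kl by (simp add: t_def)
    have b: "ennreal t * emeasure \<mu> (white_cell k l \<alpha>) \<le> 54 * emeasure \<mu> ?K"
      using white_cell_bound[OF \<mu> kl] by (simp only: t_def ennreal_of_nat_eq_real_of_nat)
    have "emeasure \<mu> (white_cell k l \<alpha>) = ennreal (1 / t) * (ennreal t * emeasure \<mu> (white_cell k l \<alpha>))"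
      using t by (simp add: mult.assoc[symmetric] flip: ennreal_mult)
    also have "\<dots> \<le> ennreal (1 / t) * (54 * emeasure \<mu> ?K)" using b by (rule mult_left_mono) simp
    also have "\<dots> \<le> ennreal (real k powr (- 3 / 2) * real l powr (- 3 / 2)) * (54 * emeasure \<mu> ?K)"
    proof (intro mult_right_mono ennreal_leI)
      have kp: "real k > 0" "real l > 0" using kl by auto
      have "real k * real l \<le> (real k + real l)\<^sup>2" using kp by (simp add: power2_eq_square algebra_simps)
      then have "sqrt (real k * real l) \<le> real k + real l" using kp by (intro real_le_lsqrt) auto
      then have "real k * real l * sqrt (real k * real l) \<le> t"
        unfolding t_def using kp by (simp add: mult_left_mono)
      then have "1 / t \<le> 1 / (real k * real l * sqrt (real k * real l))"
        using kp t by (intro divide_left_mono) auto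
      also have "real k * real l * sqrt (real k * real l) = (real k * real l) powr (3 / 2)"
      proof -
        have zz: "z powr (3 / 2) = z * sqrt z" if "0 < z" for z :: real
        proof -
          have "z powr (1 + 1 / 2) = z powr 1 * z powr (1 / 2)" by (rule powr_add)
          then show ?thesis using that by (simp add: powr_half_sqrt)
        qed
        show ?thesis by (rule sym, rule zz, rule mult_pos_pos[OF kp])
      qed
      also have "1 / (real k * real l) powr (3 / 2) = real k powr (- 3 / 2) * real l powr (- 3 / 2)"
      proof -
        have e: "- 3 / 2 = - (3 / 2 :: real)" by simp
        have "1 / (real k * real l) powr (3 / 2) = (real k * real l) powr (- (3 / 2))" by (rule powr_minus_divide[symmetric])
        also have "\<dots> = real k powr (- (3 / 2)) * real l powr (- (3 / 2))" by (rule powr_mult)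
        finally show ?thesis unfolding e .
      qed
      finally show "1 / t \<le> real k powr (- 3 / 2) * real l powr (- 3 / 2)" .
    qed simp
    finally show ?thesis by (simp add: e g_def q_def ennreal_mult mult_ac)
  qed
  ultimately have "(\<integral>\<^sup>+(k, l, \<alpha>). emeasure \<mu> (white_cell k l \<alpha>) \<partial>count_space white_indices)
    \<le> (\<integral>\<^sup>+y. 54 * emeasure \<mu> ?K * (q (fst y) * q (snd y)) \<partial>count_space UNIV)"
    by (rule nn_integral_count_space_le_inj)
  also have "\<dots> = 54 * emeasure \<mu> ?K * (P * P)"
    by (subst nn_integral_cmult) (auto simp: nn_integral_count_space_product P_def)
  also have "\<dots> < \<infinity>" using P K by (simp add: ennreal_mult_less_top)
  finally show ?thesis .
qed

lemma weighted_cells_finite: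
  "(\<integral>\<^sup>+i. weight i * emeasure \<mu> (cell i) \<partial>count_space (siegel_indices <+> white_indices)) < \<infinity>"
proof -
  let ?F = "\<lambda>i. weight i * emeasure \<mu> (cell i)"
  let ?\<kappa> = "emeasure \<mu> (cone_of ` bounded_mats 42 1)"
  have ind: "(\<integral>\<^sup>+i. h i \<partial>count_space X) = (\<integral>\<^sup>+i. h i * indicator X i \<partial>count_space UNIV)"
    for h :: "cell_index \<Rightarrow> ennreal" and X
    by (simp add: nn_integral_count_space_indicator)
  have "(\<integral>\<^sup>+i. ?F i \<partial>count_space (siegel_indices <+> white_indices))
    = (\<integral>\<^sup>+i. ?F i * indicator (Inl ` siegel_indices) i + ?F i * indicator (Inr ` white_indices) i \<partial>count_space UNIV)"
    unfolding ind[where X = "siegel_indices <+> white_indices"] by (intro nn_integral_cong) (auto simp: indicator_def)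
  also have "\<dots> = (\<integral>\<^sup>+i. ?F i \<partial>count_space (Inl ` siegel_indices)) + (\<integral>\<^sup>+i. ?F i \<partial>count_space (Inr ` white_indices))"
    by (simp add: nn_integral_add ind[where X = "Inl ` siegel_indices"] ind[where X = "Inr ` white_indices"])
  also have "(\<integral>\<^sup>+i. ?F i \<partial>count_space (Inl ` siegel_indices)) = (\<integral>\<^sup>+x. ?F (Inl x) \<partial>count_space siegel_indices)"
    by (intro nn_integral_bij_count_space[symmetric] inj_on_imp_bij_betw) simp
  also have "\<dots> = (\<integral>\<^sup>+(d, i, j). ennreal ((2 powi i * 2 powi j) ^ 3) \<partial>count_space siegel_indices) * ?\<kappa>"
    by (subst nn_integral_multc[symmetric])
       (auto simp: weight_def cell_def siegel_cell_measure[OF \<mu>] split: prod.splits intro!: nn_integral_cong)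
  also have "(\<integral>\<^sup>+i. ?F i \<partial>count_space (Inr ` white_indices)) = (\<integral>\<^sup>+x. ?F (Inr x) \<partial>count_space white_indices)"
    by (intro nn_integral_bij_count_space[symmetric] inj_on_imp_bij_betw) simp
  also have "\<dots> = (\<integral>\<^sup>+(k, l, \<alpha>). emeasure \<mu> (white_cell k l \<alpha>) \<partial>count_space white_indices)"
    by (intro nn_integral_cong) (auto simp: weight_def cell_def)
  also have "(\<integral>\<^sup>+(d, i, j). ennreal ((2 powi i * 2 powi j) ^ 3) \<partial>count_space siegel_indices) * ?\<kappa>
      + (\<integral>\<^sup>+(k, l, \<alpha>). emeasure \<mu> (white_cell k l \<alpha>) \<partial>count_space white_indices) < \<infinity>"
    using siegel_weights_finite white_cells_finite bounded_mats_measure(2)[OF \<mu>, of 1 42]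
    by (simp add: ennreal_mult_less_top)
  finally show ?thesis .
qed

text \<open>The normalization x_3 = d and \<open>good\<close> make all weights of the form
  \<open>m\<close> positive. The regime is then decided by \<open>e\<close>, the determinant of a
  smallest triangle of the face.\<close>

lemma cells_cover:
  assumes C: "generic_cone C" "face_of_sail f C" and fd: "f \<subseteq> {x. x $ 3 = real d}" and good: "\<not> ray_in_plane C"
  shows "finite f \<and> (\<exists>i\<in>siegel_indices <+> white_indices. \<exists>G. finite G \<and> G \<subseteq> SL3Z \<and> 1 \<le> weight i * of_nat (card G) \<and>
    (\<forall>\<gamma>\<in>G. act \<gamma> f \<subseteq> {x. face_plane i \<bullet> x = 1} \<and> act \<gamma> C \<in> cell i))"
proof -
  have "C \<in> cones" using C(1) by (simp add: generic_cone_def)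
  then obtain N where N: "det N = 1" "C = cone_of N" by (rule cones_cone_of)
  have N0: "det N > 0" using N by simp
  obtain m where f: "f = {x \<in> C \<inter> lattice. m \<bullet> x = 1}" and m: "\<And>x. x \<in> C \<inter> lattice \<Longrightarrow> x \<noteq> 0 \<Longrightarrow> 1 \<le> m \<bullet> x"
    and sp: "span f = UNIV" by (rule face_data[OF C]) blast
  have "\<exists>c. (\<forall>i. c i > 0) \<and> (\<forall>x. m \<bullet> x = (\<Sum>i\<in>UNIV. c i * (N $ i \<bullet> x)))"
    by (rule face_weights[OF C(1) N(2) N0 f m sp fd good]) (assumption | rule exI conjI allI)+
  then obtain c where c: "\<And>i. c i > 0" "\<And>x. m \<bullet> x = (\<Sum>i\<in>UNIV. c i * (N $ i \<bullet> x))" by metis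
  have fin: "finite f" by (rule face_finite[OF N(2) N0 f c])
  obtain p q r v e where b: "p \<in> f" "q \<in> f" "r \<in> f" "v \<in> lattice" "(e::nat) \<ge> 1"
    "det (cols p q r) = real e" "m \<bullet> v = 1 / real e" "det (cols (q - p) (r - p) v) = 1"
    by (rule lattice_basis_of_face[OF f[unfolded N(2)] sp])
  show ?thesis
  proof (cases "e \<le> 3")
    case True
    obtain i j G where s: "(2 powi i)\<^sup>2 * 2 powi j \<le> (18::real)" "2 powi i * (2 powi j)\<^sup>2 \<le> (18::real)"
      "finite G" "G \<subseteq> SL3Z" "1 \<le> (2 powi i * 2 powi j) ^ 3 * real (card G)"
      "\<And>\<gamma>. \<gamma> \<in> G \<Longrightarrow> act \<gamma> f \<subseteq> {x. x $ 3 = real e} \<and> act \<gamma> C \<in> siegel_cell i j"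
      by (rule siegel_cover[OF N(2) N0 f c b(1-4,7,8,5) True]) blast
    let ?i = "Inl (e, i, j) :: cell_index"
    have "?i \<in> siegel_indices <+> white_indices" using s True by (intro InlI) (simp add: siegel_indices_def)
    moreover have "1 \<le> weight ?i * of_nat (card G)"
    proof -
      have "ennreal 1 \<le> ennreal ((2 powi i * 2 powi j) ^ 3 * real (card G))" using s(5) by (rule ennreal_leI)
      then show ?thesis by (simp add: weight_def ennreal_mult ennreal_of_nat_eq_real_of_nat)
    qed
    moreover have "act \<gamma> f \<subseteq> {x. face_plane ?i \<bullet> x = 1} \<and> act \<gamma> C \<in> cell ?i" if "\<gamma> \<in> G" for \<gamma>
      using s(6)[OF that] b(5) by (auto simp: face_plane_def cell_def inner_axis' subset_iff)
    ultimately show ?thesis using fin s(3,4) by blast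
  next
    case False
    then have e4: "4 \<le> e" by simp
    obtain k l \<alpha> \<gamma> where w: "0 < k" "0 < l" "\<alpha> < k + l" "4 \<le> k + l" "k * \<alpha> mod (k + l) = 1" "\<gamma> \<in> SL3Z"
      "act \<gamma> f \<subseteq> {x. vector [real k / real (k + l), 1, 1] \<bullet> x = 1}" "act \<gamma> C \<in> white_cell k l \<alpha>"
      by (rule white_cover[OF C(1) N(2) N0 f _ b(1-3,6,4,7) e4]) (use m in blast)+
    let ?i = "Inr (k, l, \<alpha>) :: cell_index"
    have "?i \<in> siegel_indices <+> white_indices" using w by (intro InrI) (simp add: white_indices_def)
    moreover have "1 \<le> weight ?i * of_nat (card {\<gamma>})" by (simp add: weight_def)
    moreover have "act \<gamma> f \<subseteq> {x. face_plane ?i \<bullet> x = 1} \<and> act \<gamma> C \<in> cell ?i"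
      using w(7,8) by (simp add: face_plane_def cell_def)
    ultimately show ?thesis using fin w(6) by (intro conjI bexI[of _ ?i] exI[of _ "{\<gamma>}"]) auto
  qed
qed

lemma relative_frequency_bounded_sums:
  obtains T where "T < \<infinity>" "\<And>F. finite F \<Longrightarrow> F \<subseteq> face_classes \<Longrightarrow> (\<Sum>c\<in>F. rel_class \<mu> c) \<le> T"
proof -
  let ?I = "siegel_indices <+> white_indices"
  have cells: "cell i \<in> sets \<mu>" if "i \<in> ?I" for i
    using that siegel_cell_measure[OF \<mu>] white_cell_sets[OF \<mu>]
    by (auto simp: cell_def white_indices_def)
  have face: "span f = UNIV \<and> (\<exists>m. f = {x \<in> C \<inter> lattice. m \<bullet> x = 1})"
    if "generic_cone C" "face_of_sail f C" for C f
    by (rule face_data[OF that]) blast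
  obtain b :: nat where b: "\<And>F. finite F \<Longrightarrow> F \<subseteq> face_classes \<Longrightarrow>
    (\<Sum>c\<in>F. rel_class \<mu> c) \<le> of_nat b * (\<integral>\<^sup>+i. weight i * emeasure \<mu> (cell i) \<partial>count_space ?I)"
    by (rule frequency_sum_bound[OF \<mu> countableI_type cells sail_face_representative face cells_cover]) blast+
  show ?thesis
  proof
    show "of_nat b * (\<integral>\<^sup>+i. weight i * emeasure \<mu> (cell i) \<partial>count_space ?I) < \<infinity>"
      using weighted_cells_finite by (simp add: ennreal_mult_less_top of_nat_less_top)
  qed (rule b)
qed

end

theorem theorem1p9:
  fixes \<mu> :: "(real^3) set measure"
  assumes "invariant_measure \<mu>"
  shows "(\<Sum>\<^sub>\<infinity>c\<in>face_classes. rel_class \<mu> c) < \<infinity> \<and>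
    (\<forall>C::real. C > 0 \<longrightarrow> finite {c \<in> face_classes. rel_class \<mu> c > ennreal C})"
proof (intro conjI allI impI)
  obtain T where T: "T < \<infinity>" "\<And>F. finite F \<Longrightarrow> F \<subseteq> face_classes \<Longrightarrow> (\<Sum>c\<in>F. rel_class \<mu> c) \<le> T"
    using relative_frequency_bounded_sums[OF assms] by metis
  have "(\<Sum>\<^sub>\<infinity>c\<in>face_classes. rel_class \<mu> c) = (SUP F\<in>{F. finite F \<and> F \<subseteq> face_classes}. \<Sum>c\<in>F. rel_class \<mu> c)"
    by (rule nonneg_infsum_complete) simp
  also have "\<dots> \<le> T" using T(2) by (intro SUP_least) simp
  finally show "(\<Sum>\<^sub>\<infinity>c\<in>face_classes. rel_class \<mu> c) < \<infinity>" using T(1) by (rule le_less_trans)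
  fix C :: real assume C: "C > 0"
  show "finite {c \<in> face_classes. rel_class \<mu> c > ennreal C}"
  proof (rule ccontr)
    assume inf: "infinite {c \<in> face_classes. rel_class \<mu> c > ennreal C}"
    obtain t where t: "T = ennreal t" "0 \<le> t" using T(1) by (cases T) auto
    \<comment> \<open>So many classes above \<open>C\<close> would already have a sum beyond the
      bound \<open>T\<close> for finite partial sums.\<close>
    obtain n :: nat where n: "t < real n * C" using ex_less_of_nat_mult[OF C] by blast
    obtain F where F: "finite F" "card F = n" "F \<subseteq> {c \<in> face_classes. rel_class \<mu> c > ennreal C}"
      using infinite_arbitrarily_large[OF inf] by blast
    have "ennreal (real n * C) = (\<Sum>c\<in>F. ennreal C)"
      using C F(2) by (simp add: ennreal_mult ennreal_of_nat_eq_real_of_nat)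
    also have "\<dots> \<le> (\<Sum>c\<in>F. rel_class \<mu> c)" using F(3) by (intro sum_mono) (auto intro: less_imp_le)
    also have "\<dots> \<le> ennreal t" using T(2)[of F] F t by auto
    finally show False using n t by (simp add: ennreal_le_iff)
  qed
qed

end
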